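(* Let $y\in I^{\mathsf{fpf}}_\infty$. If $\mathfrak S^{\mathsf{Sp}}_y=\kappa^{\mathsf P}_\alpha$ for a skew-symmetric weak composition $\alpha$, then $y$ is fpf-vexillary. Conversely, suppose the following (conjectural) property holds: for every $v\in I^{\mathsf{fpf}}_\infty$, the polynomial $\mathfrak S^{\mathsf{Sp}}_v$ is a sum of distinct $P$-key polynomials, that is, there is a finite set $\mathcal X(v)$ of skew-symmetric weak compositions with $\mathfrak S^{\mathsf{Sp}}_v=\sum_{\alpha\in\mathcal X(v)}\kappa^{\mathsf P}_\alpha$ (the summands being distinct). If $y$ is fpf-vexillary, then $\mathfrak S^{\mathsf{Sp}}_y=\kappa^{\mathsf P}_\alpha$ for some skew-symmetric weak composition $\alpha$.
   Context: Let $\mathbb P=\{1,2,3,\dots\}$, $[n]=\{1,\dots,n\}$. $S_\infty$ is the group of permutations of $\mathbb P$ generated by $s_i=(i\;\,i+1)$; it acts on $\mathbb Z[x_1,x_2,\dots]$ by permuting variables. Define $\partial_if=(f-s_if)/(x_i-x_{i+1})$ and $\pi_i f=\partial_i(x_if)$; the $\pi_i$ satisfy the braid relations, so $\pi_w=\pi_{i_1}\cdots\pi_{i_l}$ is well-defined for any reduced word $i_1\cdots i_l$ of $w\in S_\infty$. Let $w_n=n\cdots321\in S_n$. A weak composition is a sequence $\alpha=(\alpha_1,\alpha_2,\dots)$ of nonnegative integers with finite sum. A partition is a weakly decreasing weak composition; it is strict if its nonzero parts are distinct. $S_\infty$ acts by $w\alpha=(\alpha_{w^{-1}(1)},\alpha_{w^{-1}(2)},\dots)$.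 Let $\lambda(\alpha)$ be the partition sorting $\alpha$ and $u(\alpha)$ the minimal-length $u\in S_\infty$ with $\alpha=u\lambda(\alpha)$. Let $\mathsf D_\mu=\{(i,j)\in\mathbb P\times\mathbb P:1\le j\le\mu_i\}$. An addable (removable) corner of a partition is a cell that can be added to (removed from) its Young diagram so that the result is again the Young diagram of a partition. A partition $\lambda$ is skew-symmetric if it equals its transpose and, for every $i$: if $(i,i)$ is a removable corner then $(i,i+1)$ is not an addable corner, and if $(i,i)$ is an addable corner then $(i,i-1)$ is not a removable corner. A weak composition $\alpha$ is skew-symmetric if $\lambda(\alpha)$ is. For a partition $\lambda$ equal to its transpose, $\mathrm{half}_<(\lambda)$ is the strict partition with nonzero parts $\{\lambda_i-i:i\in\mathbb P\}\cap\mathbb P$. For skew-symmetric $\alpha$, the $P$-key polynomial is $\kappa^{\mathsf P}_\alpha=\pi_{u(\alpha)}\prod_{(i,j)\in\mathsf D_\mu}(x_i+x_{i+j})$ with $\mu=\mathrm{half}_<(\lambda(\alpha))$. Let $I^{\mathsf{fpf}}_\infty$ be the $S_\infty$-conjugacy class of the bijection $1_{\mathsf{fpf}}=(1\;2)(3\;4)(5\;6)\cdots$ of $\mathbb P$. For $y\in I^{\mathsf{fpf}}_\infty$ let $D(y)=\{(i,y(j)):i<j,\ y(i)>y(j)\}$ and $D^{\mathsf{Sp}}(y)=\{(i,j)\in D(y):i>j\}$. For each skew-symmetric partition $\lambda$ there is a unique $y\in I^{\mathsf{fpf}}_\infty$ with $\{(i,j)\in D(y):i\ne j\}=\{(i,j)\in\mathsf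 D_\lambda:i\ne j\}$; such elements are called dominant. The symplectic involution Schubert polynomials $\{\mathfrak S^{\mathsf{Sp}}_y\}_{y\in I^{\mathsf{fpf}}_\infty}$ are the unique family of polynomials with $\mathfrak S^{\mathsf{Sp}}_y=\prod_{(i,j)\in D^{\mathsf{Sp}}(y)}(x_i+x_j)$ if $y$ is dominant, and, for all $i\in\mathbb P$, $\partial_i\mathfrak S^{\mathsf{Sp}}_y=0$ if $y(i)<y(i+1)$ or $y(i)=i+1$, and $\partial_i\mathfrak S^{\mathsf{Sp}}_y=\mathfrak S^{\mathsf{Sp}}_{s_iys_i}$ otherwise. For $y\in I^{\mathsf{fpf}}_\infty$, $P_y$ is the unique symmetric function with $P_y(x_1,\dots,x_n)=\pi_{w_n}\mathfrak S^{\mathsf{Sp}}_y$ whenever $D^{\mathsf{Sp}}(y)\subseteq[n]\times\mathbb P$. The element $y$ is fpf-vexillary if $P_y=P_\mu$ is a single Schur $P$-function for some strict partition $\mu$. *)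

theory Defs
  imports
    "HOL-Library.Poly_Mapping"
    "HOL-Combinatorics.Permutations"
    "HOL-Computational_Algebra.Fraction_Field"
begin

text \<open>
  The index set is the set of positive integers, modelled as the subset \<open>{1..}\<close> of \<open>nat\<close>.
  The spare index 0 is neutralised throughout: permutations fix it, weak compositions vanish
  there, and \<open>x\<^sub>0\<close> does not occur in the polynomials and power series considered.
\<close>


section \<open>Finitary permutations of the positive integers\<close>

abbreviation s :: "nat \<Rightarrow> nat \<Rightarrow> nat"
  where "s i \<equiv> Transposition.transpose i (i + 1)"

definition word_perm :: "nat list \<Rightarrow> nat \<Rightarrow> nat"
  where "word_perm ws = foldr (\<lambda>i w. s i \<circ> w) ws id"

text \<open>Since every \<open>s i\<close> is an involution, the products of the \<open>s i\<close> already form the group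
  generated by them.\<close>

definition S_inf :: "(nat \<Rightarrow> nat) set"
  where "S_inf = word_perm ` lists {1..}"

definition perm_length :: "(nat \<Rightarrow> nat) \<Rightarrow> nat"
  where "perm_length w = (LEAST l. \<exists>ws\<in>lists {1..}. word_perm ws = w \<and> length ws = l)"

definition reduced_word :: "nat list \<Rightarrow> (nat \<Rightarrow> nat) \<Rightarrow> bool"
  where "reduced_word ws w \<longleftrightarrow>
    ws \<in> lists {1..} \<and> word_perm ws = w \<and> length ws = perm_length w"

text \<open>The permutation \<open>n \<dots> 3 2 1\<close>.\<close>

definition w_rev :: "nat \<Rightarrow> nat \<Rightarrow> nat"
  where "w_rev n i = (if 1 \<le> i \<and> i \<le> n then n + 1 - i else i)"


section \<open>Polynomials and isobaric divided differences\<close>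

text \<open>Integer polynomials in \<open>x\<^sub>0, x\<^sub>1, x\<^sub>2, \<dots>\<close>, as finitely supported functions
  from monomials (exponent vectors) to coefficients.\<close>

type_synonym zpoly = "(nat \<Rightarrow>\<^sub>0 nat) \<Rightarrow>\<^sub>0 int"

definition X :: "nat \<Rightarrow> zpoly"
  where "X i = Poly_Mapping.single (Poly_Mapping.single i 1) 1"

definition poly_ring_P :: "zpoly set"
  where "poly_ring_P = {f. \<forall>m\<in>Poly_Mapping.keys f. Poly_Mapping.keys m \<subseteq> {1..}}"

text \<open>The action of \<open>w\<close> by substituting \<open>x\<^bsub>w i\<^esub>\<close> for \<open>x\<^sub>i\<close>.\<close>

definition permute_vars :: "(nat \<Rightarrow> nat) \<Rightarrow> zpoly \<Rightarrow> zpoly"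
  where "permute_vars w f =
    (\<Sum>m\<in>Poly_Mapping.keys f. of_int (Poly_Mapping.lookup f m) *
       (\<Prod>i\<in>Poly_Mapping.keys m. X (w i) ^ Poly_Mapping.lookup m i))"

text \<open>The quotient \<open>(f - s\<^sub>i f) / (x\<^sub>i - x\<^bsub>i+1\<^esub>)\<close>, which is exact; it is unique
  because \<^typ>\<open>zpoly\<close> is an integral domain.\<close>

definition divdiff :: "nat \<Rightarrow> zpoly \<Rightarrow> zpoly"
  where "divdiff i f = (THE g. g * (X i - X (i + 1)) = f - permute_vars (s i) f)"

definition pi_op :: "nat \<Rightarrow> zpoly \<Rightarrow> zpoly"
  where "pi_op i f = divdiff i (X i * f)"

text \<open>By the braid relations the choice of reduced word is immaterial.\<close>

definition pi_perm :: "(nat \<Rightarrow> nat) \<Rightarrow> zpoly \<Rightarrow> zpoly"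
  where "pi_perm w = foldr pi_op (SOME ws. reduced_word ws w)"


section \<open>Weak compositions and partitions\<close>

definition weak_composition :: "(nat \<Rightarrow> nat) \<Rightarrow> bool"
  where "weak_composition \<alpha> \<longleftrightarrow> \<alpha> 0 = 0 \<and> finite {i. \<alpha> i \<noteq> 0}"

definition is_partition :: "(nat \<Rightarrow> nat) \<Rightarrow> bool"
  where "is_partition \<mu> \<longleftrightarrow> weak_composition \<mu> \<and> (\<forall>i\<ge>1. \<mu> (i + 1) \<le> \<mu> i)"

definition strict_partition :: "(nat \<Rightarrow> nat) \<Rightarrow> bool"
  where "strict_partition \<mu> \<longleftrightarrow> is_partition \<mu> \<and> inj_on \<mu> {i. \<mu> i \<noteq> 0}"

definition perm_act :: "(nat \<Rightarrow> nat) \<Rightarrow> (nat \<Rightarrow> nat) \<Rightarrow> (nat \<Rightarrow> nat)"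
  where "perm_act w \<alpha> = \<alpha> \<circ> inv w"

definition sort_comp :: "(nat \<Rightarrow> nat) \<Rightarrow> (nat \<Rightarrow> nat)"
  where "sort_comp \<alpha> = (THE \<mu>. is_partition \<mu> \<and> (\<exists>w\<in>S_inf. \<alpha> = perm_act w \<mu>))"

definition min_sorter :: "(nat \<Rightarrow> nat) \<Rightarrow> (nat \<Rightarrow> nat)"
  where "min_sorter \<alpha> =
    (THE u. u \<in> S_inf \<and> \<alpha> = perm_act u (sort_comp \<alpha>) \<and>
       (\<forall>v\<in>S_inf. \<alpha> = perm_act v (sort_comp \<alpha>) \<longrightarrow> perm_length u \<le> perm_length v))"

definition diagram :: "(nat \<Rightarrow> nat) \<Rightarrow> (nat \<times> nat) set"
  where "diagram \<mu> = {(i, j). 1 \<le> i \<and> 1 \<le> j \<and> j \<le> \<mu> i}"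

definition addable_corner :: "(nat \<Rightarrow> nat) \<Rightarrow> nat \<times> nat \<Rightarrow> bool"
  where "addable_corner \<mu> c \<longleftrightarrow>
    c \<notin> diagram \<mu> \<and> (\<exists>\<nu>. is_partition \<nu> \<and> diagram \<nu> = insert c (diagram \<mu>))"

definition removable_corner :: "(nat \<Rightarrow> nat) \<Rightarrow> nat \<times> nat \<Rightarrow> bool"
  where "removable_corner \<mu> c \<longleftrightarrow>
    c \<in> diagram \<mu> \<and> (\<exists>\<nu>. is_partition \<nu> \<and> diagram \<nu> = diagram \<mu> - {c})"

text \<open>The relational converse of a Young diagram is the diagram of the transposed partition.
  For \<open>i = 1\<close> the cell \<open>(i, i - 1) = (1, 0)\<close> is never a removable corner.\<close>

definition skew_symmetric_partition :: "(nat \<Rightarrow> nat) \<Rightarrow> bool"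
  where "skew_symmetric_partition \<mu> \<longleftrightarrow>
    is_partition \<mu> \<and> (diagram \<mu>)\<inverse> = diagram \<mu> \<and>
    (\<forall>i\<ge>1. (removable_corner \<mu> (i, i) \<longrightarrow> \<not> addable_corner \<mu> (i, i + 1)) \<and>
           (addable_corner \<mu> (i, i) \<longrightarrow> \<not> removable_corner \<mu> (i, i - 1)))"

definition skew_symmetric :: "(nat \<Rightarrow> nat) \<Rightarrow> bool"
  where "skew_symmetric \<alpha> \<longleftrightarrow> weak_composition \<alpha> \<and> skew_symmetric_partition (sort_comp \<alpha>)"

definition half_lt :: "(nat \<Rightarrow> nat) \<Rightarrow> (nat \<Rightarrow> nat)"
  where "half_lt \<mu> = (THE \<nu>. strict_partition \<nu> \<and>
    {\<nu> i |i. \<nu> i \<noteq> 0} = {\<mu> i - i |i. 1 \<le> i \<and> i < \<mu> i})"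

definition P_key :: "(nat \<Rightarrow> nat) \<Rightarrow> zpoly"
  where "P_key \<alpha> = pi_perm (min_sorter \<alpha>)
    (\<Prod>(i, j)\<in>diagram (half_lt (sort_comp \<alpha>)). X i + X (i + j))"


section \<open>Fixed-point-free involutions and symplectic involution Schubert polynomials\<close>

definition one_fpf :: "nat \<Rightarrow> nat"
  where "one_fpf i = (if i = 0 then 0 else if odd i then i + 1 else i - 1)"

definition I_fpf :: "(nat \<Rightarrow> nat) set"
  where "I_fpf = {w \<circ> one_fpf \<circ> inv w |w. w \<in> S_inf}"

definition D :: "(nat \<Rightarrow> nat) \<Rightarrow> (nat \<times> nat) set"
  where "D y = {(i, y j) |i j. 1 \<le> i \<and> i < j \<and> y i > y j}"

definition D_Sp :: "(nat \<Rightarrow> nat) \<Rightarrow> (nat \<times> nat) set"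
  where "D_Sp y = {(i, j) \<in> D y. i > j}"

definition dominant :: "(nat \<Rightarrow> nat) \<Rightarrow> bool"
  where "dominant y \<longleftrightarrow> y \<in> I_fpf \<and>
    (\<exists>\<mu>. skew_symmetric_partition \<mu> \<and>
       {(i, j) \<in> D y. i \<noteq> j} = {(i, j) \<in> diagram \<mu>. i \<noteq> j})"

text \<open>The family of symplectic involution Schubert polynomials is the unique one with the
  following properties; only its values on \<^const>\<open>I_fpf\<close> matter.\<close>

definition Sp_Schubert_family :: "((nat \<Rightarrow> nat) \<Rightarrow> zpoly) \<Rightarrow> bool"
  where "Sp_Schubert_family S \<longleftrightarrow>
    (\<forall>y\<in>I_fpf. S y \<in> poly_ring_P) \<and>
    (\<forall>y. dominant y \<longrightarrow> S y = (\<Prod>(i, j)\<in>D_Sp y. X i + X j)) \<and>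
    (\<forall>y\<in>I_fpf. \<forall>i\<ge>1. divdiff i (S y) =
       (if y i < y (i + 1) \<or> y i = i + 1 then 0 else S (s i \<circ> y \<circ> s i)))"


section \<open>Symmetric functions and fpf-vexillary involutions\<close>

text \<open>Symmetric functions over the integers: formal power series of bounded degree in
  \<open>x\<^sub>1, x\<^sub>2, \<dots>\<close>, given by their coefficients, that are invariant under \<^const>\<open>S_inf\<close>.
  The exponent vector \<open>Poly_Mapping.map_key w m\<close> is \<open>m \<circ> w\<close>.\<close>

type_synonym zseries = "(nat \<Rightarrow>\<^sub>0 nat) \<Rightarrow> int"

definition symmetric_function :: "zseries \<Rightarrow> bool"
  where "symmetric_function F \<longleftrightarrow>
    (\<forall>m. F m \<noteq> 0 \<longrightarrow> Poly_Mapping.keys m \<subseteq> {1..}) \<and>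
    (\<exists>d. \<forall>m. F m \<noteq> 0 \<longrightarrow> (\<Sum>i\<in>Poly_Mapping.keys m. Poly_Mapping.lookup m i) \<le> d) \<and>
    (\<forall>w\<in>S_inf. \<forall>m. F (Poly_Mapping.map_key w m) = F m)"

text \<open>\<open>F(x\<^sub>1, \<dots>, x\<^sub>n)\<close>, i.e. \<open>F\<close> with \<open>x\<^sub>i = 0\<close> for \<open>i > n\<close>. The bounded degree of \<open>F\<close>
  makes this a polynomial.\<close>

definition restrict_vars :: "nat \<Rightarrow> zseries \<Rightarrow> zpoly"
  where "restrict_vars n F =
    Abs_poly_mapping (\<lambda>m. if Poly_Mapping.keys m \<subseteq> {1..n} then F m else 0)"

definition P_invol :: "((nat \<Rightarrow> nat) \<Rightarrow> zpoly) \<Rightarrow> (nat \<Rightarrow> nat) \<Rightarrow> zseries"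
  where "P_invol S y = (THE F. symmetric_function F \<and>
    (\<forall>n. D_Sp y \<subseteq> {1..n} \<times> {1..} \<longrightarrow> restrict_vars n F = pi_perm (w_rev n) (S y)))"

definition parts_length :: "(nat \<Rightarrow> nat) \<Rightarrow> nat"
  where "parts_length \<mu> = card {i. \<mu> i \<noteq> 0}"

text \<open>The Schur \<open>P\<close>-function of a strict partition \<open>\<mu>\<close> with \<open>l\<close> nonzero parts is the
  Hall-Littlewood \<open>P\<close>-function at \<open>t = -1\<close>: for all \<open>n \<ge> l\<close>, \<open>P\<^sub>\<mu>(x\<^sub>1, \<dots>, x\<^sub>n)\<close> is the
  sum over \<open>w \<in> S\<^sub>n / S\<^bsub>n-l\<^esub>\<close> of
  \<open>w (x\<^sub>1\<^bsup>\<mu>(1)\<^esup> \<dots> x\<^sub>l\<^bsup>\<mu>(l)\<^esup> \<Prod>\<^bsub>i \<le> l, i < j \<le> n\<^esub> (x\<^sub>i + x\<^sub>j) / (x\<^sub>i - x\<^sub>j))\<close>,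
  where \<open>S\<^bsub>n-l\<^esub>\<close> permutes \<open>{l + 1..n}\<close>. Summing over all of \<open>S\<^sub>n\<close> counts every coset
  \<open>(n - l)!\<close> times.\<close>

definition schur_P_summand :: "(nat \<Rightarrow> nat) \<Rightarrow> nat \<Rightarrow> (nat \<Rightarrow> nat) \<Rightarrow> zpoly fract"
  where "schur_P_summand \<mu> n w =
    Fract ((\<Prod>i = 1..parts_length \<mu>. X (w i) ^ \<mu> i) *
           (\<Prod>i = 1..parts_length \<mu>. \<Prod>j = i + 1..n. X (w i) + X (w j)))
          (\<Prod>i = 1..parts_length \<mu>. \<Prod>j = i + 1..n. X (w i) - X (w j))"

definition schur_P :: "(nat \<Rightarrow> nat) \<Rightarrow> zseries"
  where "schur_P \<mu> = (THE F. symmetric_function F \<and>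
    (\<forall>n \<ge> parts_length \<mu>.
       of_nat (fact (n - parts_length \<mu>)) * Fract (restrict_vars n F) 1 =
       (\<Sum>w | w permutes {1..n}. schur_P_summand \<mu> n w)))"

definition fpf_vexillary :: "((nat \<Rightarrow> nat) \<Rightarrow> zpoly) \<Rightarrow> (nat \<Rightarrow> nat) \<Rightarrow> bool"
  where "fpf_vexillary S y \<longleftrightarrow> (\<exists>\<mu>. strict_partition \<mu> \<and> P_invol S y = schur_P \<mu>)"

end

theory Submission
  imports Defs "HOL-Combinatorics.Multiset_Permutations" "HOL-Computational_Algebra.Polynomial"
begin

text \<open>
  Everything is decided by evaluating polynomials at points with pairwise distinct coordinates.
  For a polynomial \<open>f\<close> in \<open>n\<close> variables and a point whose first \<open>n\<close> coordinates form the set \<open>A\<close>, the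
  value of \<open>\<pi>\<^bsub>w\<^esub> f\<close> for \<open>w = w\<^sub>n\<close> is given by the symmetrizer: the sum over all orderings \<open>x\<^sub>1, \<dots>, x\<^sub>n\<close> of \<open>A\<close> of
  \<open>f(x) \<Prod>\<^bsub>i < j\<^esub> x\<^sub>i / (x\<^sub>i - x\<^sub>j)\<close> (\<open>eval_pi_w_rev\<close>). Two consequences are formal. The symmetrizer
  absorbs every \<open>\<pi>\<^sub>i\<close> with \<open>i < n\<close> (\<open>symmetrize_pi_op\<close>), and setting the last of \<open>n + 1\<close> variables
  to 0 turns the operator for \<open>n + 1\<close> into the operator for \<open>n\<close> (\<open>pi_w_rev_stable\<close>). The latter
  makes \<open>P\<^sub>y\<close> exist, because \<open>S\<^sub>y\<close> involves only \<open>x\<^sub>1, \<dots>, x\<^sub>n\<close> when the symplectic diagram of \<open>y\<close>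
  lies in the first \<open>n\<close> rows. The former shows that a \<open>P\<close>-key polynomial has the same
  symmetrization as its dominant version, the staircase product \<open>\<Prod> (x\<^sub>i + x\<^bsub>i+j\<^esub>)\<close> over the diagram
  of the half partition \<open>\<nu>\<close>.

  The heart of the matter is that this staircase product symmetrizes to the Schur \<open>P\<close>-function
  \<open>P\<^sub>\<nu>\<close> in \<open>n\<close> variables as soon as \<open>n\<close> exceeds the largest part \<open>\<nu>\<^sub>1\<close> (\<open>sum_staircase_product\<close>).
  For \<open>n = \<nu>\<^sub>1 + 1\<close> the first row of the product involves all variables, and one peels off one row
  at a time. A further variable is added with the identity
  \<open>\<Sum>\<^bsub>a \<in> A\<^esub> (\<Prod>\<^bsub>j \<noteq> a\<^esub> j / (j - a)) P\<^sub>\<nu>(A - {a}) = P\<^sub>\<nu>(A)\<close> (\<open>schur_P_at_interpolation\<close>). This is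
  Lagrange interpolation: \<open>P\<^sub>\<nu>(A \<union> {z})\<close> is a polynomial in \<open>z\<close> of degree at most \<open>\<nu>\<^sub>1 < |A|\<close>; its
  value at 0 is \<open>P\<^sub>\<nu>(A)\<close>, and its value at \<open>- a\<close> is \<open>P\<^sub>\<nu>(A - {a})\<close> by the cancellation property
  \<open>P\<^sub>\<nu>(t, - t, \<dots>) = P\<^sub>\<nu>(\<dots>)\<close>.

  Hence, if \<open>S\<^sub>y\<close> is a \<open>P\<close>-key polynomial, then \<open>P\<^sub>y\<close> is a Schur \<open>P\<close>-function. Conversely, if \<open>S\<^sub>y\<close> is
  a sum of \<open>P\<close>-key polynomials, then \<open>P\<^sub>y\<close> is the sum of as many Schur \<open>P\<close>-functions, and by their
  linear independence (\<open>schur_P_at_linear_independence\<close>) this sum can be a single \<open>P\<^sub>\<mu>\<close> only if it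
  has exactly one term.
\<close>

abbreviation keys :: "('a \<Rightarrow>\<^sub>0 'b::zero) \<Rightarrow> 'a set"
  where "keys \<equiv> Poly_Mapping.keys"

abbreviation lookup :: "('a \<Rightarrow>\<^sub>0 'b::zero) \<Rightarrow> 'a \<Rightarrow> 'b"
  where "lookup \<equiv> Poly_Mapping.lookup"

abbreviation single :: "'a \<Rightarrow> 'b \<Rightarrow> 'a \<Rightarrow>\<^sub>0 'b::zero"
  where "single \<equiv> Poly_Mapping.single"

abbreviation linear_factors :: "'a::field set \<Rightarrow> 'a poly"
  where "linear_factors A \<equiv> \<Prod>j\<in>A. [:- j, 1:]"

text \<open>The coefficient of the value at \<open>- a\<close> in Lagrange interpolation at 0, where the other nodes are the
  negatives of the elements of \<open>A\<close>.\<close>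

abbreviation node_factor :: "'a::field \<Rightarrow> 'a set \<Rightarrow> 'a"
  where "node_factor a A \<equiv> \<Prod>j\<in>A. j / (j - a)"

text \<open>The factor of a variable with value \<open>b\<close> in the Hall-Littlewood formula at \<open>t = -1\<close>, where \<open>A\<close> holds the
  values of the variables that are chosen after it.\<close>

abbreviation hl_factor :: "'a::field \<Rightarrow> 'a set \<Rightarrow> 'a"
  where "hl_factor b A \<equiv> \<Prod>j\<in>A. (b + j) / (b - j)"

abbreviation orderings :: "'a set \<Rightarrow> 'a list set"
  where "orderings \<equiv> permutations_of_set"

section \<open>Orderings of a finite set and Lagrange interpolation\<close>

lemma sum_permutations_of_set_Cons:
  assumes "finite A" "A \<noteq> {}"
  shows "sum g (orderings A) =
    (\<Sum>b\<in>A. \<Sum>xs\<in>orderings (A - {b}). g (b # xs))"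
proof -
  have "orderings A = (\<Union>b\<in>A. (#) b ` orderings (A - {b}))"
    using assms by (intro permutations_of_set_nonempty) auto
  also have "sum g \<dots> = (\<Sum>b\<in>A. sum g ((#) b ` orderings (A - {b})))"
    using assms by (intro sum.UNION_disjoint) auto
  also have "\<dots> = (\<Sum>b\<in>A. \<Sum>xs\<in>orderings (A - {b}). g (b # xs))"
    by (rule sum.cong[OF refl], subst sum.reindex) (auto simp: inj_on_def)
  finally show ?thesis .
qed

lemma sum_permutations_of_set_snoc:
  assumes "finite A" "A \<noteq> {}"
  shows "sum g (orderings A) =
    (\<Sum>a\<in>A. \<Sum>xs\<in>orderings (A - {a}). g (xs @ [a]))"
proof -
  have rev: "sum h (orderings B) = sum (\<lambda>xs. h (rev xs)) (orderings B)"
    for h :: "'a list \<Rightarrow> 'b" and B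
  proof -
    have "sum h (orderings B) = sum h (rev ` orderings B)" by simp
    also have "\<dots> = sum (\<lambda>xs. h (rev xs)) (orderings B)"
      by (subst sum.reindex) auto
    finally show ?thesis .
  qed
  have "sum g (orderings A) = (\<Sum>a\<in>A. \<Sum>xs\<in>orderings (A - {a}). g (rev xs @ [a]))"
    by (subst rev, subst sum_permutations_of_set_Cons) (use assms in auto)
  also have "\<dots> = (\<Sum>a\<in>A. \<Sum>xs\<in>orderings (A - {a}). g (xs @ [a]))"
    by (rule sum.cong[OF refl], subst rev) simp
  finally show ?thesis .
qed

lemma sum_eq_single_term:
  assumes "finite A" "x \<in> A" "\<And>b. b \<in> A - {x} \<Longrightarrow> f b = 0"
  shows "sum f A = f x"
  using sum.mono_neutral_right[of A "{x}" f] assms by auto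

lemma lagrange_interpolation:
  fixes p :: "'a::field poly"
  assumes "finite A" "degree p < card A"
  shows "p = (\<Sum>a\<in>A. smult (poly p a / (\<Prod>j\<in>A-{a}. a - j)) (linear_factors (A - {a})))"
    (is "_ = ?q")
proof (rule poly_eqI_degree[of A])
  show "poly p x = poly ?q x" if "x \<in> A" for x
  proof -
    have z: "(\<Prod>j\<in>A-{a}. x - j) = 0" if "a \<in> A - {x}" for a
      using that \<open>x \<in> A\<close> assms(1) by (intro prod_zero) auto
    have nz: "(\<Prod>j\<in>A-{x}. x - j) \<noteq> 0" using assms(1) by simp
    have "poly ?q x = (\<Sum>a\<in>A. poly p a / (\<Prod>j\<in>A-{a}. a - j) * (\<Prod>j\<in>A-{a}. x - j))"
      by (simp add: poly_sum poly_prod)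
    also have "\<dots> = poly p x / (\<Prod>j\<in>A-{x}. x - j) * (\<Prod>j\<in>A-{x}. x - j)"
      using assms(1) that z by (intro sum_eq_single_term) auto
    also have "\<dots> = poly p x" using nz by simp
    finally show ?thesis by simp
  qed
  have "degree ?q \<le> card A - 1"
  proof (rule degree_sum_le[OF assms(1)])
    fix a assume "a \<in> A"
    then have "degree (linear_factors (A - {a})) = card A - 1"
      using assms(1) by (subst degree_prod_eq_sum_degree) auto
    then show "degree (smult (poly p a / (\<Prod>j\<in>A-{a}. a - j)) (linear_factors (A - {a}))) \<le> card A - 1"
      by (metis degree_smult_le)
  qed
  then show "card A > degree ?q" using assms(2) by linarith
qed (use assms in auto)

text \<open>The nodes are the negatives of the elements of \<open>A\<close>, since the cancellation property of Schur
  \<open>P\<close>-functions supplies the values at these points.\<close>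

lemma lagrange_interpolation_at_0:
  fixes p :: "'a::field poly"
  assumes "finite A" "degree p < card A"
  shows "poly p 0 = (\<Sum>a\<in>A. node_factor a (A - {a}) * poly p (- a))"
proof -
  define q where "q = pcompose p [:0, -1:]"
  have "degree q < card A" using assms(2) by (simp add: q_def degree_pcompose)
  from lagrange_interpolation[OF assms(1) this]
  have "poly q 0 = poly (\<Sum>a\<in>A. smult (poly q a / (\<Prod>j\<in>A-{a}. a - j)) (linear_factors (A - {a}))) 0"
    by simp
  also have "\<dots> = (\<Sum>a\<in>A. poly q a / (\<Prod>j\<in>A-{a}. a - j) * (\<Prod>j\<in>A-{a}. - j))"
    by (simp add: poly_sum poly_prod)
  also have "\<dots> = (\<Sum>a\<in>A. node_factor a (A - {a}) * poly p (- a))"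
  proof (intro sum.cong refl)
    fix a
    have "(\<Prod>j\<in>A-{a}. - j) / (\<Prod>j\<in>A-{a}. a - j) = node_factor a (A - {a})"
      unfolding prod_dividef[symmetric]
      by (intro prod.cong refl) (metis minus_diff_eq minus_divide_divide minus_minus)
    moreover have "poly q a = poly p (- a)" by (simp add: q_def poly_pcompose)
    ultimately show "poly q a / (\<Prod>j\<in>A-{a}. a - j) * (\<Prod>j\<in>A-{a}. - j) = node_factor a (A - {a}) * poly p (- a)"
      by (metis mult.commute times_divide_eq_left times_divide_eq_right)
  qed
  finally show ?thesis by (simp add: q_def poly_pcompose)
qed

text \<open>This is the coefficient of \<open>x\<^bsup>n-1\<^esup>\<close> in the interpolation formula for \<open>x\<^bsup>n-1\<^esup>\<close>, where \<open>n = |A|\<close>.\<close>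

lemma lagrange_leading_coefficient:
  fixes A :: "'a::field set"
  assumes "finite A" "A \<noteq> {}"
  shows "(\<Sum>a\<in>A. \<Prod>j\<in>A-{a}. a / (a - j)) = 1"
proof -
  define n where "n = card A - 1"
  have n: "card (A - {a}) = n" if "a \<in> A" for a using that assms by (simp add: n_def)
  define p where "p = monom (1::'a) n"
  have "degree p < card A" using assms by (simp add: p_def n_def degree_monom_eq card_gt_0_iff)
  from lagrange_interpolation[OF assms(1) this]
  have "coeff p n = coeff (\<Sum>a\<in>A. smult (poly p a / (\<Prod>j\<in>A-{a}. a - j)) (linear_factors (A - {a}))) n"
    by simp
  also have "\<dots> = (\<Sum>a\<in>A. poly p a / (\<Prod>j\<in>A-{a}. a - j) * coeff (linear_factors (A - {a})) n)"
    by (simp add: coeff_sum)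
  also have "\<dots> = (\<Sum>a\<in>A. \<Prod>j\<in>A-{a}. a / (a - j))"
  proof (intro sum.cong refl)
    fix a assume a: "a \<in> A"
    have "degree (linear_factors (A - {a})) = n"
      using assms(1) n[OF a] by (subst degree_prod_eq_sum_degree) auto
    moreover have "lead_coeff (linear_factors (A - {a})) = 1"
      by (simp add: lead_coeff_prod)
    ultimately have 1: "coeff (linear_factors (A - {a})) n = 1" by simp
    have "poly p a = (\<Prod>j\<in>A-{a}. a)" using n[OF a] by (simp add: p_def poly_monom)
    then show "poly p a / (\<Prod>j\<in>A-{a}. a - j) * coeff (linear_factors (A - {a})) n = (\<Prod>j\<in>A-{a}. a / (a - j))"
      unfolding 1 prod_dividef by simp
  qed
  finally show ?thesis by (simp add: p_def)
qed

lemma prod_linear_factors_dvd: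
  fixes p :: "'a::field poly"
  assumes "finite A" "\<And>a. a \<in> A \<Longrightarrow> poly p a = 0"
  shows "linear_factors A dvd p"
  using assms
proof (induction A)
  case (insert a A)
  then obtain q where q: "p = linear_factors A * q" by auto
  have "poly p a = (\<Prod>j\<in>A. a - j) * poly q a" by (simp add: q poly_prod)
  moreover have "poly p a = 0" "(\<Prod>j\<in>A. a - j) \<noteq> 0" using insert by auto
  ultimately have "poly q a = 0" by simp
  then obtain r where "q = [:- a, 1:] * r" by (meson dvdE poly_eq_0_iff_dvd)
  then have "p = linear_factors (insert a A) * r" unfolding prod.insert[OF insert.hyps] q by (simp only: mult_ac)
  then show ?case by simp
qed simp

section \<open>Schur P-functions of a finite set of values\<close>

text \<open>The Hall-Littlewood formula at \<open>t = -1\<close> as a sum over cosets: the variable that carries the first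
  part is chosen first, then the one that carries the second part, and so on. As a function of a
  set of values it is symmetric by construction.\<close>

fun schur_P_at :: "nat list \<Rightarrow> 'a::field set \<Rightarrow> 'a"
  where "schur_P_at [] A = 1"
  | "schur_P_at (m # \<mu>) A = (\<Sum>b\<in>A. b ^ m * hl_factor b (A - {b}) * schur_P_at \<mu> (A - {b}))"

definition strict_parts :: "nat list \<Rightarrow> bool"
  where "strict_parts \<mu> \<longleftrightarrow> sorted_wrt (>) \<mu> \<and> 0 \<notin> set \<mu>"

definition largest_part :: "nat list \<Rightarrow> nat"
  where "largest_part \<mu> = hd (\<mu> @ [0])"

text \<open>The case \<open>a = b\<close> excludes \<open>0\<close> and characteristic 2. For such a set, \<open>0\<close> and the negatives of the
  elements of \<open>A\<close> lie outside of \<open>A\<close>, so that they can serve as an additional value.\<close>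

definition antipode_free :: "'a::field set \<Rightarrow> bool"
  where "antipode_free A \<longleftrightarrow> finite A \<and> (\<forall>a\<in>A. \<forall>b\<in>A. a + b \<noteq> 0)"

lemma largest_part_simps [simp]: "largest_part [] = 0" "largest_part (m # \<mu>) = m"
  by (simp_all add: largest_part_def)

lemma strict_parts_simps [simp]:
  "strict_parts []" "strict_parts (m # \<mu>) \<longleftrightarrow> largest_part \<mu> < m \<and> strict_parts \<mu>"
  by (cases \<mu>; fastforce simp: strict_parts_def largest_part_def)+

lemma antipode_free_subset: "antipode_free A \<Longrightarrow> B \<subseteq> A \<Longrightarrow> antipode_free B"
  unfolding antipode_free_def by (meson finite_subset subsetD)

text \<open>A summand in which the value 0 carries a positive part vanishes; in the others 0 contributes the
  factors \<open>(b + 0) / (b - 0) = 1\<close>.\<close>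

lemma schur_P_at_insert_0:
  assumes "finite A" "0 \<notin> A" "strict_parts \<mu>"
  shows "schur_P_at \<mu> (insert 0 A) = schur_P_at \<mu> A"
  using assms
proof (induction \<mu> arbitrary: A)
  case (Cons m \<mu>)
  have "schur_P_at (m # \<mu>) (insert 0 A) = (\<Sum>b\<in>A. b ^ m * hl_factor b (insert 0 A - {b}) * schur_P_at \<mu> (insert 0 A - {b}))"
    using Cons.prems by simp
  also have "\<dots> = schur_P_at (m # \<mu>) A"
    unfolding schur_P_at.simps
  proof (intro sum.cong refl)
    fix b assume b: "b \<in> A"
    then have "insert 0 A - {b} = insert 0 (A - {b})" "b \<noteq> 0" using Cons.prems by auto
    moreover have "schur_P_at \<mu> (insert 0 (A - {b})) = schur_P_at \<mu> (A - {b})"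
      using Cons.prems by (intro Cons.IH) auto
    ultimately show "b ^ m * hl_factor b (insert 0 A - {b}) * schur_P_at \<mu> (insert 0 A - {b})
        = b ^ m * hl_factor b (A - {b}) * schur_P_at \<mu> (A - {b})"
      using Cons.prems by simp
  qed
  finally show ?case .
qed simp

text \<open>If \<open>t\<close> or \<open>- t\<close> carries a part, then the factor \<open>t + (- t)\<close> occurs. Otherwise the factors of \<open>t\<close> and
  \<open>- t\<close> cancel each other.\<close>

lemma schur_P_at_cancellation:
  assumes "finite A" "t \<notin> A" "- t \<notin> A" "t + t \<noteq> 0"
  shows "schur_P_at \<mu> (insert t (insert (- t) A)) = schur_P_at \<mu> A"
  using assms
proof (induction \<mu> arbitrary: A)
  case (Cons m \<mu>)
  let ?B = "insert t (insert (- t) A)"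
  define g where "g B b = b ^ m * hl_factor b (B - {b}) * schur_P_at \<mu> (B - {b})" for b and B :: "'a set"
  have ne: "t \<noteq> - t" using Cons.prems by (metis add.right_inverse)
  have 0: "g ?B b = 0" if "b = t \<or> b = - t" for b
  proof -
    have "hl_factor b (?B - {b}) = 0"
      using that ne Cons.prems(1) by (intro prod_zero[of _] bexI[of _ "- b"]) auto
    then show ?thesis by (simp add: g_def)
  qed
  have "schur_P_at (m # \<mu>) ?B = (\<Sum>b\<in>?B. g ?B b)" by (simp add: g_def)
  also have "\<dots> = (\<Sum>b\<in>A. g ?B b)"
    using 0 Cons.prems by (intro sum.mono_neutral_right) auto
  also have "\<dots> = (\<Sum>b\<in>A. g A b)"
  proof (intro sum.cong refl)
    fix b assume b: "b \<in> A"
    have bt: "b \<noteq> t" "b \<noteq> - t" using b Cons.prems by auto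
    then have eq: "?B - {b} = insert t (insert (- t) (A - {b}))" by auto
    have nz: "b - t \<noteq> 0" "b + t \<noteq> 0" using bt by (auto simp: add_eq_0_iff2)
    have "hl_factor b (?B - {b}) = (b + t) / (b - t) * ((b - t) / (b + t) * hl_factor b (A - {b}))"
      unfolding eq using Cons.prems ne by simp
    also have "\<dots> = hl_factor b (A - {b})" using nz by simp
    finally have "hl_factor b (?B - {b}) = hl_factor b (A - {b})" .
    moreover have "schur_P_at \<mu> (?B - {b}) = schur_P_at \<mu> (A - {b})"
      unfolding eq using Cons.prems by (intro Cons.IH) auto
    ultimately show "g ?B b = g A b" by (simp add: g_def)
  qed
  finally show ?case by (simp add: g_def)
qed simp

text \<open>As a function of \<open>z\<close>, the sum has at most simple poles, located at the elements of \<open>A\<close>. At \<open>z = b\<close> the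
  poles of the two summands in which \<open>z\<close> or \<open>b\<close> carries the first part cancel. Only the summand in
  which \<open>z\<close> carries the first part has full degree, which gives the leading coefficient.\<close>

lemma schur_P_at_polynomial:
  fixes A :: "'a::field set"
  assumes "finite A" "strict_parts \<mu>"
  shows "\<exists>p. degree p \<le> largest_part \<mu> \<and>
    (\<forall>z. z \<notin> A \<longrightarrow> poly p z = schur_P_at \<mu> (insert z A)) \<and>
    (\<mu> \<noteq> [] \<longrightarrow> coeff p (largest_part \<mu>) = schur_P_at (tl \<mu>) A)"
  using assms
proof (induction \<mu> arbitrary: A)
  case Nil
  show ?case by (intro exI[of _ 1]) auto
next
  case (Cons m \<mu>)
  have "\<forall>b. \<exists>p. degree p \<le> largest_part \<mu> \<and>
     (\<forall>z. z \<notin> A - {b} \<longrightarrow> poly p z = schur_P_at \<mu> (insert z (A - {b})))"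
    using Cons by (metis finite_Diff strict_parts_simps(2))
  then obtain P where degP: "\<And>b. degree (P b) \<le> largest_part \<mu>"
    and P: "\<And>b z. z \<notin> A - {b} \<Longrightarrow> poly (P b) z = schur_P_at \<mu> (insert z (A - {b}))"
    by metis
  define c where "c b = b ^ m * hl_factor b (A - {b})" for b
  \<comment> \<open>Up to the factor \<open>E\<close>, \<open>N1\<close> is the summand in which \<open>z\<close> carries the first part and \<open>- N2\<close> the sum
    of the others.\<close>
  define N1 where "N1 = smult (schur_P_at \<mu> A) (monom 1 m * (\<Prod>j\<in>A. [:j, 1:]))"
  define N2 where "N2 = (\<Sum>b\<in>A. smult (c b) ([:b, 1:] * linear_factors (A - {b}) * P b))"
  define E where "E = linear_factors A"
  have "poly (N1 - N2) x = 0" if x: "x \<in> A" for x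
  proof -
    have z: "(\<Prod>j\<in>A-{b}. x - j) = 0" if "b \<in> A - {x}" for b
      using that x Cons.prems(1) by (intro prod_zero) auto
    have nz: "(\<Prod>j\<in>A-{x}. x - j) \<noteq> 0" using Cons.prems(1) by simp
    have "poly N2 x = (\<Sum>b\<in>A. c b * ((b + x) * (\<Prod>j\<in>A-{b}. x - j) * poly (P b) x))"
      by (simp add: N2_def poly_sum poly_prod ring_distribs mult_ac)
    also have "\<dots> = c x * ((x + x) * (\<Prod>j\<in>A-{x}. x - j) * poly (P x) x)"
      using Cons.prems(1) x z by (intro sum_eq_single_term) auto
    also have "poly (P x) x = schur_P_at \<mu> A" using P[of x x] x by (simp add: insert_absorb)
    also have "c x * ((x + x) * (\<Prod>j\<in>A-{x}. x - j) * schur_P_at \<mu> A) =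
      x ^ m * ((x + x) * (\<Prod>j\<in>A-{x}. x + j)) * schur_P_at \<mu> A"
      using nz by (simp add: c_def prod_dividef)
    also have "(x + x) * (\<Prod>j\<in>A-{x}. x + j) = (\<Prod>j\<in>A. x + j)"
      using Cons.prems(1) x by (simp add: prod.remove)
    finally show ?thesis by (simp add: N1_def poly_prod poly_monom mult_ac add_ac)
  qed
  then have "E dvd N1 - N2" unfolding E_def using Cons.prems(1) by (intro prod_linear_factors_dvd)
  then obtain p where p: "N1 - N2 = E * p" by auto
  have degE: "degree E = card A"
    unfolding E_def using Cons.prems(1) by (subst degree_prod_eq_sum_degree) auto
  have lcE: "coeff E (card A) = 1"
    unfolding degE[symmetric] by (simp add: E_def lead_coeff_prod)
  have degE': "degree (\<Prod>j\<in>A. [:j, 1:]) = card A"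
    using Cons.prems(1) by (subst degree_prod_eq_sum_degree) auto
  have lcE': "coeff (\<Prod>j\<in>A. [:j, 1:]) (card A) = (1::'a)"
    unfolding degE'[symmetric] by (simp add: lead_coeff_prod)
  have coN1: "coeff N1 (card A + m) = schur_P_at \<mu> A"
    by (simp add: N1_def lcE' coeff_monom_mult)
  have degN1: "degree N1 \<le> card A + m"
    unfolding N1_def
    by (rule order_trans[OF degree_smult_le] order_trans[OF degree_mult_le])+
      (simp add: degE' degree_monom_eq)
  have degN2: "degree N2 < card A + m"
  proof -
    have "degree N2 \<le> card A + largest_part \<mu>" unfolding N2_def
    proof (rule degree_sum_le)
      fix b assume b: "b \<in> A"
      then have c: "Suc (card A - 1) = card A" using Cons.prems(1) by (metis Suc_diff_1 card_gt_0_iff empty_iff)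
      have "degree (linear_factors (A - {b})) = card A - 1"
        using Cons.prems(1) b by (subst degree_prod_eq_sum_degree) auto
      then have "degree ([:b, 1:] * linear_factors (A - {b})) \<le> card A"
        using degree_mult_le[of "[:b, 1:]" "\<Prod>j\<in>A-{b}. [:-j, 1:]"] c by simp
      then show "degree (smult (c b) ([:b, 1:] * linear_factors (A - {b}) * P b)) \<le> card A + largest_part \<mu>"
        using degP[of b] degree_smult_le[of "c b"] degree_mult_le[of "[:b, 1:] * linear_factors (A - {b})" "P b"]
        by (meson add_mono order_trans)
    qed (use Cons.prems in auto)
    then show ?thesis using Cons.prems(2) by simp
  qed
  have "degree (N1 - N2) \<le> card A + m"
    using degN1 degN2 by (intro degree_diff_le) auto
  have degp: "degree p \<le> m"
  proof (cases "p = 0")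
    case False
    have "E \<noteq> 0" using lcE by auto
    then have "degree (E * p) = card A + degree p"
      using False degE by (simp add: degree_mult_eq)
    with \<open>degree (N1 - N2) \<le> card A + m\<close> p show ?thesis by simp
  qed simp
  have "coeff p m = schur_P_at \<mu> A"
  proof -
    have "coeff (E * p) (card A + m) = coeff p m"
    proof (cases "degree p = m")
      case True
      then show ?thesis using coeff_mult_degree_sum[of E p] degE lcE by simp
    next
      case False
      then have "degree p < m" using degp by simp
      then have "degree (E * p) < card A + m"
        using degree_mult_le[of E p] degE by linarith
      then show ?thesis using \<open>degree p < m\<close> by (simp add: coeff_eq_0)
    qed
    then show ?thesis using coN1 degN2 by (simp add: p[symmetric] coeff_eq_0)
  qed
  moreover have "poly p z = schur_P_at (m # \<mu>) (insert z A)" if z: "z \<notin> A" for z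
  proof -
    have nz: "poly E z \<noteq> 0" using Cons.prems(1) z by (auto simp: E_def poly_prod)
    have zj: "z - j \<noteq> 0" "j - z \<noteq> 0" if "j \<in> A" for j using that z by auto
    have t: "b ^ m * hl_factor b (insert z A - {b}) * schur_P_at \<mu> (insert z A - {b}) * poly E z
        = - (c b * ((b + z) * (\<Prod>j\<in>A-{b}. z - j) * poly (P b) z))" if b: "b \<in> A" for b
    proof -
      have eq: "insert z A - {b} = insert z (A - {b})" using b z by auto
      have E: "poly E z = (z - b) * (\<Prod>j\<in>A-{b}. z - j)"
        using Cons.prems(1) b unfolding E_def using prod.remove[OF Cons.prems(1) b, of "\<lambda>j. z - j"] by (simp add: poly_prod)
      have "hl_factor b (insert z A - {b}) = (b + z) / (b - z) * hl_factor b (A - {b})"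
        unfolding eq using Cons.prems(1) z by simp
      moreover have "schur_P_at \<mu> (insert z A - {b}) = poly (P b) z"
        using P[of z b] z eq by simp
      ultimately have "b ^ m * hl_factor b (insert z A - {b}) * schur_P_at \<mu> (insert z A - {b}) * poly E z
        = (b + z) / (b - z) * (z - b) * (c b * ((\<Prod>j\<in>A-{b}. z - j) * poly (P b) z))"
        unfolding E c_def by (simp only: mult_ac)
      also have "\<dots> = - (b + z) * (c b * ((\<Prod>j\<in>A-{b}. z - j) * poly (P b) z))"
      proof -
        have "(b + z) / (b - z) * (z - b) = - (b + z)"
          using zj[OF b] by (metis minus_diff_eq mult_minus_right nonzero_divide_eq_eq times_divide_eq_left)
        then show ?thesis by (simp only:)
      qed
      also have "\<dots> = - (c b * ((b + z) * (\<Prod>j\<in>A-{b}. z - j) * poly (P b) z))"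
        by (simp only: mult_ac mult_minus_left mult_minus_right)
      finally show ?thesis .
    qed
    have "schur_P_at (m # \<mu>) (insert z A) * poly E z =
      z ^ m * hl_factor z (insert z A - {z}) * schur_P_at \<mu> (insert z A - {z}) * poly E z +
      (\<Sum>b\<in>A. b ^ m * hl_factor b (insert z A - {b}) * schur_P_at \<mu> (insert z A - {b}) * poly E z)"
      using Cons.prems(1) z by (simp add: sum_distrib_right ring_distribs)
    also have "insert z A - {z} = A" using z by auto
    also have "z ^ m * hl_factor z A * schur_P_at \<mu> A * poly E z = poly N1 z"
      using nz by (simp add: N1_def E_def poly_prod poly_monom prod_dividef add_ac)
    also have "(\<Sum>b\<in>A. b ^ m * hl_factor b (insert z A - {b}) * schur_P_at \<mu> (insert z A - {b}) * poly E z)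
      = - poly N2 z"
      using t by (simp add: N2_def poly_sum poly_prod sum_negf distrib_right mult.assoc)
    also have "poly N1 z + - poly N2 z = poly p z * poly E z"
      using p by (metis mult.commute poly_diff poly_mult uminus_add_conv_diff add.commute)
    finally show ?thesis using nz by simp
  qed
  ultimately show ?case using degp by (intro exI[of _ p]) simp
qed

text \<open>Interpolation of \<open>z \<mapsto> P\<^sub>\<mu>(A \<union> {z})\<close> at the points \<open>- a\<close>, evaluated at \<open>z = 0\<close>.\<close>

lemma schur_P_at_interpolation:
  assumes A: "antipode_free A" and \<mu>: "strict_parts \<mu>" "largest_part \<mu> < card A"
  shows "(\<Sum>a\<in>A. node_factor a (A - {a}) * schur_P_at \<mu> (A - {a})) = schur_P_at \<mu> A"
proof -
  have fin: "finite A" and 0: "0 \<notin> A" and neg: "\<And>a. a \<in> A \<Longrightarrow> - a \<notin> A"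
    and dbl: "\<And>a. a \<in> A \<Longrightarrow> a + a \<noteq> 0"
    using A unfolding antipode_free_def by (fastforce, fastforce, metis add.right_inverse, blast)
  obtain p where p: "degree p \<le> largest_part \<mu>"
    "\<And>z. z \<notin> A \<Longrightarrow> poly p z = schur_P_at \<mu> (insert z A)"
    using schur_P_at_polynomial[OF fin \<mu>(1)] by blast
  have "schur_P_at \<mu> A = poly p 0"
    using p(2)[OF 0] schur_P_at_insert_0[OF fin 0 \<mu>(1)] by simp
  also have "\<dots> = (\<Sum>a\<in>A. node_factor a (A - {a}) * poly p (- a))"
    using p(1) \<mu>(2) by (intro lagrange_interpolation_at_0 fin) linarith
  also have "\<dots> = (\<Sum>a\<in>A. node_factor a (A - {a}) * schur_P_at \<mu> (A - {a}))"
  proof (intro sum.cong refl)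
    fix a assume a: "a \<in> A"
    have "poly p (- a) = schur_P_at \<mu> (insert a (insert (- a) (A - {a})))"
      using p(2)[OF neg[OF a]] a by (metis insert_Diff_single insert_commute insert_absorb)
    also have "\<dots> = schur_P_at \<mu> (A - {a})"
      using fin neg[OF a] dbl[OF a] by (intro schur_P_at_cancellation) auto
    finally show "node_factor a (A - {a}) * poly p (- a) = node_factor a (A - {a}) * schur_P_at \<mu> (A - {a})" by simp
  qed
  finally show ?thesis ..
qed


section \<open>Symmetrization of staircase products\<close>

lemma strict_parts_nth_le:
  assumes "strict_parts \<mu>" "i < length \<mu>"
  shows "\<mu> ! i + i \<le> largest_part \<mu>"
  using assms
proof (induction \<mu> arbitrary: i)
  case (Cons m \<mu>)
  show ?case
  proof (cases i)
    case (Suc k)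
    with Cons have "\<mu> ! k + k \<le> largest_part \<mu>" by auto
    with Cons.prems Suc show ?thesis by simp
  qed simp
qed simp

text \<open>The product of \<open>x\<^sub>i / (x\<^sub>i - x\<^sub>j)\<close> over all \<open>i < j\<close>.\<close>

fun sym_weight :: "'a::field list \<Rightarrow> 'a"
  where "sym_weight [] = 1"
  | "sym_weight (b # xs) = (\<Prod>j\<in>set xs. b / (b - j)) * sym_weight xs"

text \<open>The symmetrizer fixes constants: splitting off the first entry reduces this to
  \<open>lagrange_leading_coefficient\<close>.\<close>

lemma sum_sym_weight:
  "finite A \<Longrightarrow> sum sym_weight (orderings A) = 1"
proof (induction "card A" arbitrary: A)
  case (Suc n)
  then have ne: "A \<noteq> {}" by auto
  have "sum sym_weight (orderings A) =
     (\<Sum>b\<in>A. \<Sum>xs\<in>orderings (A - {b}). (\<Prod>j\<in>A-{b}. b / (b - j)) * sym_weight xs)"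
    unfolding sum_permutations_of_set_Cons[OF Suc.prems ne]
    by (intro sum.cong) (auto dest: permutations_of_setD)
  also have "\<dots> = (\<Sum>b\<in>A. \<Prod>j\<in>A-{b}. b / (b - j))"
  proof (rule sum.cong[OF refl])
    fix b assume "b \<in> A"
    then have "sum sym_weight (orderings (A - {b})) = 1"
      using Suc by (intro Suc.hyps(1)) auto
    then show "(\<Sum>xs\<in>orderings (A - {b}). (\<Prod>j\<in>A-{b}. b / (b - j)) * sym_weight xs) = (\<Prod>j\<in>A-{b}. b / (b - j))"
      by (simp add: sum_distrib_left[symmetric])
  qed
  also have "\<dots> = 1" by (rule lagrange_leading_coefficient[OF Suc.prems ne])
  finally show ?case .
qed auto

lemma sym_weight_snoc:
  "distinct (xs @ [a]) \<Longrightarrow>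
    sym_weight (xs @ [a]) = node_factor a (set xs) * sym_weight xs"
  by (induction xs) auto

text \<open>Only the factor of the two swapped entries changes; \<open>r\<close> is the product of all others.\<close>

lemma sym_weight_swap:
  assumes "distinct (xs @ b # d # ys)"
  obtains r where "sym_weight (xs @ b # d # ys) = r * (b / (b - d))"
    "sym_weight (xs @ d # b # ys) = r * (d / (d - b))"
  using assms
proof (induction xs arbitrary: thesis)
  case Nil
  show ?case
    by (rule Nil.prems(1)[of "(\<Prod>j\<in>set ys. b / (b - j)) * (\<Prod>j\<in>set ys. d / (d - j)) * sym_weight ys"])
      (use Nil.prems(2) in \<open>simp_all add: mult_ac\<close>)
next
  case (Cons x xs)
  then obtain r where r: "sym_weight (xs @ b # d # ys) = r * (b / (b - d))"
    "sym_weight (xs @ d # b # ys) = r * (d / (d - b))" by auto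
  have "set (xs @ d # b # ys) = set (xs @ b # d # ys)" by auto
  then show ?case
    by (intro Cons.prems(1)[of "(\<Prod>j\<in>set (xs @ b # d # ys). x / (x - j)) * r"])
      (simp_all only: append_Cons sym_weight.simps r mult_ac)
qed

text \<open>The product of \<open>x\<^sub>i + x\<^bsub>i+j\<^esub>\<close> over the cells \<open>(i, j)\<close> of the diagram of \<open>\<mu>\<close>, with both indices shifted
  to start at 0.\<close>

definition staircase_product :: "nat list \<Rightarrow> 'a::field list \<Rightarrow> 'a"
  where "staircase_product \<mu> xs = (\<Prod>i<length \<mu>. \<Prod>j<\<mu> ! i. xs ! i + xs ! (i + 1 + j))"

lemma staircase_product_Cons:
  "staircase_product (m # \<mu>) (b # xs) = (\<Prod>j<m. b + xs ! j) * staircase_product \<mu> xs"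
  by (simp add: staircase_product_def prod.lessThan_Suc_shift del: prod.lessThan_Suc)

text \<open>Since the parts decrease strictly, row \<open>i\<close> ends at a variable whose index is at most \<open>\<mu>\<^sub>1 + 1\<close>.\<close>

lemma staircase_product_append:
  assumes "strict_parts \<mu>" "largest_part \<mu> < length xs"
  shows "staircase_product \<mu> (xs @ ys) = staircase_product \<mu> xs"
  unfolding staircase_product_def
proof (intro prod.cong refl)
  fix i j assume ij: "i \<in> {..<length \<mu>}" "j \<in> {..<\<mu> ! i}"
  then have "i + 1 + j < length xs" using strict_parts_nth_le[OF assms(1), of i] assms(2) by auto
  then show "(xs @ ys) ! i + (xs @ ys) ! (i + 1 + j) = xs ! i + xs ! (i + 1 + j)"
    by (simp add: nth_append)
qed

lemma prod_nth_distinct: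
  "distinct xs \<Longrightarrow> (\<Prod>j<length xs. f (xs ! j)) = prod f (set xs)"
  by (rule prod.reindex_bij_betw[OF bij_betw_nth]) auto

text \<open>Outer induction on the rows, inner induction on the number of variables. In the smallest case the
  first row of the staircase product contains all variables, and the power of the first variable
  that is missing is supplied by the weight. A superfluous last variable is split off by the
  interpolation identity.\<close>

lemma sum_staircase_product:
  assumes "antipode_free A" "strict_parts \<mu>" "largest_part \<mu> < card A"
  shows "(\<Sum>xs\<in>orderings A. staircase_product \<mu> xs * sym_weight xs) = schur_P_at \<mu> A"
  using assms
proof (induction \<mu> arbitrary: A)
  case Nil
  then show ?case by (simp add: staircase_product_def sum_sym_weight antipode_free_def)
next
  case (Cons m \<mu>)
  show ?case using Cons.prems(1,3)
  proof (induction "card A" arbitrary: A)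
    case (Suc n)
    have fin: "finite A" using Suc.prems by (simp add: antipode_free_def)
    have ne: "A \<noteq> {}" using Suc.prems by auto
    have str: "strict_parts \<mu>" "largest_part \<mu> < m" using Cons.prems(2) by auto
    have cd: "card (A - {a}) = n" if "a \<in> A" for a using that Suc fin by simp
    have af: "antipode_free (A - {a})" for a using Suc.prems(1) by (rule antipode_free_subset) auto
    let ?S = "\<lambda>\<mu> A. \<Sum>xs\<in>orderings A. staircase_product \<mu> xs * sym_weight xs"
    show ?case
    \<comment> \<open>The set \<open>A\<close> has \<open>n + 1\<close> elements; the smallest admissible size is \<open>m + 1\<close>.\<close>
    proof (cases "n = m")
      case True
      have "?S (m # \<mu>) A = (\<Sum>b\<in>A. b ^ m * hl_factor b (A - {b}) * ?S \<mu> (A - {b}))"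
        unfolding sum_permutations_of_set_Cons[OF fin ne] sum_distrib_left
      proof (intro sum.cong refl)
        fix b xs assume b: "b \<in> A" and xs: "xs \<in> orderings (A - {b})"
        have sx: "set xs = A - {b}" "distinct xs" using permutations_of_setD[OF xs] by auto
        have len: "length xs = m" using cd[OF b] sx True distinct_card by metis
        have "b ^ m * hl_factor b (A - {b}) = (\<Prod>j\<in>A-{b}. b * ((b + j) / (b - j)))"
          using cd[OF b] True by (simp only: prod.distrib prod_constant)
        also have "\<dots> = (\<Prod>j\<in>A-{b}. b + j) * (\<Prod>j\<in>A-{b}. b / (b - j))"
          unfolding prod.distrib[symmetric] by (intro prod.cong) auto
        also have "(\<Prod>j\<in>A-{b}. b + j) = (\<Prod>j<m. b + xs ! j)"
          using prod_nth_distinct[OF sx(2), of "\<lambda>j. b + j"] len sx(1) by simp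
        finally show "staircase_product (m # \<mu>) (b # xs) * sym_weight (b # xs)
          = b ^ m * hl_factor b (A - {b}) * (staircase_product \<mu> xs * sym_weight xs)"
          by (simp add: staircase_product_Cons sx(1) mult_ac)
      qed
      also have "\<dots> = schur_P_at (m # \<mu>) A"
        unfolding schur_P_at.simps
      proof (rule sum.cong[OF refl])
        fix b assume b: "b \<in> A"
        have "?S \<mu> (A - {b}) = schur_P_at \<mu> (A - {b})"
          using cd[OF b] True str by (intro Cons.IH af) auto
        then show "b ^ m * hl_factor b (A - {b}) * ?S \<mu> (A - {b}) =
           b ^ m * hl_factor b (A - {b}) * schur_P_at \<mu> (A - {b})" by (rule arg_cong)
      qed
      finally show ?thesis .
    next
      case False
      then have mn: "m < n" using Suc by simp
      have "?S (m # \<mu>) A = (\<Sum>a\<in>A. node_factor a (A - {a}) * ?S (m # \<mu>) (A - {a}))"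
        unfolding sum_permutations_of_set_snoc[OF fin ne] sum_distrib_left
      proof (intro sum.cong refl)
        fix a xs assume a: "a \<in> A" and xs: "xs \<in> orderings (A - {a})"
        have sx: "set xs = A - {a}" "distinct xs" using permutations_of_setD[OF xs] by auto
        have len: "length xs = n" using cd[OF a] sx distinct_card by metis
        have "sym_weight (xs @ [a]) = node_factor a (A - {a}) * sym_weight xs"
          using sx by (subst sym_weight_snoc) auto
        moreover have "staircase_product (m # \<mu>) (xs @ [a]) = staircase_product (m # \<mu>) xs"
          using Cons.prems(2) len mn by (intro staircase_product_append) auto
        ultimately show "staircase_product (m # \<mu>) (xs @ [a]) * sym_weight (xs @ [a]) =
          node_factor a (A - {a}) * (staircase_product (m # \<mu>) xs * sym_weight xs)"
          by (simp add: mult_ac)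
      qed
      also have "\<dots> = (\<Sum>a\<in>A. node_factor a (A - {a}) * schur_P_at (m # \<mu>) (A - {a}))"
      proof (rule sum.cong[OF refl])
        fix a assume a: "a \<in> A"
        have "?S (m # \<mu>) (A - {a}) = schur_P_at (m # \<mu>) (A - {a})"
          using cd[OF a] mn by (intro Suc.hyps(1) af) auto
        then show "node_factor a (A - {a}) * ?S (m # \<mu>) (A - {a}) =
           node_factor a (A - {a}) * schur_P_at (m # \<mu>) (A - {a})" by (rule arg_cong)
      qed
      also have "\<dots> = schur_P_at (m # \<mu>) A"
        using Suc.prems Cons.prems(2) by (intro schur_P_at_interpolation) auto
      finally show ?thesis .
    qed
  qed auto
qed

text \<open>The summand of an ordering in the Hall-Littlewood formula.\<close>

fun schur_P_term :: "nat list \<Rightarrow> 'a::field list \<Rightarrow> 'a"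
  where "schur_P_term (m # \<mu>) (b # xs) = b ^ m * hl_factor b (set xs) * schur_P_term \<mu> xs"
  | "schur_P_term _ _ = 1"

text \<open>Permuting the variables that carry no part does not change a summand; the factorial counts these
  permutations.\<close>

lemma sum_schur_P_term:
  assumes "finite A" "length \<mu> \<le> card A"
  shows "sum (schur_P_term \<mu>) (orderings A) =
    of_nat (fact (card A - length \<mu>)) * schur_P_at \<mu> A"
  using assms
proof (induction \<mu> arbitrary: A)
  case (Cons m \<mu>)
  then have ne: "A \<noteq> {}" by auto
  have "sum (schur_P_term (m # \<mu>)) (orderings A) =
     (\<Sum>b\<in>A. b ^ m * hl_factor b (A - {b}) * sum (schur_P_term \<mu>) (orderings (A - {b})))"
    unfolding sum_permutations_of_set_Cons[OF Cons.prems(1) ne] sum_distrib_left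
    by (intro sum.cong refl) (auto dest: permutations_of_setD)
  also have "\<dots> = (\<Sum>b\<in>A. of_nat (fact (card A - length (m # \<mu>))) * (b ^ m * hl_factor b (A - {b}) * schur_P_at \<mu> (A - {b})))"
  proof (rule sum.cong[OF refl])
    fix b assume b: "b \<in> A"
    have "sum (schur_P_term \<mu>) (orderings (A - {b})) =
      of_nat (fact (card (A - {b}) - length \<mu>)) * schur_P_at \<mu> (A - {b})"
      using Cons.prems b by (intro Cons.IH) auto
    moreover have "card (A - {b}) - length \<mu> = card A - length (m # \<mu>)"
      using Cons.prems b by simp
    ultimately show "b ^ m * hl_factor b (A - {b}) * sum (schur_P_term \<mu>) (orderings (A - {b})) =
      of_nat (fact (card A - length (m # \<mu>))) * (b ^ m * hl_factor b (A - {b}) * schur_P_at \<mu> (A - {b}))"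
      by (simp add: mult_ac)
  qed
  finally show ?case by (simp add: sum_distrib_left)
qed simp

text \<open>The coefficient of \<open>z\<^sup>m\<close> in \<open>P\<^sub>\<mu>(A \<union> {z})\<close>, for the largest part \<open>m\<close> that occurs at all, is \<open>P\<close> of the
  remaining parts if \<open>\<mu>\<^sub>1 = m\<close>, and 0 otherwise. So a linear relation yields a shorter one between the
  partitions with first part \<open>m\<close>; once their coefficients vanish, the others are treated.\<close>

lemma schur_P_at_linear_independence:
  fixes c :: "nat list \<Rightarrow> 'a::field_char_0"
  assumes "finite M" "\<And>\<mu>. \<mu> \<in> M \<Longrightarrow> strict_parts \<mu>"
    and "\<And>A. antipode_free A \<Longrightarrow> n \<le> card A \<Longrightarrow> (\<Sum>\<mu>\<in>M. c \<mu> * schur_P_at \<mu> A) = 0"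
    and "\<mu> \<in> M"
  shows "c \<mu> = 0"
  using assms
proof (induction "\<Sum>\<mu>\<in>M. Suc (length \<mu>)" arbitrary: M c \<mu> rule: less_induct)
  case less
  note fin = less.prems(1) and str = less.prems(2) and van = less.prems(3)
  define m where "m = Max (largest_part ` M)"
  have m_ge: "largest_part \<nu> \<le> m" if "\<nu> \<in> M" for \<nu> using that fin by (simp add: m_def)
  have "m \<in> largest_part ` M" unfolding m_def using fin less.prems(4) by (intro Max_in) auto
  show ?case
  proof (cases "m = 0")
    case True
    have "\<nu> = []" if "\<nu> \<in> M" for \<nu>
      using m_ge[OF that] str[OF that] True by (cases \<nu>) auto
    then have M: "M = {[]}" using less.prems(4) by auto
    have "antipode_free (of_nat ` {1..n} :: 'a set)"
      unfolding antipode_free_def by (auto simp flip: of_nat_add)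
    moreover have "card (of_nat ` {1..n} :: 'a set) = n" by (subst card_image) (auto simp: inj_on_def)
    ultimately show ?thesis using van[of "of_nat ` {1..n}"] less.prems(4) by (simp add: M)
  next
    case False
    define M' where "M' = {\<nu> \<in> M. largest_part \<nu> = m}"
    have M': "\<nu> = m # tl \<nu>" if "\<nu> \<in> M'" for \<nu> using that False by (cases \<nu>) (auto simp: M'_def)
    have inj: "inj_on tl M'" by (metis M' inj_onI)
    have fin': "finite M'" using fin by (simp add: M'_def)
    have "M' \<noteq> {}" using \<open>m \<in> largest_part ` M\<close> by (auto simp: M'_def)
    have sub: "M' \<subseteq> M" by (auto simp: M'_def)
    have top: "(\<Sum>\<nu>\<in>tl ` M'. c (m # \<nu>) * schur_P_at \<nu> A) = 0"
      if A: "antipode_free A" "n \<le> card A" for A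
    proof -
      have finA: "finite A" using A by (simp add: antipode_free_def)
      have "\<exists>p. \<forall>\<nu>\<in>M. degree (p \<nu>) \<le> largest_part \<nu> \<and>
        (\<forall>z. z \<notin> A \<longrightarrow> poly (p \<nu>) z = schur_P_at \<nu> (insert z A)) \<and>
        (\<nu> \<noteq> [] \<longrightarrow> coeff (p \<nu>) (largest_part \<nu>) = schur_P_at (tl \<nu>) A)"
        using schur_P_at_polynomial[OF finA str] by (intro bchoice) auto
      then obtain p where degp: "\<And>\<nu>. \<nu> \<in> M \<Longrightarrow> degree (p \<nu>) \<le> largest_part \<nu>"
        and valp: "\<And>\<nu> z. \<nu> \<in> M \<Longrightarrow> z \<notin> A \<Longrightarrow> poly (p \<nu>) z = schur_P_at \<nu> (insert z A)"
        and cop: "\<And>\<nu>. \<nu> \<in> M \<Longrightarrow> \<nu> \<noteq> [] \<Longrightarrow> coeff (p \<nu>) (largest_part \<nu>) = schur_P_at (tl \<nu>) A"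
        by blast
      define q where "q = (\<Sum>\<nu>\<in>M. smult (c \<nu>) (p \<nu>))"
      have "poly q z = 0" if z: "z \<notin> A \<union> uminus ` A \<union> {0}" for z
      proof -
        have "antipode_free (insert z A)"
          using A(1) z finA unfolding antipode_free_def by (auto simp: add_eq_0_iff image_iff)
        moreover have "n \<le> card (insert z A)" using A(2) finA by (simp add: card_insert_if)
        ultimately have "(\<Sum>\<nu>\<in>M. c \<nu> * schur_P_at \<nu> (insert z A)) = 0" by (rule van)
        then show ?thesis using z valp by (simp add: q_def poly_sum)
      qed
      then have "- (A \<union> uminus ` A \<union> {0}) \<subseteq> {z. poly q z = 0}" by auto
      moreover have "infinite (- (A \<union> uminus ` A \<union> {0}))"
        using finA by (simp add: Compl_eq_Diff_UNIV infinite_UNIV_char_0 del: Diff_insert)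
      ultimately have "q = 0" using poly_roots_finite finite_subset by blast
      then have "0 = coeff q m" by simp
      also have "\<dots> = (\<Sum>\<nu>\<in>M. c \<nu> * coeff (p \<nu>) m)" by (simp add: q_def coeff_sum)
      also have "\<dots> = (\<Sum>\<nu>\<in>M'. c \<nu> * coeff (p \<nu>) m)"
      proof (intro sum.mono_neutral_right fin sub ballI)
        fix \<nu> assume "\<nu> \<in> M - M'"
        then have "degree (p \<nu>) < m" using degp[of \<nu>] m_ge[of \<nu>] by (auto simp: M'_def)
        then show "c \<nu> * coeff (p \<nu>) m = 0" by (simp add: coeff_eq_0)
      qed
      also have "\<dots> = (\<Sum>\<nu>\<in>M'. c (m # tl \<nu>) * schur_P_at (tl \<nu>) A)"
      proof (rule sum.cong[OF refl])
        fix \<nu> assume \<nu>: "\<nu> \<in> M'"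
        then have "\<nu> \<in> M" "\<nu> \<noteq> []" "largest_part \<nu> = m" using M'[OF \<nu>] by (auto simp: M'_def)
        then have "coeff (p \<nu>) m = schur_P_at (tl \<nu>) A" using cop by blast
        then show "c \<nu> * coeff (p \<nu>) m = c (m # tl \<nu>) * schur_P_at (tl \<nu>) A"
          using M'[OF \<nu>] by simp
      qed
      also have "\<dots> = (\<Sum>\<nu>\<in>tl ` M'. c (m # \<nu>) * schur_P_at \<nu> A)"
        by (simp add: sum.reindex[OF inj])
      finally show ?thesis ..
    qed
    have lt: "(\<Sum>\<nu>\<in>tl ` M'. Suc (length \<nu>)) < (\<Sum>\<nu>\<in>M. Suc (length \<nu>))"
    proof -
      have "(\<Sum>\<nu>\<in>tl ` M'. Suc (length \<nu>)) = (\<Sum>\<nu>\<in>M'. Suc (length (tl \<nu>)))"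
        by (simp only: sum.reindex[OF inj] o_def)
      also have "\<dots> < (\<Sum>\<nu>\<in>M'. Suc (length \<nu>))"
        using fin' \<open>M' \<noteq> {}\<close>
      proof (rule sum_strict_mono)
        fix \<nu> assume "\<nu> \<in> M'"
        then have "length \<nu> = Suc (length (tl \<nu>))" using M' by (metis length_Cons)
        then show "Suc (length (tl \<nu>)) < Suc (length \<nu>)" by simp
      qed
      also have "\<dots> \<le> (\<Sum>\<nu>\<in>M. Suc (length \<nu>))" by (intro sum_mono2 fin sub) auto
      finally show ?thesis .
    qed
    have str': "strict_parts \<xi>" if "\<xi> \<in> tl ` M'" for \<xi>
      using that M' str sub by (metis imageE strict_parts_simps(2) subsetD)
    have zero: "c \<nu> = 0" if \<nu>: "\<nu> \<in> M'" for \<nu>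
      using less.hyps[of "tl ` M'" "\<lambda>\<nu>. c (m # \<nu>)" "tl \<nu>", OF lt finite_imageI[OF fin'] str' top imageI[OF \<nu>]]
        M'[OF \<nu>] by metis
    show ?thesis
    proof (cases "\<mu> \<in> M'")
      case False
      have "(\<Sum>\<nu>\<in>M-M'. Suc (length \<nu>)) < (\<Sum>\<nu>\<in>M. Suc (length \<nu>))"
      proof -
        obtain \<nu> where "\<nu> \<in> M'" using \<open>M' \<noteq> {}\<close> by auto
        then show ?thesis using fin sub by (intro sum_strict_mono2[of _ _ \<nu>]) auto
      qed
      then show ?thesis
      proof (rule less.hyps)
        fix A :: "'a set" assume "antipode_free A" "n \<le> card A"
        then have "(\<Sum>\<nu>\<in>M. c \<nu> * schur_P_at \<nu> A) = 0" by (rule van)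
        moreover have "(\<Sum>\<nu>\<in>M. c \<nu> * schur_P_at \<nu> A) = (\<Sum>\<nu>\<in>M-M'. c \<nu> * schur_P_at \<nu> A)"
          using zero by (intro sum.mono_neutral_right fin) auto
        ultimately show "(\<Sum>\<nu>\<in>M-M'. c \<nu> * schur_P_at \<nu> A) = 0" by simp
      qed (use fin str False less.prems(4) in auto)
    qed (use zero in auto)
  qed
qed

section \<open>Evaluation of polynomials\<close>

definition monomial_at :: "(nat \<Rightarrow> 'a::comm_ring_1) \<Rightarrow> (nat \<Rightarrow>\<^sub>0 nat) \<Rightarrow> 'a"
  where "monomial_at a m = (\<Prod>i\<in>keys m. a i ^ lookup m i)"

definition eval_poly :: "(nat \<Rightarrow> 'a::comm_ring_1) \<Rightarrow> zpoly \<Rightarrow> 'a"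
  where "eval_poly a f =
    (\<Sum>m\<in>keys f. of_int (lookup f m) * monomial_at a m)"

lemma monomial_at_superset:
  assumes "finite A" "keys m \<subseteq> A"
  shows "monomial_at a m = (\<Prod>i\<in>A. a i ^ lookup m i)"
  unfolding monomial_at_def using assms
  by (intro prod.mono_neutral_left) (auto simp: in_keys_iff)

lemma eval_poly_superset:
  assumes "finite A" "keys f \<subseteq> A"
  shows "eval_poly a f = (\<Sum>m\<in>A. of_int (lookup f m) * monomial_at a m)"
  unfolding eval_poly_def using assms
  by (intro sum.mono_neutral_left) (auto simp: in_keys_iff)

lemma monomial_at_0 [simp]: "monomial_at a 0 = 1"
  by (simp add: monomial_at_def)

lemma monomial_at_single [simp]: "monomial_at a (single i n) = a i ^ n"
  by (cases "n = 0") (simp_all add: monomial_at_def)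

lemma monomial_at_add: "monomial_at a (m + n) = monomial_at a m * monomial_at a n"
proof -
  let ?A = "keys m \<union> keys n"
  have "monomial_at a (m + n) = (\<Prod>i\<in>?A. a i ^ lookup (m + n) i)"
    by (rule monomial_at_superset) (use Poly_Mapping.keys_add[of m n] in auto)
  also have "\<dots> = monomial_at a m * monomial_at a n"
    by (simp add: monomial_at_superset[of ?A] lookup_add power_add prod.distrib)
  finally show ?thesis .
qed

lemma eval_poly_single [simp]: "eval_poly a (single m c) = of_int c * monomial_at a m"
  by (cases "c = 0") (simp_all add: eval_poly_def)

lemma eval_poly_0 [simp]: "eval_poly a 0 = 0"
  by (simp add: eval_poly_def)

lemma eval_poly_1 [simp]: "eval_poly a 1 = 1"
  using eval_poly_single[of a 0 1] by simp

lemma eval_poly_X [simp]: "eval_poly a (X i) = a i"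
  by (simp add: X_def)

lemma eval_poly_add [simp]: "eval_poly a (f + g) = eval_poly a f + eval_poly a g"
proof -
  let ?A = "keys f \<union> keys g"
  have "eval_poly a (f + g) = (\<Sum>m\<in>?A. of_int (lookup (f + g) m) * monomial_at a m)"
    by (rule eval_poly_superset) (use Poly_Mapping.keys_add[of f g] in auto)
  also have "\<dots> = eval_poly a f + eval_poly a g"
    by (simp add: eval_poly_superset[of ?A] lookup_add distrib_right sum.distrib)
  finally show ?thesis .
qed

lemma eval_poly_uminus [simp]: "eval_poly a (- f) = - eval_poly a f"
  by (metis eval_poly_add eval_poly_0 add.right_inverse eq_neg_iff_add_eq_0 add.commute)

lemma eval_poly_diff [simp]: "eval_poly a (f - g) = eval_poly a f - eval_poly a g"
  using eval_poly_add[of a f "- g"] by simp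

lemma eval_poly_sum: "eval_poly a (\<Sum>i\<in>A. f i) = (\<Sum>i\<in>A. eval_poly a (f i))"
  by (induction A rule: infinite_finite_induct) auto

lemma zpoly_sum_of_terms:
  "f = (\<Sum>m\<in>keys f. single m (lookup f m))"
  by (rule poly_mapping_eqI) (simp add: lookup_sum lookup_single when_def in_keys_iff)

lemma eval_poly_mult [simp]: "eval_poly a (f * g) = eval_poly a f * eval_poly a g"
proof -
  have 1: "eval_poly a (single m c * g) = of_int c * monomial_at a m * eval_poly a g" for m c
  proof -
    have "eval_poly a (single m c * g) = eval_poly a (\<Sum>n\<in>keys g. single m c * single n (lookup g n))"
      by (subst (1) zpoly_sum_of_terms[of g]) (simp only: sum_distrib_left)
    also have "\<dots> = of_int c * monomial_at a m * eval_poly a g"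
      by (simp only: eval_poly_sum mult_single eval_poly_single monomial_at_add)
        (simp add: eval_poly_def sum_distrib_left mult_ac)
    finally show ?thesis .
  qed
  have "eval_poly a (f * g) = eval_poly a (\<Sum>m\<in>keys f. single m (lookup f m) * g)"
    by (subst (1) zpoly_sum_of_terms[of f]) (simp only: sum_distrib_right)
  also have "\<dots> = eval_poly a f * eval_poly a g"
    by (simp only: eval_poly_sum 1) (simp add: eval_poly_def sum_distrib_right)
  finally show ?thesis .
qed

lemma eval_poly_power [simp]: "eval_poly a (f ^ n) = eval_poly a f ^ n"
  by (induction n) auto

lemma eval_poly_prod: "eval_poly a (\<Prod>i\<in>A. f i) = (\<Prod>i\<in>A. eval_poly a (f i))"
  by (induction A rule: infinite_finite_induct) auto

lemma eval_poly_of_int [simp]: "eval_poly a (of_int c) = of_int c"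
proof -
  have "of_int c = (single 0 c :: zpoly)" by (simp flip: single_of_int)
  then show ?thesis by simp
qed

lemma permute_vars_eq_eval: "permute_vars w f = eval_poly (\<lambda>i. X (w i)) f"
  by (simp add: permute_vars_def eval_poly_def monomial_at_def)

lemma monomial_at_X: "monomial_at X m = single m 1"
proof -
  have "(\<Prod>i\<in>A. X i ^ k i) = single (\<Sum>i\<in>A. single i (k i)) (1::int)" if "finite A" for A k
    using that
  proof induction
    case (insert i A)
    have "X i ^ n = single (single i n) 1" for n
      by (induction n) (simp_all add: X_def mult_single single_add[symmetric] add.commute)
    then show ?case using insert by (simp add: mult_single)
  qed simp
  then have "monomial_at X m = single (\<Sum>i\<in>keys m. single i (lookup m i)) 1"
    by (simp add: monomial_at_def)
  also have "(\<Sum>i\<in>keys m. single i (lookup m i)) = m"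
    by (rule poly_mapping_eqI) (simp add: lookup_sum lookup_single when_def in_keys_iff)
  finally show ?thesis .
qed

lemma of_int_times_monomial:
  "of_int c * single m (1::int) = single m c"
  by (simp flip: single_of_int add: mult_single)

lemma eval_poly_X_id: "eval_poly X f = f"
  using zpoly_sum_of_terms[of f] by (simp add: eval_poly_def monomial_at_X of_int_times_monomial)

lemma eval_poly_eval_poly: "eval_poly a (eval_poly b f) = eval_poly (\<lambda>i. eval_poly a (b i)) f"
  by (simp add: eval_poly_def[of b] eval_poly_def[of "\<lambda>i. eval_poly a (b i)"]
      eval_poly_sum monomial_at_def eval_poly_prod)

lemma eval_poly_permute_vars: "eval_poly a (permute_vars w f) = eval_poly (a \<circ> w) f"
  by (simp add: permute_vars_eq_eval eval_poly_eval_poly o_def)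

lemma permute_vars_id: "permute_vars id f = f"
  by (simp add: permute_vars_eq_eval eval_poly_X_id)

lemma permute_vars_comp: "permute_vars v (permute_vars w f) = permute_vars (v \<circ> w) f"
  by (simp add: permute_vars_eq_eval eval_poly_eval_poly)

text \<open>Evaluation at the generic point is the embedding into the field of fractions. Identities between
  polynomials can therefore be checked at this point, where all denominators are nonzero.\<close>

definition generic :: "nat \<Rightarrow> zpoly fract"
  where "generic i = Fraction_Field.Fract (X i) 1"

lemma eval_poly_generic: "eval_poly generic f = Fraction_Field.Fract f 1"
proof -
  have pow: "generic i ^ n = Fraction_Field.Fract (X i ^ n) 1" for i n
    by (induction n) (simp_all add: generic_def One_fract_def)
  have pr: "(\<Prod>i\<in>A. Fraction_Field.Fract (h i) 1) = Fraction_Field.Fract (\<Prod>i\<in>A. h i) (1::zpoly)" for A :: "nat set" and h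
    by (induction A rule: infinite_finite_induct) (simp_all add: One_fract_def)
  have su: "(\<Sum>i\<in>A. Fraction_Field.Fract (h i) 1) = Fraction_Field.Fract (\<Sum>i\<in>A. h i) (1::zpoly)" for A :: "(nat \<Rightarrow>\<^sub>0 nat) set" and h
    by (induction A rule: infinite_finite_induct) (simp_all add: Zero_fract_def)
  have oi: "of_int c = Fraction_Field.Fract (of_int c) (1::zpoly)" for c
    by (cases c rule: int_diff_cases) (simp add: of_nat_fract)
  have "eval_poly generic f = (\<Sum>m\<in>keys f. Fraction_Field.Fract (of_int (lookup f m) * monomial_at X m) 1)"
    by (simp add: eval_poly_def monomial_at_def pow pr oi)
  also have "\<dots> = Fraction_Field.Fract (eval_poly X f) 1" by (simp only: su eval_poly_def)
  finally show ?thesis by (simp add: eval_poly_X_id)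
qed

lemma eval_poly_generic_inj: "eval_poly generic f = eval_poly generic g \<longleftrightarrow> f = g"
  by (simp add: eval_poly_generic eq_fract)

lemma X_inj: "X i = X j \<longleftrightarrow> i = j"
proof
  assume "X i = X j"
  then have "lookup (X i) (single i 1) = lookup (X j) (single i 1)" by simp
  then have "single i (1::nat) = single j 1" 
    by (simp add: X_def lookup_single when_def split: if_splits)
  then have "lookup (single i (1::nat)) i = lookup (single j 1) i" by (simp only:)
  then show "i = j" by (simp add: lookup_single when_def split: if_splits)
qed simp

lemma generic_inj: "generic i = generic j \<longleftrightarrow> i = j"
  by (simp add: generic_def eq_fract X_inj)

lemma generic_add_nonzero: "generic i + generic j \<noteq> 0"
proof
  assume "generic i + generic j = 0"
  then have "X i + X j = 0" by (simp add: generic_def Zero_fract_def eq_fract)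
  then have "eval_poly (\<lambda>_. 1 :: int) (X i + X j) = 0" by simp
  then show False by simp
qed

section \<open>Divided differences\<close>

lemmas transpose_if = Transposition.transpose_def

text \<open>The polynomials \<open>g\<close> for which the division is exact form a subring that contains all variables.\<close>

lemma divdiff_exists: "\<exists>g. g * (X i - X j) = f - permute_vars (Transposition.transpose i j) f"
proof -
  let ?p = "permute_vars (Transposition.transpose i j)"
  have p: "?p (g + h) = ?p g + ?p h" "?p (g * h) = ?p g * ?p h" "?p (of_int c) = of_int c"
    "?p (X k) = X (Transposition.transpose i j k)" for g h c k
    by (simp_all add: permute_vars_eq_eval)
  define d where "d g \<longleftrightarrow> X i - X j dvd g - ?p g" for g
  have add: "d (g + h)" if "d g" "d h" for g h
  proof -
    have "(g + h) - ?p (g + h) = (g - ?p g) + (h - ?p h)" by (simp add: p)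
    then show ?thesis using that unfolding d_def by (metis dvd_add)
  qed
  have mult: "d (g * h)" if "d g" "d h" for g h
  proof -
    have "(g * h) - ?p (g * h) = (g - ?p g) * h + ?p g * (h - ?p h)" by (simp add: p algebra_simps)
    then show ?thesis using that unfolding d_def by (metis dvd_add dvd_mult dvd_mult2)
  qed
  have const: "d (of_int c)" for c by (simp add: d_def p)
  have var: "d (X k)" for k
  proof -
    have "X j - X i = - (X i - X j)" by simp
    then have "X i - X j dvd X j - X i" by (metis dvd_refl dvd_minus_iff)
    then show ?thesis by (simp add: d_def p transpose_if)
  qed
  have one: "d 1" using const[of 1] by simp
  have zero: "d 0" using const[of 0] by simp
  have "d (X k ^ n)" for k n by (induction n) (simp_all add: one var mult)
  then have "d (\<Prod>k\<in>A. X k ^ n k)" for A n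
    by (induction A rule: infinite_finite_induct) (simp_all add: one mult)
  then have "d (\<Sum>m\<in>A. of_int (c m) * (\<Prod>k\<in>keys m. X k ^ lookup m k))" for A c
    by (induction A rule: infinite_finite_induct) (simp_all add: zero add mult const)
  from this[of "lookup f" "keys f"] have "d (eval_poly X f)"
    by (simp add: eval_poly_def monomial_at_def)
  then have "X i - X j dvd f - ?p f" by (simp add: d_def eval_poly_X_id)
  then show ?thesis by (metis dvdE mult.commute)
qed

lemma divdiff_mult: "divdiff i f * (X i - X (i + 1)) = f - permute_vars (s i) f"
  and divdiff_unique: "g * (X i - X (i + 1)) = f - permute_vars (s i) f \<Longrightarrow> divdiff i f = g"
proof -
  have "\<exists>!g. g * (X i - X (i + 1)) = f - permute_vars (s i) f"
  proof (rule ex_ex1I)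
    show "\<exists>g. g * (X i - X (i + 1)) = f - permute_vars (s i) f" by (rule divdiff_exists)
    have "X i - X (i + 1) \<noteq> 0" by (simp add: X_inj)
    then show "g = h" if "g * (X i - X (i + 1)) = f - permute_vars (s i) f"
      "h * (X i - X (i + 1)) = f - permute_vars (s i) f" for g h
      using that mult_right_cancel by metis
  qed
  then show "divdiff i f * (X i - X (i + 1)) = f - permute_vars (s i) f"
    "g * (X i - X (i + 1)) = f - permute_vars (s i) f \<Longrightarrow> divdiff i f = g"
    unfolding divdiff_def by (rule theI', rule the1_equality)
qed

lemma divdiff_eq_0_iff: "divdiff i f = 0 \<longleftrightarrow> permute_vars (s i) f = f"
  using divdiff_mult[of i f] divdiff_unique[of 0 i f] by auto

lemma eval_divdiff:
  fixes a :: "nat \<Rightarrow> 'a::field"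
  assumes "a i \<noteq> a (i + 1)"
  shows "eval_poly a (divdiff i f) = (eval_poly a f - eval_poly (a \<circ> s i) f) / (a i - a (i + 1))"
proof -
  have "eval_poly a (divdiff i f * (X i - X (i + 1))) = eval_poly a (f - permute_vars (s i) f)"
    by (simp only: divdiff_mult)
  then show ?thesis using assms by (simp add: eval_poly_permute_vars field_simps)
qed

text \<open>Only the two coordinates concerned have to differ, so the formula applies at all points with
  distinct coordinates, also if one of them is 0.\<close>

lemma eval_pi_op:
  fixes a :: "nat \<Rightarrow> 'a::field"
  assumes "a i \<noteq> a (i + 1)"
  shows "eval_poly a (pi_op i f) =
    a i / (a i - a (i + 1)) * eval_poly a f + a (i + 1) / (a (i + 1) - a i) * eval_poly (a \<circ> s i) f"
proof -
  have "a (i + 1) - a i \<noteq> 0" "a i - a (i + 1) \<noteq> 0" using assms by auto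
  then show ?thesis
    unfolding pi_op_def by (simp add: eval_divdiff[OF assms] divide_simps) (simp add: algebra_simps)
qed

lemma permute_vars_pi_op: "permute_vars (s i) (pi_op i f) = pi_op i f"
proof -
  let ?f = "X i * f"
  have p: "permute_vars (s i) (g * h) = permute_vars (s i) g * permute_vars (s i) h"
    "permute_vars (s i) (g - h) = permute_vars (s i) g - permute_vars (s i) h"
    "permute_vars (s i) (X k) = X (s i k)" for g h k
    by (simp_all add: permute_vars_eq_eval)
  have "permute_vars (s i) (divdiff i ?f * (X i - X (i + 1))) = permute_vars (s i) (?f - permute_vars (s i) ?f)"
    by (simp only: divdiff_mult)
  also have "\<dots> = permute_vars (s i) ?f - ?f"
    by (simp only: p(2) permute_vars_comp transpose_comp_involutory permute_vars_id)
  finally have *: "permute_vars (s i) (divdiff i ?f) * (X (i + 1) - X i) = permute_vars (s i) ?f - ?f"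
    by (simp only: p transpose_apply_first transpose_apply_second)
  then have "permute_vars (s i) (divdiff i ?f) * (X i - X (i + 1)) = ?f - permute_vars (s i) ?f"
  proof -
    have "permute_vars (s i) (divdiff i ?f) * (X i - X (i + 1)) =
        - (permute_vars (s i) (divdiff i ?f) * (X (i + 1) - X i))"
      by (simp only: mult_minus_right[symmetric] minus_diff_eq)
    then show ?thesis by (simp only: * minus_diff_eq)
  qed
  then show ?thesis unfolding pi_op_def by (metis divdiff_unique)
qed

lemma zpoly_eq_by_generic_eval:
  assumes "eval_poly generic f = eval_poly generic g"
  shows "f = g"
  using assms by (simp add: eval_poly_generic_inj)

lemma pi_op_commute:
  assumes "i + 1 < j"
  shows "pi_op i (pi_op j f) = pi_op j (pi_op i f)"
proof (rule zpoly_eq_by_generic_eval)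
  let ?x = "generic i" and ?y = "generic (i + 1)" and ?z = "generic j" and ?u = "generic (j + 1)"
  have ne: "?x \<noteq> ?y" "?z \<noteq> ?u" by (simp_all add: generic_inj)
  have v: "(generic \<circ> s i) j = ?z" "(generic \<circ> s i) (j + 1) = ?u" "(generic \<circ> s j) i = ?x" "(generic \<circ> s j) (i + 1) = ?y"
    using assms by (auto simp: transpose_if)
  have c: "generic \<circ> s i \<circ> s j = generic \<circ> s j \<circ> s i"
    using assms by (auto simp: fun_eq_iff transpose_if)
  show "eval_poly generic (pi_op i (pi_op j f)) = eval_poly generic (pi_op j (pi_op i f))"
    by (simp only: eval_pi_op ne v not_False_eq_True c) (simp only: distrib_left mult_ac add_ac)
qed

text \<open>At a point with coordinates \<open>x, y, z\<close> in the places concerned, both sides are combinations of the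
  six values of \<open>f\<close> at the rearrangements of this point.\<close>

lemma pi_op_braid: "pi_op i (pi_op (i + 1) (pi_op i f)) = pi_op (i + 1) (pi_op i (pi_op (i + 1) f))"
proof (rule zpoly_eq_by_generic_eval)
  define j where "j = i + 1"
  define x y z where xyz: "x = generic i" "y = generic j" "z = generic (j + 1)"
  have ne: "x \<noteq> y" "x \<noteq> z" "y \<noteq> z" "y \<noteq> x" "z \<noteq> x" "z \<noteq> y" by (simp_all add: generic_inj xyz j_def)
  let ?g = generic
  have s: "s i i = j" "s i j = i" "s i (j + 1) = j + 1" "s j i = i" "s j j = j + 1" "s j (j + 1) = j"
    by (auto simp: j_def transpose_if)
  have c: "?g \<circ> s i \<circ> s i = ?g" "?g \<circ> s j \<circ> s j = ?g" "?g \<circ> s i \<circ> s j \<circ> s j = ?g \<circ> s i"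
    "?g \<circ> s j \<circ> s i \<circ> s i = ?g \<circ> s j"
    "?g \<circ> s j \<circ> s i \<circ> s j = ?g \<circ> s i \<circ> s j \<circ> s i"
    by (auto simp: j_def fun_eq_iff transpose_if)
  have Ei: "eval_poly a (pi_op i h) = a i / (a i - a j) * eval_poly a h + a j / (a j - a i) * eval_poly (a \<circ> s i) h"
    if "a i \<noteq> a j" for a :: "nat \<Rightarrow> zpoly fract" and h
    using that eval_pi_op[of a i h] by (simp add: j_def)
  have Ej: "eval_poly a (pi_op j h) = a j / (a j - a (j + 1)) * eval_poly a h + a (j + 1) / (a (j + 1) - a j) * eval_poly (a \<circ> s j) h"
    if "a j \<noteq> a (j + 1)" for a :: "nat \<Rightarrow> zpoly fract" and h
    using that by (rule eval_pi_op)
  have 1: "eval_poly ?g (pi_op i (pi_op j (pi_op i f))) =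
    x / (x - y) * (y / (y - z) * (x / (x - y) * eval_poly ?g f + y / (y - x) * eval_poly (?g \<circ> s i) f)
      + z / (z - y) * (x / (x - z) * eval_poly (?g \<circ> s j) f + z / (z - x) * eval_poly (?g \<circ> s j \<circ> s i) f))
   + y / (y - x) * (x / (x - z) * (y / (y - x) * eval_poly (?g \<circ> s i) f + x / (x - y) * eval_poly ?g f)
      + z / (z - x) * (y / (y - z) * eval_poly (?g \<circ> s i \<circ> s j) f + z / (z - y) * eval_poly (?g \<circ> s i \<circ> s j \<circ> s i) f))"
    by (simp only: Ei Ej o_apply s xyz[symmetric] ne c not_False_eq_True)
  have 2: "eval_poly ?g (pi_op j (pi_op i (pi_op j f))) =
    y / (y - z) * (x / (x - y) * (y / (y - z) * eval_poly ?g f + z / (z - y) * eval_poly (?g \<circ> s j) f)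
      + y / (y - x) * (x / (x - z) * eval_poly (?g \<circ> s i) f + z / (z - x) * eval_poly (?g \<circ> s i \<circ> s j) f))
   + z / (z - y) * (x / (x - z) * (z / (z - y) * eval_poly (?g \<circ> s j) f + y / (y - z) * eval_poly ?g f)
      + z / (z - x) * (x / (x - y) * eval_poly (?g \<circ> s j \<circ> s i) f + y / (y - x) * eval_poly (?g \<circ> s i \<circ> s j \<circ> s i) f))"
    by (simp only: Ei Ej o_apply s xyz[symmetric] ne c not_False_eq_True)
  have sub: "x - y \<noteq> 0" "x - z \<noteq> 0" "y - z \<noteq> 0" using ne by auto
  have neg: "y - x = - (x - y)" "z - x = - (x - z)" "z - y = - (y - z)" by auto
  \<comment> \<open>\<open>A\<close>, \<open>B\<close> and \<open>C\<close> compare the coefficients at \<open>x y z\<close>, \<open>y x z\<close> and \<open>x z y\<close>; the other three agree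
    literally.\<close>
  have A: "x / (x - y) * (y / (y - z)) * (x / (x - y)) + y / (y - x) * (x / (x - z)) * (x / (x - y))
      = y / (y - z) * (x / (x - y)) * (y / (y - z)) + z / (z - y) * (x / (x - z)) * (y / (y - z))"
    using sub unfolding neg by (simp add: divide_simps) (simp add: algebra_simps)
  have B: "x / (x - y) * (y / (y - z)) * (y / (y - x)) + y / (y - x) * (x / (x - z)) * (y / (y - x))
      = y / (y - z) * (y / (y - x)) * (x / (x - z))"
    using sub unfolding neg by (simp add: divide_simps) (simp add: algebra_simps)
  have C: "x / (x - y) * (z / (z - y)) * (x / (x - z)) =
    y / (y - z) * (x / (x - y)) * (z / (z - y)) + z / (z - y) * (x / (x - z)) * (z / (z - y))"
    using sub unfolding neg by (simp add: divide_simps) (simp add: algebra_simps)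
  have lin: "p1 * (p2 * (p3 * F + p4 * G) + p5 * (p6 * H + p7 * I)) + q1 * (q2 * (q3 * G + q4 * F) + q5 * (q6 * J + q7 * K))
    = (p1 * p2 * p3 + q1 * q2 * q4) * F + (p1 * p2 * p4 + q1 * q2 * q3) * G + p1 * p5 * p6 * H + p1 * p5 * p7 * I
      + q1 * q5 * q6 * J + q1 * q5 * q7 * K" for p1 p2 p3 p4 p5 p6 p7 q1 q2 q3 q4 q5 q6 q7 F G H I J K :: "zpoly fract"
    by (simp add: algebra_simps)
  show "eval_poly ?g (pi_op i (pi_op (i + 1) (pi_op i f))) = eval_poly ?g (pi_op (i + 1) (pi_op i (pi_op (i + 1) f)))"
    unfolding j_def[symmetric] 1 2 lin A B C by (simp only: mult_ac add_ac)
qed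

section \<open>Reduced words\<close>

definition inversions :: "(nat \<Rightarrow> nat) \<Rightarrow> (nat \<times> nat) set"
  where "inversions v = {(i, j). 1 \<le> i \<and> i < j \<and> v i > v j}"

lemma inversions_id: "inversions id = {}"
  by (auto simp: inversions_def)

abbreviation inv_count :: "(nat \<Rightarrow> nat) \<Rightarrow> nat"
  where "inv_count v \<equiv> card (inversions v)"

lemma s_permutes: "1 \<le> i \<Longrightarrow> i < n \<Longrightarrow> s i permutes {1..n}"
  by (rule permutes_swap_id) auto

lemma word_perm_Nil [simp]: "word_perm [] = id"
  and word_perm_Cons [simp]: "word_perm (i # ws) = s i \<circ> word_perm ws"
  by (simp_all add: word_perm_def)

lemma word_perm_append: "word_perm (us @ ws) = word_perm us \<circ> word_perm ws"
  by (induction us) (simp_all add: comp_assoc)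

lemma word_perm_permutes: "ws \<in> lists {1..<n} \<Longrightarrow> word_perm ws permutes {1..n}"
proof (induction ws)
  case (Cons i ws)
  then have "word_perm ws permutes {1..n}" "1 \<le> i" "i < n" by auto
  then show ?case unfolding word_perm_Cons by (intro permutes_compose s_permutes)
qed (simp add: permutes_id)

lemma lists_bounded: "ws \<in> lists {1..} \<Longrightarrow> \<exists>n. ws \<in> lists {1..<n::nat}"
proof (induction ws)
  case (Cons i ws)
  then obtain n where "ws \<in> lists {1..<n}" by auto
  then have "ws \<in> lists {1..<max n (Suc i)}" by (auto simp: in_lists_conv_set)
  with Cons.prems have "i # ws \<in> lists {1..<max n (Suc i)}" by auto
  then show ?case by blast
qed auto

lemma inversions_subset:
  assumes "v permutes {1..n}"
  shows "inversions v \<subseteq> {1..n} \<times> {1..n}"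
proof
  fix p assume "p \<in> inversions v"
  then obtain i j where p: "p = (i, j)" and ij: "1 \<le> i" "i < j" "v j < v i"
    by (auto simp: inversions_def)
  have "j \<le> n"
  proof (rule ccontr)
    assume "\<not> j \<le> n"
    then have "v j = j" using assms by (auto simp: permutes_def)
    then have "v i \<notin> {1..n}" using ij \<open>\<not> j \<le> n\<close> by auto
    then have "i \<notin> {1..n}" using permutes_in_image[OF assms] by blast
    then have "v i = i" using permutes_not_in[OF assms] by blast
    with ij \<open>v j = j\<close> show False by simp
  qed
  then show "p \<in> {1..n} \<times> {1..n}" using ij p by auto
qed

lemma finite_inversions: "v permutes {1..n} \<Longrightarrow> finite (inversions v)"
  by (rule finite_subset[OF inversions_subset]) auto

text \<open>Exchanging the positions \<open>i\<close> and \<open>i + 1\<close> preserves the order of all other pairs of positions.\<close>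

lemma card_inversions_comp_s_aux:
  assumes "1 \<le> i"
  shows "card (inversions (v \<circ> s i) - {(i, i + 1)}) = card (inversions v - {(i, i + 1)})"
proof -
  have ord: "1 \<le> s i a \<and> s i a < s i b \<and> (s i a, s i b) \<noteq> (i, i + 1)"
    if "1 \<le> a" "a < b" "(a, b) \<noteq> (i, i + 1)" for a b
    using that assms by (auto simp: transpose_if)
  have "bij_betw (map_prod (s i) (s i)) (inversions (v \<circ> s i) - {(i, i + 1)}) (inversions v - {(i, i + 1)})"
  proof (rule bij_betw_byWitness[where f' = "map_prod (s i) (s i)"])
    show "map_prod (s i) (s i) ` (inversions (v \<circ> s i) - {(i, i + 1)}) \<subseteq> inversions v - {(i, i + 1)}"
      using ord by (auto simp: inversions_def)
    show "map_prod (s i) (s i) ` (inversions v - {(i, i + 1)}) \<subseteq> inversions (v \<circ> s i) - {(i, i + 1)}"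
      using ord by (auto simp: inversions_def)
  qed auto
  then show ?thesis by (rule bij_betw_same_card)
qed

lemma inv_count_comp_s:
  assumes v: "v permutes {1..n}" and i: "1 \<le> i"
  shows "v i < v (i + 1) \<Longrightarrow> inv_count (v \<circ> s i) = Suc (inv_count v)"
    and "v i > v (i + 1) \<Longrightarrow> inv_count v = Suc (inv_count (v \<circ> s i))"
proof -
  have fin: "finite (inversions v)" using finite_inversions[OF v] .
  have v': "v \<circ> s i permutes {1..max n (i + 1)}"
    using i by (intro permutes_compose s_permutes permutes_subset[OF v]) auto
  have fin': "finite (inversions (v \<circ> s i))" using finite_inversions[OF v'] .
  have mem: "(i, i + 1) \<in> inversions v \<longleftrightarrow> v i > v (i + 1)"
    "(i, i + 1) \<in> inversions (v \<circ> s i) \<longleftrightarrow> v i < v (i + 1)"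
    using i by (auto simp: inversions_def)
  note aux = card_inversions_comp_s_aux[OF i, of v]
  show "inv_count (v \<circ> s i) = Suc (inv_count v)" if "v i < v (i + 1)"
  proof -
    have "inv_count (v \<circ> s i) = Suc (card (inversions (v \<circ> s i) - {(i, i + 1)}))"
      using mem that fin' by (intro card.remove) auto
    moreover have "inversions v - {(i, i + 1)} = inversions v" using mem that by auto
    ultimately show ?thesis using aux by simp
  qed
  show "inv_count v = Suc (inv_count (v \<circ> s i))" if "v i > v (i + 1)"
  proof -
    have "inv_count v = Suc (card (inversions v - {(i, i + 1)}))"
      using mem that fin by (intro card.remove) auto
    moreover have "inversions (v \<circ> s i) - {(i, i + 1)} = inversions (v \<circ> s i)" using mem that by auto
    ultimately show ?thesis using aux by simp
  qed
qed

lemma permutes_0: "v permutes {1..n} \<Longrightarrow> v 0 = (0::nat)"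
  by (auto simp: permutes_def)

lemma permutes_pos: "v permutes {1..n} \<Longrightarrow> 1 \<le> i \<Longrightarrow> 1 \<le> v (i::nat)"
  by (metis permutes_0 permutes_inj inj_eq not_less_eq_eq One_nat_def le_zero_eq)

lemma increasing_permutation_is_id:
  assumes v: "v permutes {1..n::nat}" and inc: "\<And>i. 1 \<le> i \<Longrightarrow> v i < v (i + 1)"
  shows "v = id"
proof -
  have sm: "strict_mono v"
    unfolding strict_mono_Suc_iff
  proof
    fix k show "v k < v (Suc k)"
      using inc[of k] permutes_pos[OF v, of 1] permutes_0[OF v] by (cases k) auto
  qed
  have bij: "bij v" using permutes_bij[OF v] .
  have sm': "strict_mono (inv v)"
  proof (rule strict_monoI)
    fix a b :: nat assume "a < b"
    then have "v (inv v a) < v (inv v b)" using bij by (simp add: bij_is_surj surj_f_inv_f)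
    then show "inv v a < inv v b" using sm by (simp add: strict_mono_less)
  qed
  show ?thesis
  proof
    fix i
    have "i \<le> v i" using sm by (rule strict_mono_imp_increasing)
    have "i \<le> inv v i" using sm' by (rule strict_mono_imp_increasing)
    then have "v i \<le> v (inv v i)" using sm by (simp add: strict_mono_less_eq)
    then have "v i \<le> i" using bij by (simp add: bij_is_surj surj_f_inv_f)
    with \<open>i \<le> v i\<close> show "v i = id i" by simp
  qed
qed

text \<open>Right multiplication by a simple reflection at a descent lowers the number of inversions, and only
  the identity has no descent.\<close>

lemma reduced_word_exists_aux:
  assumes "v permutes {1..n}"
  shows "\<exists>ws\<in>lists {1..<n}. word_perm ws = v \<and> length ws = inv_count v"
  using assms
proof (induction "inv_count v" arbitrary: v rule: less_induct)
  case less
  show ?case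
  proof (cases "v = id")
    case True
    then show ?thesis using inversions_id by (intro bexI[of _ "[]"]) auto
  next
    case False
    then obtain i where i: "1 \<le> i" "\<not> v i < v (i + 1)"
      using increasing_permutation_is_id[OF less.prems] by blast
    then have desc: "v i > v (i + 1)"
      using permutes_inj[OF less.prems] by (metis add_eq_self_zero inj_eq linorder_neqE_nat one_neq_zero)
    then have "(i, i + 1) \<in> inversions v" using i by (simp add: inversions_def)
    then have "i < n" using inversions_subset[OF less.prems] by auto
    have c: "inv_count v = Suc (inv_count (v \<circ> s i))"
      using inv_count_comp_s(2)[OF less.prems i(1) desc] .
    have "v \<circ> s i permutes {1..n}"
      using s_permutes[OF i(1) \<open>i < n\<close>] less.prems by (rule permutes_compose)
    then obtain ws where ws: "ws \<in> lists {1..<n}" "word_perm ws = v \<circ> s i" "length ws = inv_count (v \<circ> s i)"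
      using less.hyps[of "v \<circ> s i"] c by auto
    have "word_perm (ws @ [i]) = v"
      by (simp add: word_perm_append ws comp_assoc)
    then show ?thesis using ws i \<open>i < n\<close> c by (intro bexI[of _ "ws @ [i]"]) auto
  qed
qed

lemma S_inf_iff: "v \<in> S_inf \<longleftrightarrow> (\<exists>n. v permutes {1..n})"
proof
  assume "v \<in> S_inf"
  then obtain ws where "ws \<in> lists {1..}" "v = word_perm ws" by (auto simp: S_inf_def)
  then show "\<exists>n. v permutes {1..n}" using lists_bounded word_perm_permutes by blast
next
  assume "\<exists>n. v permutes {1..n}"
  then obtain n ws where "ws \<in> lists {1..<n}" "word_perm ws = v" using reduced_word_exists_aux by blast
  then show "v \<in> S_inf" unfolding S_inf_def by (auto simp: in_lists_conv_set)
qed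

lemma inv_count_word_perm_le: "ws \<in> lists {1..} \<Longrightarrow> inv_count (word_perm ws) \<le> length ws"
proof (induction ws rule: rev_induct)
  case Nil
  show ?case by (simp only: word_perm_Nil inversions_id) simp
next
  case (snoc i ws)
  then obtain n where "word_perm ws permutes {1..n}"
    using lists_bounded[of ws] word_perm_permutes snoc.prems by auto
  moreover have "1 \<le> i" using snoc by auto
  ultimately have "inv_count (word_perm ws \<circ> s i) \<le> Suc (inv_count (word_perm ws))"
    using inv_count_comp_s[of "word_perm ws" n i] by (metis le_Suc_eq le_refl linorder_neqE_nat
        add_eq_self_zero inj_eq one_neq_zero permutes_inj)
  also have "\<dots> \<le> Suc (length ws)" using snoc by simp
  finally show ?case
    by (simp only: word_perm_append word_perm_Cons word_perm_Nil o_id length_append list.size add_0 add_Suc_right)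
qed

lemma perm_length_eq_inv_count:
  assumes "w \<in> S_inf"
  shows "perm_length w = inv_count w"
  unfolding perm_length_def
proof (rule Least_equality)
  obtain n where "w permutes {1..n}" using assms S_inf_iff by blast
  from reduced_word_exists_aux[OF this]
  show "\<exists>ws\<in>lists {1..}. word_perm ws = w \<and> length ws = inv_count w"
    by (auto simp: in_lists_conv_set)
  show "inv_count w \<le> l" if "\<exists>ws\<in>lists {1..}. word_perm ws = w \<and> length ws = l" for l
    using that inv_count_word_perm_le by blast
qed

lemma word_perm_in_S_inf: "ws \<in> lists {1..} \<Longrightarrow> word_perm ws \<in> S_inf"
  by (auto simp: S_inf_def)

lemma reduced_word_iff:
  "reduced_word ws w \<longleftrightarrow> ws \<in> lists {1..} \<and> word_perm ws = w \<and> length ws = inv_count w"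
  unfolding reduced_word_def using perm_length_eq_inv_count word_perm_in_S_inf by metis

lemma reduced_word_exists:
  assumes "v permutes {1..n}"
  obtains ws where "ws \<in> lists {1..<n}" "reduced_word ws v"
  using reduced_word_exists_aux[OF assms] by (auto simp: reduced_word_iff in_lists_conv_set)

lemma S_inf_bij: "w \<in> S_inf \<Longrightarrow> bij w"
  using S_inf_iff permutes_bij by blast

lemma S_inf_inv: "w \<in> S_inf \<Longrightarrow> inv w \<in> S_inf"
  using S_inf_iff permutes_inv by blast

lemma S_inf_comp: "v \<in> S_inf \<Longrightarrow> w \<in> S_inf \<Longrightarrow> v \<circ> w \<in> S_inf"
proof -
  assume "v \<in> S_inf" "w \<in> S_inf"
  then obtain us ws where "us \<in> lists {1..}" "v = word_perm us" "ws \<in> lists {1..}" "w = word_perm ws"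
    unfolding S_inf_def by blast
  then have "us @ ws \<in> lists {1..}" "v \<circ> w = word_perm (us @ ws)"
    by (simp_all only: append_in_lists_conv word_perm_append)
  then show ?thesis unfolding S_inf_def by blast
qed

lemma S_inf_s: "1 \<le> i \<Longrightarrow> s i \<in> S_inf"
  using word_perm_in_S_inf[of "[i]"] by auto

lemma inv_s [simp]: "inv (s i) = s i"
  by simp

lemma bij_word_perm: "bij (word_perm ws)"
  by (induction ws) (simp_all only: word_perm_Nil word_perm_Cons bij_id bij_comp bij_transpose)

lemma inv_word_perm: "inv (word_perm ws) = word_perm (rev ws)"
proof (induction ws)
  case (Cons i ws)
  have "inv (s i \<circ> word_perm ws) = inv (word_perm ws) \<circ> inv (s i)"
    by (rule o_inv_distrib[OF bij_transpose bij_word_perm])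
  then show ?case using Cons by (simp only: word_perm_Cons rev.simps word_perm_append inv_s word_perm_Nil o_id)
qed (simp add: inv_id)

lemma inv_count_inv:
  assumes "w \<in> S_inf"
  shows "inv_count (inv w) = inv_count w"
proof -
  have le: "inv_count (inv w) \<le> inv_count w" if w: "w \<in> S_inf" for w
  proof -
    obtain n where "w permutes {1..n}" using w unfolding S_inf_iff by (elim exE)
    then obtain ws where "reduced_word ws w" by (rule reduced_word_exists)
    then have ws: "ws \<in> lists {1..}" "word_perm ws = w" "length ws = inv_count w"
      by (auto simp: reduced_word_iff)
    have "inv_count (word_perm (rev ws)) \<le> length (rev ws)"
      using ws by (intro inv_count_word_perm_le) auto
    moreover have "word_perm (rev ws) = inv w" unfolding ws(2)[symmetric] by (rule inv_word_perm[symmetric])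
    ultimately show ?thesis by (simp only: ws(3) length_rev)
  qed
  have "inv (inv w) = w" using S_inf_bij[OF assms] by (rule inv_inv_eq)
  then have "inv_count w \<le> inv_count (inv w)" using le[OF S_inf_inv[OF assms]] by (simp only:)
  then show ?thesis using le[OF assms] by (rule antisym[rotated])
qed

lemma inv_s_comp: "w \<in> S_inf \<Longrightarrow> inv (s i \<circ> w) = inv w \<circ> s i"
  by (subst o_inv_distrib) (auto simp: S_inf_bij)

lemma inv_count_s_comp:
  assumes w: "w \<in> S_inf" and i: "1 \<le> i"
  shows "inv w i < inv w (i + 1) \<Longrightarrow> inv_count (s i \<circ> w) = Suc (inv_count w)"
    and "inv w i > inv w (i + 1) \<Longrightarrow> inv_count w = Suc (inv_count (s i \<circ> w))"
proof -
  obtain n where n: "inv w permutes {1..n}" using S_inf_inv[OF w] S_inf_iff by blast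
  have "inv_count (s i \<circ> w) = inv_count (inv w \<circ> s i)"
    using inv_count_inv[OF S_inf_comp[OF S_inf_s[OF i] w]] inv_s_comp[OF w] by simp
  then show "inv w i < inv w (i + 1) \<Longrightarrow> inv_count (s i \<circ> w) = Suc (inv_count w)"
    "inv w i > inv w (i + 1) \<Longrightarrow> inv_count w = Suc (inv_count (s i \<circ> w))"
    using inv_count_comp_s[OF n i] inv_count_inv[OF w] by simp_all
qed

lemma reduced_word_S_inf: "reduced_word ws w \<Longrightarrow> w \<in> S_inf"
  unfolding reduced_word_def using word_perm_in_S_inf by blast

lemma reduced_word_ConsD:
  assumes "reduced_word (i # ws) w"
  shows "1 \<le> i" "reduced_word ws (s i \<circ> w)" "inv w i > inv w (i + 1)"
proof -
  have w: "w \<in> S_inf" using assms by (rule reduced_word_S_inf)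
  have r: "i # ws \<in> lists {1..}" "s i \<circ> word_perm ws = w" "Suc (length ws) = inv_count w"
    using assms by (auto simp: reduced_word_iff)
  show i: "1 \<le> i" using r by auto
  have sw: "s i \<circ> w = word_perm ws" using r(2) by auto
  have le: "inv_count (s i \<circ> w) \<le> length ws" unfolding sw using r by (intro inv_count_word_perm_le) auto
  show desc: "inv w i > inv w (i + 1)"
  proof (rule ccontr)
    assume "\<not> ?thesis"
    moreover have "inv w i \<noteq> inv w (i + 1)"
      using bij_is_inj[OF S_inf_bij[OF S_inf_inv[OF w]]] by (metis add_eq_self_zero inj_eq one_neq_zero)
    ultimately have "inv_count (s i \<circ> w) = Suc (inv_count w)"
      using inv_count_s_comp(1)[OF w i] by linarith
    then show False using le r by simp
  qed
  show "reduced_word ws (s i \<circ> w)"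
    unfolding reduced_word_iff using inv_count_s_comp(2)[OF w i desc] r sw by auto
qed

lemma reduced_word_ConsI:
  assumes "reduced_word ws (s i \<circ> w)" "1 \<le> i" "w \<in> S_inf" "inv w i > inv w (i + 1)"
  shows "reduced_word (i # ws) w"
  using assms inv_count_s_comp(2)[OF assms(3,2,4)] by (auto simp: reduced_word_iff)

text \<open>Matsumoto's theorem. If reduced words of \<open>w\<close> begin with \<open>i < j\<close>, then both are left descents of \<open>w\<close>.
  Hence \<open>w\<close> also has reduced words that begin with \<open>i j\<close> and \<open>j i\<close> and agree from there on, or with
  \<open>i j i\<close> and \<open>j i j\<close> if \<open>j = i + 1\<close>. These are related by one of the given relations, and to the two
  original words by the induction hypothesis, because they share a first letter with them.\<close>

lemma reduced_words_act_equally: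
  fixes p :: "nat \<Rightarrow> 'b \<Rightarrow> 'b"
  assumes comm: "\<And>i j x. i + 1 < j \<Longrightarrow> p i (p j x) = p j (p i x)"
    and braid: "\<And>i x. p i (p (i + 1) (p i x)) = p (i + 1) (p i (p (i + 1) x))"
  shows "reduced_word a w \<Longrightarrow> reduced_word b w \<Longrightarrow> foldr p a x = foldr p b x"
proof (induction "length a" arbitrary: a b w)
  case 0
  then have "length b = length a" by (simp only: reduced_word_iff)
  with 0 show ?case by simp
next
  case (Suc k)
  note IH = Suc.hyps(1)
  have len: "length b = length a" using Suc.prems by (simp only: reduced_word_iff)
  have w: "w \<in> S_inf" using Suc.prems(1) by (rule reduced_word_S_inf)
  have ex: "\<exists>c. reduced_word c v" if "v \<in> S_inf" for v
    using that unfolding S_inf_iff by (blast elim: reduced_word_exists)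
  have main: "p i (foldr p c x) = p j (foldr p d x)"
    if c: "reduced_word (i # c) w" and d: "reduced_word (j # d) w" and "i < j"
      and k: "k = length c" "k = length d" for i j c d
  proof -
    note ci = reduced_word_ConsD[OF c] and dj = reduced_word_ConsD[OF d]
    have swi: "s i \<circ> w \<in> S_inf" "s j \<circ> w \<in> S_inf"
      using S_inf_comp[OF S_inf_s w] ci(1) dj(1) by auto
    note invs = inv_s_comp[OF w] inv_s_comp[OF swi(1)] inv_s_comp[OF swi(2)]
    show ?thesis
    proof (cases "i + 1 < j")
      case True
      have sw2: "s j \<circ> (s i \<circ> w) \<in> S_inf" using S_inf_comp[OF S_inf_s swi(1)] dj(1) by auto
      then obtain e where e: "reduced_word e (s j \<circ> (s i \<circ> w))" using ex by blast
      have sij: "s j \<circ> s i = s i \<circ> s j" using True by (auto simp: fun_eq_iff transpose_if)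
      then have "s j \<circ> (s i \<circ> w) = s i \<circ> (s j \<circ> w)" by (simp only: comp_assoc[symmetric])
      with e have e': "reduced_word e (s i \<circ> (s j \<circ> w))" by (simp only:)
      have 1: "reduced_word (j # e) (s i \<circ> w)"
        using e dj(1) swi(1)
      proof (rule reduced_word_ConsI)
        show "inv (s i \<circ> w) j > inv (s i \<circ> w) (j + 1)"
          using dj(3) True unfolding invs by (simp add: transpose_if)
      qed
      have 2: "reduced_word (i # e) (s j \<circ> w)"
        using e' ci(1) swi(2)
      proof (rule reduced_word_ConsI)
        show "inv (s j \<circ> w) i > inv (s j \<circ> w) (i + 1)"
          using ci(3) True unfolding invs by (simp add: transpose_if)
      qed
      have "foldr p c x = p j (foldr p e x)" using IH[OF k(1) ci(2) 1] by simp
      moreover have "foldr p d x = p i (foldr p e x)" using IH[OF k(2) dj(2) 2] by simp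
      ultimately show ?thesis by (simp only: comm[OF True])
    next
      case False
      then have j: "j = i + 1" using \<open>i < j\<close> by simp
      define u where "u = inv w"
      have u: "u i > u j" "u j > u (j + 1)" "u i > u (j + 1)" using ci(3) dj(3) j by (auto simp: u_def)
      have sval: "s i i = j" "s i j = i" "s i (j + 1) = j + 1" "s j i = i" "s j j = j + 1" "s j (j + 1) = j"
        "s i (i + 1) = i" "s j (i + 1) = j + 1"
        by (auto simp: j transpose_if)
      have swij: "s j \<circ> (s i \<circ> w) \<in> S_inf" "s i \<circ> (s j \<circ> w) \<in> S_inf"
        using S_inf_comp[OF S_inf_s swi(1)] S_inf_comp[OF S_inf_s swi(2)] ci(1) dj(1) by auto
      then have "s i \<circ> (s j \<circ> (s i \<circ> w)) \<in> S_inf" using S_inf_comp[OF S_inf_s] ci(1) by blast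
      then obtain e where e: "reduced_word e (s i \<circ> (s j \<circ> (s i \<circ> w)))" using ex by blast
      have "s i \<circ> s j \<circ> s i = s j \<circ> s i \<circ> s j" by (auto simp: j fun_eq_iff transpose_if)
      then have "s i \<circ> (s j \<circ> (s i \<circ> w)) = s j \<circ> (s i \<circ> (s j \<circ> w))" by (simp only: comp_assoc[symmetric])
      with e have e': "reduced_word e (s j \<circ> (s i \<circ> (s j \<circ> w)))" by (simp only:)
      have 1: "reduced_word (i # e) (s j \<circ> (s i \<circ> w))"
        using e ci(1) swij(1)
      proof (rule reduced_word_ConsI)
        show "inv (s j \<circ> (s i \<circ> w)) i > inv (s j \<circ> (s i \<circ> w)) (i + 1)"
          by (simp only: invs u_def[symmetric] o_apply sval u)
      qed
      have 2: "reduced_word (j # i # e) (s i \<circ> w)"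
        using 1 dj(1) swi(1)
      proof (rule reduced_word_ConsI)
        show "inv (s i \<circ> w) j > inv (s i \<circ> w) (j + 1)"
          by (simp only: invs u_def[symmetric] o_apply sval u)
      qed
      have 3: "reduced_word (j # e) (s i \<circ> (s j \<circ> w))"
        using e' dj(1) swij(2)
      proof (rule reduced_word_ConsI)
        show "inv (s i \<circ> (s j \<circ> w)) j > inv (s i \<circ> (s j \<circ> w)) (j + 1)"
          by (simp only: invs u_def[symmetric] o_apply sval u)
      qed
      have 4: "reduced_word (i # j # e) (s j \<circ> w)"
        using 3 ci(1) swi(2)
      proof (rule reduced_word_ConsI)
        show "inv (s j \<circ> w) i > inv (s j \<circ> w) (i + 1)"
          by (simp only: invs u_def[symmetric] o_apply sval u)
      qed
      have "foldr p c x = p j (p i (foldr p e x))" using IH[OF k(1) ci(2) 2] by (simp only: foldr.simps o_apply)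
      moreover have "foldr p d x = p i (p j (foldr p e x))" using IH[OF k(2) dj(2) 4] by (simp only: foldr.simps o_apply)
      ultimately show ?thesis unfolding j by (simp only: braid)
    qed
  qed
  obtain i c where a: "a = i # c" using Suc.hyps(2) by (cases a) auto
  obtain j d where b: "b = j # d" using Suc.hyps(2) len by (cases b) auto
  have k: "k = length c" "k = length d" using Suc.hyps(2) len a b by auto
  note r = Suc.prems[unfolded a b]
  consider "i < j" | "j < i" | "i = j" by linarith
  then show ?case
  proof cases
    case 1
    then show ?thesis using main[OF r 1 k] a b by simp
  next
    case 2
    then show ?thesis using main[OF r(2,1) 2 k(2,1)] a b by simp
  next
    case 3
    then show ?thesis
      using IH[OF k(1) reduced_word_ConsD(2)[OF r(1)]] reduced_word_ConsD(2)[OF r(2)] a b by simp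
  qed
qed

lemma w_rev_permutes: "w_rev n permutes {1..n}"
proof (rule bij_imp_permutes)
  show "bij_betw (w_rev n) {1..n} {1..n}"
    by (rule bij_betw_byWitness[where f' = "w_rev n"]) (auto simp: w_rev_def)
qed (auto simp: w_rev_def)

lemma inv_w_rev: "inv (w_rev n) = w_rev n"
  by (rule inv_unique_comp) (auto simp: w_rev_def fun_eq_iff)

text \<open>Every simple reflection is a left descent of the longest element. This is why polynomials in the
  image of its operator are symmetric.\<close>

lemma reduced_word_w_rev_Cons:
  assumes "1 \<le> i" "i < n"
  obtains ws where "reduced_word (i # ws) (w_rev n)"
proof -
  have "s i \<circ> w_rev n permutes {1..n}"
    using w_rev_permutes s_permutes[OF assms] by (rule permutes_compose)
  then obtain ws where ws: "reduced_word ws (s i \<circ> w_rev n)" by (rule reduced_word_exists)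
  have "w_rev n \<in> S_inf" using w_rev_permutes S_inf_iff by blast
  moreover have "inv (w_rev n) i > inv (w_rev n) (i + 1)"
    using assms by (simp add: inv_w_rev) (auto simp: w_rev_def)
  ultimately have "reduced_word (i # ws) (w_rev n)"
    using ws assms(1) by (intro reduced_word_ConsI)
  then show ?thesis by (rule that)
qed

section \<open>Polynomials of bounded degree in the first variables\<close>

definition mdeg :: "(nat \<Rightarrow>\<^sub>0 nat) \<Rightarrow> nat"
  where "mdeg m = (\<Sum>i\<in>keys m. lookup m i)"

text \<open>The polynomials of degree at most \<open>d\<close> in \<open>x\<^sub>1, \<dots>, x\<^sub>n\<close>. The degree is recorded because the limit of
  a sequence of symmetric polynomials has to be of bounded degree.\<close>

definition poly_space :: "nat \<Rightarrow> nat \<Rightarrow> zpoly set"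
  where "poly_space n d = {f. \<forall>m\<in>keys f. keys m \<subseteq> {1..n} \<and> mdeg m \<le> d}"

lemma mdeg_superset:
  "finite A \<Longrightarrow> keys m \<subseteq> A \<Longrightarrow> mdeg m = (\<Sum>i\<in>A. lookup m i)"
  unfolding mdeg_def by (intro sum.mono_neutral_left) (auto simp: in_keys_iff)

lemma keys_add_nat: "keys (m + n :: nat \<Rightarrow>\<^sub>0 nat) = keys m \<union> keys n"
  by (auto simp: in_keys_iff lookup_add)

lemma mdeg_add: "mdeg (m + n) = mdeg m + mdeg n"
  by (simp add: mdeg_superset[of "keys m \<union> keys n"] keys_add_nat lookup_add sum.distrib)

lemma mdeg_single [simp]: "mdeg (single i k) = k"
  by (cases "k = 0") (simp_all add: mdeg_def)

lemma poly_space_0 [simp]: "0 \<in> poly_space n d"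
  by (simp add: poly_space_def)

lemma poly_space_mono: "f \<in> poly_space n d \<Longrightarrow> n \<le> n' \<Longrightarrow> d \<le> d' \<Longrightarrow> f \<in> poly_space n' d'"
  by (fastforce simp: poly_space_def)

lemma poly_space_add: "f \<in> poly_space n d \<Longrightarrow> g \<in> poly_space n d \<Longrightarrow> f + g \<in> poly_space n d"
  using Poly_Mapping.keys_add[of f g] by (auto simp: poly_space_def)

lemma poly_space_uminus: "f \<in> poly_space n d \<Longrightarrow> - f \<in> poly_space n d"
  by (simp add: poly_space_def)

lemma poly_space_sum: "(\<And>i. i \<in> A \<Longrightarrow> f i \<in> poly_space n d) \<Longrightarrow> (\<Sum>i\<in>A. f i) \<in> poly_space n d"
  by (induction A rule: infinite_finite_induct) (auto intro: poly_space_add)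

lemma poly_space_mult:
  assumes "f \<in> poly_space n d" "g \<in> poly_space n e"
  shows "f * g \<in> poly_space n (d + e)"
  unfolding poly_space_def
proof (intro CollectI ballI)
  fix m assume "m \<in> keys (f * g)"
  then obtain a b where "m = a + b" "a \<in> keys f" "b \<in> keys g"
    using Poly_Mapping.keys_mult[of f g] by blast
  then show "keys m \<subseteq> {1..n} \<and> mdeg m \<le> d + e"
    using assms unfolding poly_space_def by (auto simp: mdeg_add keys_add_nat intro!: add_mono)
qed

lemma poly_space_X: "1 \<le> i \<Longrightarrow> i \<le> n \<Longrightarrow> X i \<in> poly_space n 1"
  by (auto simp: poly_space_def X_def)

lemma poly_space_single:
  "keys m \<subseteq> {1..n} \<Longrightarrow> mdeg m \<le> d \<Longrightarrow> single m c \<in> poly_space n d"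
  by (auto simp: poly_space_def)

lemma poly_space_prod:
  assumes "finite A" "\<And>i. i \<in> A \<Longrightarrow> f i \<in> poly_space n 1"
  shows "(\<Prod>i\<in>A. f i) \<in> poly_space n (card A)"
  using assms
proof (induction A)
  case empty
  have "single 0 (1::int) \<in> poly_space n 0" by (rule poly_space_single) (auto simp: mdeg_def)
  then show ?case by simp
next
  case (insert x A)
  have "f x * prod f A \<in> poly_space n (1 + card A)"
    using insert by (intro poly_space_mult) auto
  then show ?case using insert by simp
qed

lemma eval_poly_cong:
  assumes "f \<in> poly_space n d" "\<And>i. 1 \<le> i \<Longrightarrow> i \<le> n \<Longrightarrow> a i = b i"
  shows "eval_poly a f = eval_poly b f"
  unfolding eval_poly_def monomial_at_def
proof (intro sum.cong arg_cong2[where f = "(*)"] prod.cong refl)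
  fix m i assume "m \<in> keys f" "i \<in> keys m"
  then have "i \<in> {1..n}" using assms(1) unfolding poly_space_def by blast
  then show "a i ^ lookup m i = b i ^ lookup m i" using assms(2) by simp
qed

lemma divdiff_add: "divdiff i (f + g) = divdiff i f + divdiff i g"
  by (rule divdiff_unique) (simp only: distrib_right divdiff_mult, simp add: permute_vars_eq_eval algebra_simps)

lemma divdiff_0 [simp]: "divdiff i 0 = 0"
  by (simp add: divdiff_eq_0_iff permute_vars_eq_eval)

lemma divdiff_sum: "divdiff i (\<Sum>k\<in>A. f k) = (\<Sum>k\<in>A. divdiff i (f k))"
  by (induction A rule: infinite_finite_induct) (auto simp: divdiff_add)

lemma divdiff_of_int_mult: "divdiff i (of_int c * f) = of_int c * divdiff i f"
  by (rule divdiff_unique) (simp only: mult.assoc divdiff_mult, simp add: permute_vars_eq_eval algebra_simps)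

lemma divdiff_X_mult:
  "divdiff i (X j * f) = (if j = i then f else if j = i + 1 then - f else 0) + X (s i j) * divdiff i f"
proof (rule divdiff_unique)
  have "X j * f - permute_vars (s i) (X j * f) = (X j - X (s i j)) * f + X (s i j) * (f - permute_vars (s i) f)"
    by (simp add: permute_vars_eq_eval algebra_simps)
  also have "(X j - X (s i j)) * f = (if j = i then f else if j = i + 1 then - f else 0) * (X i - X (i + 1))"
    by (simp add: transpose_if algebra_simps)
  also have "f - permute_vars (s i) f = divdiff i f * (X i - X (i + 1))" by (rule divdiff_mult[symmetric])
  finally show "((if j = i then f else if j = i + 1 then - f else 0) + X (s i j) * divdiff i f) * (X i - X (i + 1)) =
    X j * f - permute_vars (s i) (X j * f)"
    by (simp only: distrib_right mult.assoc)
qed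

text \<open>Induction on the degree by the twisted Leibniz rule \<open>divdiff_X_mult\<close>.\<close>

lemma divdiff_monomial_space:
  assumes i: "1 \<le> i" "i < n"
  shows "keys m \<subseteq> {1..n} \<Longrightarrow>
    divdiff i (single m 1) \<in> poly_space n (mdeg m - 1)"
proof (induction "mdeg m" arbitrary: m)
  case 0
  then have "m = 0" by (metis mdeg_def card_0_eq finite_keys in_keys_iff keys_eq_empty sum_eq_0_iff equals0I)
  then have "divdiff i (single m 1) = 0"
    by (simp add: divdiff_eq_0_iff permute_vars_eq_eval)
  then show ?case by simp
next
  case (Suc k)
  have "m \<noteq> 0" using Suc.hyps(2) by (auto simp: mdeg_def)
  then obtain j where j: "j \<in> keys m" by (metis keys_eq_empty equals0I)
  define m' where "m' = m - single j 1"
  have m: "m = single j 1 + m'"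
    using j by (intro poly_mapping_eqI) (auto simp: m'_def lookup_add lookup_minus lookup_single when_def in_keys_iff)
  have deg: "mdeg m = Suc (mdeg m')" by (simp add: m mdeg_add)
  have kj: "keys m' \<subseteq> {1..n}" "j \<in> {1..n}" using Suc.prems j by (auto simp: m keys_add_nat)
  have IH: "divdiff i (single m' 1) \<in> poly_space n (mdeg m' - 1)"
    using Suc deg kj by simp
  have "single m (1::int) = X j * single m' 1"
    by (simp add: X_def m mult_single)
  then have eq: "divdiff i (single m 1) =
     (if j = i then single m' 1 else if j = i + 1 then - single m' 1 else 0)
      + X (s i j) * divdiff i (single m' 1)"
    by (simp only: divdiff_X_mult)
  have "single m' (1::int) \<in> poly_space n (mdeg m')" using kj by (intro poly_space_single) auto
  moreover have "X (s i j) * divdiff i (single m' 1) \<in> poly_space n (mdeg m')"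
  proof (cases "mdeg m' = 0")
    case True
    then have "m' = 0" by (metis mdeg_def card_0_eq finite_keys in_keys_iff keys_eq_empty sum_eq_0_iff equals0I)
    then have "divdiff i (single m' 1) = 0"
      by (simp add: divdiff_eq_0_iff permute_vars_eq_eval)
    then show ?thesis by simp
  next
    case False
    have "s i j \<in> {1..n}" using i kj by (auto simp: transpose_if)
    then have "X (s i j) * divdiff i (single m' 1) \<in> poly_space n (1 + (mdeg m' - 1))"
      using IH by (intro poly_space_mult poly_space_X) auto
    then show ?thesis using False by simp
  qed
  ultimately show ?case unfolding eq deg by (intro poly_space_add) (simp_all add: poly_space_uminus)
qed

lemma pi_op_space:
  assumes "1 \<le> i" "i < n" "f \<in> poly_space n d"
  shows "pi_op i f \<in> poly_space n d"
proof -
  let ?g = "X i * f"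
  have "?g \<in> poly_space n (1 + d)" using assms by (intro poly_space_mult poly_space_X) auto
  then have g: "keys m \<subseteq> {1..n} \<and> mdeg m \<le> Suc d" if "m \<in> keys ?g" for m
    using that by (auto simp: poly_space_def)
  have "divdiff i ?g = divdiff i (\<Sum>m\<in>keys ?g. of_int (lookup ?g m) * single m 1)"
    using zpoly_sum_of_terms[of ?g] by (simp add: of_int_times_monomial)
  also have "\<dots> = (\<Sum>m\<in>keys ?g. of_int (lookup ?g m) * divdiff i (single m 1))"
    by (simp only: divdiff_sum divdiff_of_int_mult)
  also have "\<dots> \<in> poly_space n d"
  proof (rule poly_space_sum)
    fix m assume "m \<in> keys ?g"
    with g have m: "keys m \<subseteq> {1..n}" "mdeg m \<le> Suc d" by auto
    have "single 0 (lookup ?g m) * divdiff i (single m 1) \<in> poly_space n (0 + (mdeg m - 1))"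
      using divdiff_monomial_space[OF assms(1,2) m(1)]
      by (intro poly_space_mult poly_space_single) (auto simp: mdeg_def)
    then have "of_int (lookup ?g m) * divdiff i (single m 1) \<in> poly_space n (mdeg m - 1)"
      by (simp flip: single_of_int)
    then show "of_int (lookup ?g m) * divdiff i (single m 1) \<in> poly_space n d"
      using m(2) by (elim poly_space_mono) auto
  qed
  finally show ?thesis unfolding pi_op_def .
qed

lemma foldr_pi_op_space:
  "ws \<in> lists {1..<n} \<Longrightarrow> f \<in> poly_space n d \<Longrightarrow> foldr pi_op ws f \<in> poly_space n d"
  by (induction ws) (auto intro: pi_op_space)

section \<open>The longest element acts by symmetrization\<close>

definition point :: "'a::zero list \<Rightarrow> nat \<Rightarrow> 'a"
  where "point xs i = (if 1 \<le> i \<and> i \<le> length xs then xs ! (i - 1) else 0)"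

definition symmetrize :: "zpoly \<Rightarrow> 'a::field set \<Rightarrow> 'a"
  where "symmetrize f A = (\<Sum>xs\<in>orderings A. eval_poly (point xs) f * sym_weight xs)"

definition swap_at :: "nat \<Rightarrow> 'a list \<Rightarrow> 'a list"
  where "swap_at k xs = xs[k := xs ! Suc k, Suc k := xs ! k]"

lemma split_at_two:
  assumes "Suc k < length xs"
  obtains us b d ys where "xs = us @ b # d # ys" "length us = k"
proof
  show "xs = take k xs @ xs ! k # xs ! Suc k # drop (Suc (Suc k)) xs"
    using assms by (metis Cons_nth_drop_Suc Suc_lessD append_take_drop_id)
  show "length (take k xs) = k" using assms by simp
qed

lemma swap_at_append: "length us = k \<Longrightarrow> swap_at k (us @ b # d # ys) = us @ d # b # ys"
  by (simp add: swap_at_def list_update_append nth_append)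

text \<open>Each ordering is paired with the one in which the entries in places \<open>i\<close> and \<open>i + 1\<close> are exchanged:
  the two values of \<open>f\<close> that occur in \<open>\<pi>\<^sub>i f\<close> are redistributed, and the coefficients of \<open>\<pi>\<^sub>i\<close> sum
  to 1.\<close>

lemma symmetrize_pi_op:
  fixes A :: "'a::field set"
  assumes A: "finite A" and i: "1 \<le> i" "i < card A"
  shows "symmetrize (pi_op i f) A = symmetrize f A"
proof -
  \<comment> \<open>The position in a list, counted from 0, of the variable \<open>x\<^sub>i\<close>.\<close>
  define k where "k = i - 1"
  have ik: "i = Suc k" using i by (simp add: k_def)
  define E where "E xs = eval_poly (point xs) f" for xs :: "'a list"
  define c where "c xs = xs ! k / (xs ! k - xs ! Suc k)" for xs :: "'a list"
  have split: "\<exists>us b d ys. xs = us @ b # d # ys \<and> length us = k \<and> distinct xs"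
    if "xs \<in> orderings A" for xs
  proof -
    have "distinct xs" "Suc k < length xs"
      using permutations_of_setD[OF that] i ik distinct_card[of xs] by auto
    then show ?thesis using split_at_two[of k xs] by metis
  qed
  have ev: "eval_poly (point xs) (pi_op i f) = c xs * E xs + c (swap_at k xs) * E (swap_at k xs)"
    if xs: "xs \<in> orderings A" for xs
  proof -
    obtain us b d ys where u: "xs = us @ b # d # ys" "length us = k" "distinct xs" using split[OF xs] by blast
    have p: "point xs i = b" "point xs (i + 1) = d" using u(2) ik by (auto simp: point_def u(1) nth_append)
    have "b \<noteq> d" using u by auto
    have "point xs \<circ> s i = point (swap_at k xs)"
    proof
      fix l
      show "(point xs \<circ> s i) l = point (swap_at k xs) l"
        unfolding u(1) swap_at_append[OF u(2)] using u(2)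
        by (auto simp: point_def ik transpose_if nth_append nth_Cons' )
    qed
    moreover have "c xs = b / (b - d)" "c (swap_at k xs) = d / (d - b)"
      unfolding u(1) swap_at_append[OF u(2)] c_def using u(2) by (auto simp: nth_append)
    ultimately show ?thesis using eval_pi_op[of "point xs" i f] \<open>b \<noteq> d\<close> p by (simp add: E_def)
  qed
  have weights: "c xs * (sym_weight xs + sym_weight (swap_at k xs)) = sym_weight xs"
    if xs: "xs \<in> orderings A" for xs
  proof -
    obtain us b d ys where u: "xs = us @ b # d # ys" "length us = k" "distinct xs" using split[OF xs] by blast
    obtain r where r: "sym_weight (us @ b # d # ys) = r * (b / (b - d))"
      "sym_weight (us @ d # b # ys) = r * (d / (d - b))"
      using u by (metis sym_weight_swap)
    have "b - d \<noteq> 0" "d - b \<noteq> 0" using u by auto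
    then have "b / (b - d) + d / (d - b) = 1"
    proof -
      have "d / (d - b) = d / - (b - d)" by simp
      also have "\<dots> = - (d / (b - d))" by (rule minus_divide_right[symmetric])
      finally have "b / (b - d) + d / (d - b) = (b - d) / (b - d)" by (simp only: diff_divide_distrib) simp
      then show ?thesis using \<open>b - d \<noteq> 0\<close> by simp
    qed
    then have "r * (b / (b - d)) + r * (d / (d - b)) = r" by (metis distrib_left mult.right_neutral)
    moreover have "c xs = b / (b - d)" unfolding u(1) c_def using u(2) by (auto simp: nth_append)
    ultimately show ?thesis unfolding u(1) swap_at_append[OF u(2)] r by (simp add: u(1))
  qed
  have swap_mem: "swap_at k xs \<in> orderings A" "swap_at k (swap_at k xs) = xs"
    if xs: "xs \<in> orderings A" for xs
  proof -
    obtain us b d ys where u: "xs = us @ b # d # ys" "length us = k" "distinct xs" using split[OF xs] by blast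
    show "swap_at k xs \<in> orderings A"
      using permutations_of_setD[OF xs] unfolding u(1) swap_at_append[OF u(2)]
      by (intro permutations_of_setI) auto
    show "swap_at k (swap_at k xs) = xs" by (simp add: u(1) swap_at_append[OF u(2)])
  qed
  have reindex: "(\<Sum>xs\<in>orderings A. c (swap_at k xs) * E (swap_at k xs) * sym_weight xs) =
    (\<Sum>xs\<in>orderings A. c xs * E xs * sym_weight (swap_at k xs))"
    by (rule sum.reindex_bij_witness[where i = "swap_at k" and j = "swap_at k"]) (simp_all add: swap_mem)
  have "symmetrize (pi_op i f) A = (\<Sum>xs\<in>orderings A. c xs * E xs * sym_weight xs)
     + (\<Sum>xs\<in>orderings A. c (swap_at k xs) * E (swap_at k xs) * sym_weight xs)"
    unfolding symmetrize_def sum.distrib[symmetric]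
    by (intro sum.cong refl) (simp add: ev distrib_right)
  also have "\<dots> = (\<Sum>xs\<in>orderings A. E xs * (c xs * (sym_weight xs + sym_weight (swap_at k xs))))"
    unfolding reindex sum.distrib[symmetric] by (intro sum.cong refl) (simp only: distrib_left mult_ac)
  also have "\<dots> = symmetrize f A"
    unfolding symmetrize_def by (intro sum.cong refl) (simp add: weights E_def)
  finally show ?thesis .
qed

lemma symmetrize_word:
  "finite A \<Longrightarrow> ws \<in> lists {1..<card A} \<Longrightarrow> symmetrize (foldr pi_op ws f) A = symmetrize f A"
  by (induction ws) (auto simp: symmetrize_pi_op)

text \<open>The factors \<open>0 / (0 - j)\<close> in the weight remove all orderings in which 0 is not the last entry.\<close>

lemma symmetrize_insert_0:
  assumes A: "finite A" "0 \<notin> A"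
  shows "symmetrize f (insert 0 A) = symmetrize f A"
proof -
  define g where "g xs = eval_poly (point xs) f * sym_weight xs" for xs :: "'a list"
  have "symmetrize f (insert 0 A) = (\<Sum>a\<in>insert 0 A. \<Sum>xs\<in>orderings (insert 0 A - {a}). g (xs @ [a]))"
    unfolding symmetrize_def g_def using A by (intro sum_permutations_of_set_snoc) auto
  also have "\<dots> = (\<Sum>xs\<in>orderings (insert 0 A - {0}). g (xs @ [0]))"
  proof (rule sum_eq_single_term)
    fix a assume a: "a \<in> insert 0 A - {0}"
    show "(\<Sum>xs\<in>orderings (insert 0 A - {a}). g (xs @ [a])) = 0"
    proof (rule sum.neutral, rule ballI)
      fix xs assume "xs \<in> orderings (insert 0 A - {a})"
      then have xs: "set xs = insert 0 A - {a}" "distinct xs" using permutations_of_setD by auto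
      then have "0 \<in> set xs" using a by blast
      then have "node_factor a (set xs) = 0" by (intro prod_zero bexI[of _ 0]) simp_all
      moreover have "distinct (xs @ [a])" using xs by simp
      ultimately have "sym_weight (xs @ [a]) = 0" by (simp only: sym_weight_snoc mult_zero_left)
      then show "g (xs @ [a]) = 0" unfolding g_def by (simp only: mult_zero_right)
    qed
  qed (use A in simp_all)
  also have "insert 0 A - {0} = A" using A by blast
  also have "(\<Sum>xs\<in>orderings A. g (xs @ [0])) = symmetrize f A"
    unfolding symmetrize_def
  proof (rule sum.cong[OF refl])
    fix xs assume "xs \<in> orderings A"
    then have xs: "set xs = A" "distinct xs" using permutations_of_setD by auto
    have "point (xs @ [0]) = point xs" by (auto simp: point_def fun_eq_iff nth_append)
    moreover have "sym_weight (xs @ [0]) = sym_weight xs"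
    proof -
      have "node_factor 0 (set xs) = 1"
      proof (rule prod.neutral, rule ballI)
        fix j assume "j \<in> set xs"
        then have "j \<noteq> 0" using A xs by blast
        then show "j / (j - 0) = 1" by simp
      qed
      moreover have "distinct (xs @ [0])" using A xs by simp
      ultimately show ?thesis by (simp only: sym_weight_snoc mult_1)
    qed
    ultimately show "g (xs @ [0]) = eval_poly (point xs) f * sym_weight xs" by (simp only: g_def)
  qed
  finally show ?thesis .
qed

lemma permutation_lists_bij:
  assumes "inj_on a {1..n}"
  shows "bij_betw (\<lambda>w. map (a \<circ> w) [1..<Suc n]) {w. w permutes {1..n}} (orderings (a ` {1..n}))"
proof -
  let ?h = "\<lambda>w. map (a \<circ> w) [1..<Suc n]"
  have inj: "inj_on ?h {w. w permutes {1..n}}"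
  proof (rule inj_onI, clarify)
    fix v w assume v: "v permutes {1..n}" and w: "w permutes {1..n}" and eq: "?h v = ?h w"
    show "v = w"
    proof
      fix i
      show "v i = w i"
      proof (cases "i \<in> {1..n}")
        case True
        then have "a (v i) = a (w i)" using eq by (auto simp: map_eq_conv)
        moreover have "v i \<in> {1..n}" "w i \<in> {1..n}" using True permutes_in_image[OF v] permutes_in_image[OF w] by blast+
        ultimately show ?thesis by (rule inj_onD[OF assms])
      qed (use v w in \<open>simp add: permutes_not_in\<close>)
    qed
  qed
  have sub: "?h ` {w. w permutes {1..n}} \<subseteq> orderings (a ` {1..n})"
  proof clarify
    fix w assume w: "w permutes {1..n}"
    have "set (?h w) = a ` w ` {1..n}" by (auto simp: image_comp atLeastLessThanSuc_atLeastAtMost simp del: upt_Suc)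
    also have "\<dots> = a ` {1..n}" by (simp only: permutes_image[OF w])
    finally have "set (?h w) = a ` {1..n}" .
    moreover have "inj_on (a \<circ> w) {1..n}"
      using assms permutes_image[OF w] permutes_inj_on[OF w] by (intro comp_inj_on) auto
    then have "distinct (?h w)" by (simp add: distinct_map atLeastLessThanSuc_atLeastAtMost del: upt_Suc)
    ultimately show "?h w \<in> orderings (a ` {1..n})" by (rule permutations_of_setI)
  qed
  have "card (?h ` {w. w permutes {1..n}}) = card (orderings (a ` {1..n}))"
  proof -
    have "card (?h ` {w. w permutes {1..n}}) = fact n"
      unfolding card_image[OF inj] by (rule card_permutations) auto
    moreover have "card (orderings (a ` {1..n})) = fact n"
      using card_image[OF assms] by (subst card_permutations_of_set) auto
    ultimately show ?thesis by simp
  qed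
  then have "?h ` {w. w permutes {1..n}} = orderings (a ` {1..n})"
    by (intro card_subset_eq sub) auto
  with inj show ?thesis by (simp add: bij_betw_def)
qed

lemma permute_vars_symmetric:
  assumes "\<And>i. 1 \<le> i \<Longrightarrow> i < n \<Longrightarrow> permute_vars (s i) G = G" "w permutes {1..n}"
  shows "permute_vars w G = G"
proof -
  obtain ws where ws: "ws \<in> lists {1..<n}" "reduced_word ws w"
    using assms(2) by (rule reduced_word_exists)
  have "permute_vars (word_perm ws) G = G" using ws(1)
  proof (induction ws)
    case (Cons i ws)
    then have "permute_vars (s i) (permute_vars (word_perm ws) G) = G" using assms(1)[of i] by auto
    then show ?case by (simp only: permute_vars_comp word_perm_Cons)
  qed (simp only: word_perm_Nil permute_vars_id)
  then show ?thesis using ws(2) by (simp add: reduced_word_iff)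
qed

lemma point_permutation_list:
  assumes "1 \<le> i" "i \<le> n"
  shows "point (map (a \<circ> w) [1..<Suc n]) i = a (w i)"
  using assms by (simp add: point_def nth_map del: upt_Suc)

text \<open>A symmetric polynomial can be taken out of the sum, which leaves the total weight 1.\<close>

lemma symmetrize_symmetric:
  assumes "G \<in> poly_space n d" "\<And>i. 1 \<le> i \<Longrightarrow> i < n \<Longrightarrow> permute_vars (s i) G = G"
    and a: "inj_on a {1..n}"
  shows "symmetrize G (a ` {1..n}) = eval_poly a G"
proof -
  have "eval_poly (point xs) G = eval_poly a G" if xs: "xs \<in> orderings (a ` {1..n})" for xs
  proof -
    obtain w where w: "w permutes {1..n}" "xs = map (a \<circ> w) [1..<Suc n]"
      using xs bij_betw_imp_surj_on[OF permutation_lists_bij[OF a]] by blast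
    have "eval_poly (point xs) G = eval_poly (a \<circ> w) G"
      using assms(1) by (rule eval_poly_cong) (simp only: w(2) point_permutation_list o_apply)
    also have "\<dots> = eval_poly a (permute_vars w G)" by (rule eval_poly_permute_vars[symmetric])
    also have "permute_vars w G = G" using assms(2) w(1) by (rule permute_vars_symmetric)
    finally show ?thesis .
  qed
  then have "symmetrize G (a ` {1..n}) = (\<Sum>xs\<in>orderings (a ` {1..n}). eval_poly a G * sym_weight xs)"
    unfolding symmetrize_def by (intro sum.cong refl) simp
  also have "\<dots> = eval_poly a G"
    by (simp add: sum_distrib_left[symmetric] sum_sym_weight)
  finally show ?thesis .
qed

lemma pi_perm_reduced_word:
  assumes "reduced_word ws w"
  shows "pi_perm w f = foldr pi_op ws f"
proof -
  have "reduced_word (SOME ws. reduced_word ws w) w" using assms by (rule someI)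
  then show ?thesis
    unfolding pi_perm_def using assms
    by (intro reduced_words_act_equally pi_op_commute pi_op_braid)
qed

lemma pi_perm_word:
  assumes "w permutes {1..n}"
  obtains ws where "ws \<in> lists {1..<n}" "\<And>f. pi_perm w f = foldr pi_op ws f"
  using reduced_word_exists[OF assms] pi_perm_reduced_word by metis

lemma pi_w_rev_space: "f \<in> poly_space n d \<Longrightarrow> pi_perm (w_rev n) f \<in> poly_space n d"
  using pi_perm_word[OF w_rev_permutes[of n]] foldr_pi_op_space by metis

lemma pi_w_rev_symmetric:
  assumes "1 \<le> i" "i < n"
  shows "permute_vars (s i) (pi_perm (w_rev n) f) = pi_perm (w_rev n) f"
proof -
  obtain ws where "reduced_word (i # ws) (w_rev n)" using assms by (rule reduced_word_w_rev_Cons)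
  then have "pi_perm (w_rev n) f = pi_op i (foldr pi_op ws f)" by (simp add: pi_perm_reduced_word)
  then show ?thesis by (simp only: permute_vars_pi_op)
qed

text \<open>The polynomial \<open>\<pi>\<^bsub>w\<^esub> f\<close> for \<open>w = w\<^sub>n\<close> is symmetric, hence fixed by the symmetrizer, which in turn absorbs
  the operators of a reduced word of \<open>w\<^sub>n\<close>.\<close>

lemma eval_pi_w_rev:
  assumes f: "f \<in> poly_space n d" and a: "inj_on a {1..n}"
  shows "eval_poly a (pi_perm (w_rev n) f) = symmetrize f (a ` {1..n})"
proof -
  obtain ws where ws: "ws \<in> lists {1..<n}" "\<And>f. pi_perm (w_rev n) f = foldr pi_op ws f"
    using pi_perm_word[OF w_rev_permutes] by blast
  have "eval_poly a (pi_perm (w_rev n) f) = symmetrize (pi_perm (w_rev n) f) (a ` {1..n})"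
    using pi_w_rev_space[OF f] pi_w_rev_symmetric a by (rule symmetrize_symmetric[symmetric])
  also have "\<dots> = symmetrize f (a ` {1..n})"
    unfolding ws(2) using ws(1) a by (intro symmetrize_word) (auto simp: card_image)
  finally show ?thesis .
qed

definition truncate_vars :: "nat \<Rightarrow> zpoly \<Rightarrow> zpoly"
  where "truncate_vars n f = eval_poly (\<lambda>i. if i \<in> {1..n} then X i else 0) f"

lemma lookup_truncate_vars:
  "lookup (truncate_vars n f) m =
    (if keys m \<subseteq> {1..n} then lookup f m else 0)"
proof -
  have mon: "monomial_at (\<lambda>i. if i \<in> {1..n} then X i else 0) m =
      (if keys m \<subseteq> {1..n} then single m 1 else 0)" for m
  proof (cases "keys m \<subseteq> {1..n}")
    case True
    then have "monomial_at (\<lambda>i. if i \<in> {1..n} then X i else 0) m = monomial_at X m"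
      unfolding monomial_at_def by (intro prod.cong refl) auto
    then show ?thesis using True by (simp add: monomial_at_X)
  next
    case False
    then obtain i where "i \<in> keys m" "i \<notin> {1..n}" by blast
    then have "monomial_at (\<lambda>i. if i \<in> {1..n} then X i else 0) m = 0"
      unfolding monomial_at_def by (intro prod_zero) (auto simp: in_keys_iff intro!: bexI[of _ i])
    then show ?thesis using False by simp
  qed
  have "lookup (truncate_vars n f) m =
    (\<Sum>k\<in>keys f. if k = m then (if keys k \<subseteq> {1..n} then lookup f k else 0) else 0)"
    unfolding truncate_vars_def eval_poly_def mon lookup_sum
    by (intro sum.cong refl) (auto simp: of_int_times_monomial lookup_single when_def)
  also have "\<dots> = (if keys m \<subseteq> {1..n} then lookup f m else 0)"
    by (simp add: in_keys_iff)
  finally show ?thesis .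
qed

lemma eval_truncate_vars:
  "eval_poly a (truncate_vars n f) = eval_poly (\<lambda>i. if i \<in> {1..n} then a i else 0) f"
  unfolding truncate_vars_def eval_poly_eval_poly
  by (rule arg_cong[where f = "\<lambda>a. eval_poly a f"]) auto

lemma pi_w_rev_stable:
  assumes "f \<in> poly_space n d"
  shows "truncate_vars n (pi_perm (w_rev (Suc n)) f) = pi_perm (w_rev n) f"
proof (rule zpoly_eq_by_generic_eval)
  define a where "a i = (if i \<in> {1..n} then generic i else 0)" for i
  have nz: "generic i \<noteq> 0" for i using generic_add_nonzero[of i i] by auto
  have inj: "inj_on a {1..Suc n}" by (auto simp: inj_on_def a_def generic_inj nz nz[symmetric] split: if_splits)
  have inj': "inj_on generic {1..n}" by (auto simp: inj_on_def generic_inj)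
  have f': "f \<in> poly_space (Suc n) d" using assms by (rule poly_space_mono) auto
  have "{1..Suc n} = insert (Suc n) {1..n}" by auto
  then have im: "a ` {1..Suc n} = insert 0 (generic ` {1..n})"
    by (auto simp: a_def image_iff)
  have "eval_poly generic (truncate_vars n (pi_perm (w_rev (Suc n)) f)) = eval_poly a (pi_perm (w_rev (Suc n)) f)"
    unfolding eval_truncate_vars a_def ..
  also have "\<dots> = symmetrize f (insert 0 (generic ` {1..n}))"
    using eval_pi_w_rev[OF f' inj] im by simp
  also have "\<dots> = symmetrize f (generic ` {1..n})" using nz by (intro symmetrize_insert_0) auto
  also have "\<dots> = eval_poly generic (pi_perm (w_rev n) f)" using eval_pi_w_rev[OF assms inj'] by simp
  finally show "eval_poly generic (truncate_vars n (pi_perm (w_rev (Suc n)) f)) = eval_poly generic (pi_perm (w_rev n) f)" .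
qed

section \<open>Symmetric functions as limits of symmetric polynomials\<close>

lemma monomial_at_permuted:
  assumes "bij w"
  shows "monomial_at (\<lambda>i. X (w i)) m = single (Poly_Mapping.map_key (inv w) m) 1"
proof -
  have inj: "inj (inv w)" using assms by (simp add: bij_imp_bij_inv bij_is_inj)
  have iw: "inv w (w i) = i" "w (inv w i) = i" for i
    using assms by (simp_all add: bij_is_inj bij_is_surj surj_f_inv_f)
  have "bij_betw w (keys m) (keys (Poly_Mapping.map_key (inv w) m))"
    by (rule bij_betw_byWitness[where f' = "inv w"]) (auto simp: in_keys_iff map_key.rep_eq inj iw)
  then have "monomial_at (\<lambda>i. X (w i)) m =
      (\<Prod>j\<in>keys (Poly_Mapping.map_key (inv w) m). X j ^ lookup m (inv w j))"
    unfolding monomial_at_def by (intro prod.reindex_bij_witness[where i = "inv w" and j = w])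
      (auto simp: in_keys_iff map_key.rep_eq inj iw)
  also have "\<dots> = monomial_at X (Poly_Mapping.map_key (inv w) m)"
    by (simp add: monomial_at_def map_key.rep_eq inj)
  finally show ?thesis by (simp add: monomial_at_X)
qed

lemma lookup_permute_vars:
  assumes "bij w"
  shows "lookup (permute_vars w f) m = lookup f (Poly_Mapping.map_key w m)"
proof -
  have inj: "inj w" "inj (inv w)" using assms by (simp_all add: bij_imp_bij_inv bij_is_inj)
  have iw: "inv w (w i) = i" "w (inv w i) = i" for i
    using assms by (simp_all add: bij_is_inj bij_is_surj surj_f_inv_f)
  have eq: "Poly_Mapping.map_key (inv w) k = m \<longleftrightarrow> k = Poly_Mapping.map_key w m" for k
    by (auto intro!: poly_mapping_eqI simp: map_key.rep_eq inj iw)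
  have "lookup (permute_vars w f) m =
    (\<Sum>k\<in>keys f. if k = Poly_Mapping.map_key w m then lookup f k else 0)"
    unfolding permute_vars_eq_eval eval_poly_def monomial_at_permuted[OF assms] lookup_sum of_int_times_monomial
    by (intro sum.cong refl) (simp add: lookup_single when_def eq)
  also have "\<dots> = lookup f (Poly_Mapping.map_key w m)"
    by (simp add: in_keys_iff)
  finally show ?thesis .
qed

lemma finite_bounded_monomials:
  "finite {m. keys m \<subseteq> {1..n} \<and> mdeg m \<le> d}"
proof (rule finite_imageD)
  let ?M = "{m. keys m \<subseteq> {1..n} \<and> mdeg m \<le> d}"
  show "inj_on lookup ?M" by (auto intro: inj_onI poly_mapping_eqI)
  have "lookup ` ?M \<subseteq> {f. \<forall>i. (i \<in> {1..n} \<longrightarrow> f i \<in> {0..d}) \<and> (i \<notin> {1..n} \<longrightarrow> f i = 0)}"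
  proof clarify
    fix m i assume m: "keys m \<subseteq> {1..n}" "mdeg m \<le> d"
    have "lookup m i \<le> mdeg m"
      unfolding mdeg_def by (cases "i \<in> keys m") (auto intro: member_le_sum simp: in_keys_iff)
    then show "(i \<in> {1..n} \<longrightarrow> lookup m i \<in> {0..d}) \<and> (i \<notin> {1..n} \<longrightarrow> lookup m i = 0)"
      using m by (auto simp: in_keys_iff subset_iff)
  qed
  moreover have "finite {f::nat \<Rightarrow> nat. \<forall>i. (i \<in> {1..n} \<longrightarrow> f i \<in> {0..d}) \<and> (i \<notin> {1..n} \<longrightarrow> f i = 0)}"
    by (rule finite_set_of_finite_funs) auto
  ultimately show "finite (lookup ` ?M)" by (rule finite_subset)
qed

lemma symmetric_function_bounded:
  assumes "symmetric_function F"
  obtains d where "\<And>m. F m \<noteq> 0 \<Longrightarrow> keys m \<subseteq> {1..} \<and> mdeg m \<le> d"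
  using assms unfolding symmetric_function_def mdeg_def by blast

lemma lookup_restrict_vars:
  assumes "symmetric_function F"
  shows "lookup (restrict_vars n F) m = (if keys m \<subseteq> {1..n} then F m else 0)"
proof -
  obtain d where d: "\<And>m. F m \<noteq> 0 \<Longrightarrow> keys m \<subseteq> {1..} \<and> mdeg m \<le> d"
    using symmetric_function_bounded[OF assms] by blast
  have "{m. (if keys m \<subseteq> {1..n} then F m else 0) \<noteq> 0} \<subseteq> {m. keys m \<subseteq> {1..n} \<and> mdeg m \<le> d}"
    using d by (auto split: if_splits)
  then have "finite {m. (if keys m \<subseteq> {1..n} then F m else 0) \<noteq> 0}"
    using finite_bounded_monomials finite_subset by blast
  then show ?thesis unfolding restrict_vars_def by (simp add: lookup_Abs_poly_mapping)
qed

lemma restrict_vars_space: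
  assumes "symmetric_function F"
  obtains d where "\<And>n. restrict_vars n F \<in> poly_space n d"
proof -
  obtain d where d: "\<And>m. F m \<noteq> 0 \<Longrightarrow> keys m \<subseteq> {1..} \<and> mdeg m \<le> d"
    using symmetric_function_bounded[OF assms] by blast
  have "restrict_vars n F \<in> poly_space n d" for n
    unfolding poly_space_def
  proof (intro CollectI ballI)
    fix m assume "m \<in> keys (restrict_vars n F)"
    then have "keys m \<subseteq> {1..n}" "F m \<noteq> 0"
      by (simp_all only: in_keys_iff lookup_restrict_vars[OF assms] split: if_splits) simp_all
    then show "keys m \<subseteq> {1..n} \<and> mdeg m \<le> d" using d by blast
  qed
  then show ?thesis by (rule that)
qed

lemma truncate_restrict_vars:
  assumes "symmetric_function F"
  shows "truncate_vars n (restrict_vars (Suc n) F) = restrict_vars n F"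
  by (rule poly_mapping_eqI) (auto simp: lookup_truncate_vars lookup_restrict_vars[OF assms] subset_iff Ball_def)

lemma symmetric_function_eqI:
  assumes F: "symmetric_function F" and G: "symmetric_function G"
    and eq: "\<And>n. n0 \<le> n \<Longrightarrow> restrict_vars n F = restrict_vars n G"
  shows "F = G"
proof
  fix m
  show "F m = G m"
  proof (cases "keys m \<subseteq> {1..}")
    case True
    define n where "n = Max (insert n0 (keys m))"
    have n: "n0 \<le> n" "keys m \<subseteq> {1..n}" using True by (auto simp: n_def)
    have "lookup (restrict_vars n F) m = lookup (restrict_vars n G) m"
      using eq[OF n(1)] by simp
    then show ?thesis using n(2) by (simp add: lookup_restrict_vars[OF F] lookup_restrict_vars[OF G])
  next
    case False
    then have "F m = 0" "G m = 0"
      using symmetric_function_bounded[OF F] symmetric_function_bounded[OF G] by metis+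
    then show ?thesis by simp
  qed
qed

text \<open>The coefficient of a monomial is read off from any \<open>Q n\<close> for which \<open>n\<close> is at least \<open>n0\<close> and the
  indices of all variables in the monomial; stability makes the choice immaterial.\<close>

lemma symmetric_function_of_stable_family:
  assumes sp: "\<And>n. n0 \<le> n \<Longrightarrow> Q n \<in> poly_space n d"
    and sym: "\<And>n i. n0 \<le> n \<Longrightarrow> 1 \<le> i \<Longrightarrow> i < n \<Longrightarrow> permute_vars (s i) (Q n) = Q n"
    and stable: "\<And>n. n0 \<le> n \<Longrightarrow> truncate_vars n (Q (Suc n)) = Q n"
  obtains F where "symmetric_function F" "\<And>n. n0 \<le> n \<Longrightarrow> restrict_vars n F = Q n"
proof -
  define N where "N m = Max (insert n0 (keys m))" for m :: "nat \<Rightarrow>\<^sub>0 nat"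
  define F where "F m = lookup (Q (N m)) m" for m
  have step: "lookup (Q (n + k)) m = lookup (Q n) m"
    if "n0 \<le> n" "keys m \<subseteq> {1..n}" for n k m
  proof (induction k)
    case (Suc k)
    have "lookup (Q (n + k)) m = lookup (truncate_vars (n + k) (Q (Suc (n + k)))) m"
      using stable[of "n + k"] that by simp
    also have "\<dots> = lookup (Q (Suc (n + k))) m"
      using that by (auto simp: lookup_truncate_vars)
    finally show ?case using Suc by simp
  qed simp
  have F_eq: "F m = lookup (Q n) m" if n: "n0 \<le> n" "keys m \<subseteq> {1..n}" for n m
  proof -
    have "N m \<le> n" using n by (auto simp: N_def)
    moreover have "n0 \<le> N m" "keys m \<subseteq> {1..N m}"
      using n by (auto simp: N_def subset_iff)
    ultimately show ?thesis using step[of "N m" m "n - N m"] by (simp add: F_def)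
  qed
  have F_supp: "keys m \<subseteq> {1..N m} \<and> mdeg m \<le> d" if "F m \<noteq> 0" for m
  proof -
    have "Q (N m) \<in> poly_space (N m) d" by (rule sp) (simp add: N_def)
    moreover have "m \<in> keys (Q (N m))" using that by (simp add: F_def in_keys_iff)
    ultimately show ?thesis unfolding poly_space_def by blast
  qed
  have "F (Poly_Mapping.map_key w m) = F m" if w: "w \<in> S_inf" for w m
  proof (cases "keys m \<subseteq> {1..}")
    case True
    obtain k where k: "w permutes {1..k}" using w S_inf_iff by blast
    define n where "n = Max (insert n0 (insert k (keys m)))"
    have "x \<le> n" if "x \<in> insert n0 (insert k (keys m))" for x
      unfolding n_def using that by (intro Max_ge) auto
    then have n: "n0 \<le> n" "k \<le> n" "keys m \<subseteq> {1..n}" using True by auto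
    have wn: "w permutes {1..n}" using k n(2) by (intro permutes_subset[OF k]) auto
    have "inj w" using wn by (rule permutes_inj)
    then have "keys (Poly_Mapping.map_key w m) = w -` keys m"
      by (rule keys_map_key)
    then have kw: "keys (Poly_Mapping.map_key w m) \<subseteq> {1..n}"
      using n(3) permutes_in_image[OF wn] by blast
    have "lookup (Q n) (Poly_Mapping.map_key w m) = lookup (permute_vars w (Q n)) m"
      using permutes_bij[OF wn] by (simp add: lookup_permute_vars)
    also have "permute_vars w (Q n) = Q n"
      using sym[OF n(1)] wn by (rule permute_vars_symmetric)
    finally show ?thesis using F_eq[OF n(1) kw] F_eq[OF n(1,3)] by simp
  next
    case False
    then have "F m = 0" using F_supp[of m] by force
    moreover have "F (Poly_Mapping.map_key w m) = 0"
    proof (rule ccontr)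
      assume "F (Poly_Mapping.map_key w m) \<noteq> 0"
      then have sub: "keys (Poly_Mapping.map_key w m) \<subseteq> {1..}" using F_supp by force
      obtain k where k: "w permutes {1..k}" using w S_inf_iff by blast
      have "inj w" using k by (rule permutes_inj)
      then have "keys (Poly_Mapping.map_key w m) = w -` keys m"
        by (rule keys_map_key)
      moreover have "0 \<in> keys m"
      proof -
        obtain x where "x \<in> keys m" "x \<notin> {1..}" using False by blast
        then show ?thesis by (cases x) auto
      qed
      ultimately have "0 \<in> keys (Poly_Mapping.map_key w m)" using permutes_0[OF k] by simp
      then show False using sub by auto
    qed
    ultimately show ?thesis by simp
  qed
  moreover have "F m \<noteq> 0 \<longrightarrow> keys m \<subseteq> {1..}" for m using F_supp[of m] by force
  moreover have "\<forall>m. F m \<noteq> 0 \<longrightarrow> (\<Sum>i\<in>keys m. lookup m i) \<le> d"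
    using F_supp unfolding mdeg_def by blast
  ultimately have symF: "symmetric_function F" unfolding symmetric_function_def by blast
  have "restrict_vars n F = Q n" if n: "n0 \<le> n" for n
  proof (rule poly_mapping_eqI)
    fix m
    show "lookup (restrict_vars n F) m = lookup (Q n) m"
    proof (cases "keys m \<subseteq> {1..n}")
      case True
      then show ?thesis using F_eq[OF n True] by (simp add: lookup_restrict_vars[OF symF])
    next
      case False
      then have "m \<notin> keys (Q n)" using sp[OF n] unfolding poly_space_def by blast
      then show ?thesis using False by (simp add: lookup_restrict_vars[OF symF] in_keys_iff)
    qed
  qed
  with symF show ?thesis by (rule that)
qed

lemma symmetric_function_of_pi_w_rev:
  assumes "f \<in> poly_space n0 d"
  obtains F where "symmetric_function F" "\<And>n. n0 \<le> n \<Longrightarrow> restrict_vars n F = pi_perm (w_rev n) f"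
proof (rule symmetric_function_of_stable_family[of n0 "\<lambda>n. pi_perm (w_rev n) f" d])
  have f: "f \<in> poly_space n d" if "n0 \<le> n" for n using assms that by (rule poly_space_mono) simp
  show "pi_perm (w_rev n) f \<in> poly_space n d" if "n0 \<le> n" for n using f[OF that] by (rule pi_w_rev_space)
  show "truncate_vars n (pi_perm (w_rev (Suc n)) f) = pi_perm (w_rev n) f" if "n0 \<le> n" for n
    using f[OF that] by (rule pi_w_rev_stable)
  show "permute_vars (s i) (pi_perm (w_rev n) f) = pi_perm (w_rev n) f" if "1 \<le> i" "i < n" for n i
    using that by (rule pi_w_rev_symmetric)
qed (rule that)

section \<open>The symmetric function of a fixed-point-free involution\<close>

text \<open>If the last variable \<open>x\<^sub>k\<close> in \<open>f\<close> had an index \<open>k > n\<close>, then the symmetry under \<open>s\<^sub>k\<close> would produce an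
  occurrence of \<open>x\<^bsub>k+1\<^esub>\<close>.\<close>

lemma poly_space_if_symmetric_beyond:
  assumes "f \<in> poly_ring_P" and "\<And>i. n < i \<Longrightarrow> permute_vars (s i) f = f"
  obtains d where "f \<in> poly_space n d"
proof -
  define U where "U = (\<Union>m\<in>keys f. keys m)"
  have fin: "finite U" by (simp add: U_def)
  have "i \<le> n" if "i \<in> U" for i
  proof (rule ccontr)
    assume "\<not> i \<le> n"
    define k where "k = Max U"
    have "U \<noteq> {}" using that by auto
    then have "k \<in> U" unfolding k_def by (rule Max_in[OF fin])
    moreover have "i \<le> k" unfolding k_def using fin that by (rule Max_ge)
    ultimately have k: "k \<in> U" "i \<le> k" .
    then obtain m where m: "m \<in> keys f" "k \<in> keys m" by (auto simp: U_def)
    let ?m = "Poly_Mapping.map_key (s k) m"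
    have inv: "permute_vars (s k) f = f" using assms(2) k(2) \<open>\<not> i \<le> n\<close> by simp
    have "lookup f ?m = lookup (permute_vars (s k) f) m"
      by (simp add: lookup_permute_vars)
    then have "?m \<in> keys f" using m(1) inv by (simp add: in_keys_iff)
    moreover have "Suc k \<in> keys ?m" using m(2) by (simp add: in_keys_iff map_key.rep_eq)
    ultimately have "Suc k \<in> U" by (auto simp: U_def)
    then have "Suc k \<le> k" using fin by (simp add: k_def)
    then show False by simp
  qed
  then have "keys m \<subseteq> {1..n}" if "m \<in> keys f" for m
    using that assms(1) by (fastforce simp: U_def poly_ring_P_def)
  moreover have "mdeg m \<le> Max (mdeg ` keys f)" if "m \<in> keys f" for m
    using that by simp
  ultimately have "f \<in> poly_space n (Max (mdeg ` keys f))" by (simp add: poly_space_def)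
  then show ?thesis by (rule that)
qed

lemma one_fpf_involution: "one_fpf (one_fpf i) = i"
  by (auto simp: one_fpf_def elim: oddE evenE)

lemma I_fpf_properties:
  assumes "y \<in> I_fpf"
  shows "y (y i) = i" "1 \<le> i \<Longrightarrow> y i \<noteq> i" "1 \<le> i \<Longrightarrow> 1 \<le> y i" "\<exists>N. \<forall>i>N. y i = one_fpf i"
proof -
  obtain w where w: "w \<in> S_inf" "y = w \<circ> one_fpf \<circ> inv w" using assms by (auto simp: I_fpf_def)
  obtain n where n: "w permutes {1..n}" using w(1) S_inf_iff by blast
  have iw: "inv w (w i) = i" "w (inv w i) = i" for i
    using permutes_inverses[OF n] by simp_all
  have ne: "one_fpf i \<noteq> i \<and> 1 \<le> one_fpf i" if "1 \<le> i" for i using that by (auto simp: one_fpf_def elim: evenE)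
  have pos: "1 \<le> inv w i" "1 \<le> w i" if "1 \<le> i" for i
    using that permutes_pos[OF n] permutes_pos[OF permutes_inv[OF n]] by auto
  show "y (y i) = i" by (simp add: w(2) iw one_fpf_involution)
  show "y i \<noteq> i" if "1 \<le> i"
  proof
    assume "y i = i"
    then have "one_fpf (inv w i) = inv w i" using iw by (metis comp_apply w(2))
    then show False using ne[OF pos(1)[OF that]] by simp
  qed
  show "1 \<le> y i" if "1 \<le> i" unfolding w(2) o_apply using ne pos that by blast
  have "y i = one_fpf i" if "i > n + 1" for i
  proof -
    have "inv w i = i" using permutes_not_in[OF permutes_inv[OF n]] that by simp
    moreover have "one_fpf i \<ge> i - 1" by (auto simp: one_fpf_def)
    then have "n < one_fpf i" using that by arith
    then have "one_fpf i \<notin> {1..n}" by simp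
    then have "w (one_fpf i) = one_fpf i" by (rule permutes_not_in[OF n])
    ultimately show ?thesis by (simp add: w(2))
  qed
  then show "\<exists>N. \<forall>i>N. y i = one_fpf i" by blast
qed

text \<open>Without such an \<open>n\<close> the conditions that define \<open>P\<^sub>y\<close> would be void.\<close>

lemma D_Sp_bounded:
  assumes "y \<in> I_fpf"
  shows "\<exists>n. D_Sp y \<subseteq> {1..n} \<times> {1..}"
proof -
  obtain N where N: "\<And>i. i > N \<Longrightarrow> y i = one_fpf i" using I_fpf_properties(4)[OF assms] by blast
  have "D_Sp y \<subseteq> {1..N} \<times> {1..}"
  proof
    fix p assume "p \<in> D_Sp y"
    then obtain i j where p: "p = (i, y j)" and ij: "1 \<le> i" "i < j" "y i > y j" "i > y j"
      by (auto simp: D_Sp_def D_def)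
    have "j \<le> N"
    proof (rule ccontr)
      assume "\<not> j \<le> N"
      then have "y j = one_fpf j" using N by simp
      then have "y j \<ge> j - 1" by (auto simp: one_fpf_def)
      then show False using ij by simp
    qed
    moreover have "1 \<le> y j" using I_fpf_properties(3)[OF assms] ij by simp
    ultimately show "p \<in> {1..N} \<times> {1..}" using ij p by auto
  qed
  then show ?thesis ..
qed

text \<open>Suppose that \<open>i > n\<close> and that the divided difference of \<open>S\<^sub>y\<close> at \<open>i\<close> is nonzero. Then \<open>y\<close> has a descent at
  \<open>i\<close>, and the symplectic diagram contains \<open>(i, y(i+1))\<close> or \<open>(y(i+1), i)\<close>, depending on which of the
  two numbers is larger. Both cells lie below row \<open>n\<close>.\<close>

lemma Sp_Schubert_space:
  assumes S: "Sp_Schubert_family S" and y: "y \<in> I_fpf" and n: "D_Sp y \<subseteq> {1..n} \<times> {1..}"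
  obtains d where "S y \<in> poly_space n d"
proof (rule poly_space_if_symmetric_beyond)
  show "S y \<in> poly_ring_P" using S y by (simp add: Sp_Schubert_family_def)
  show "permute_vars (s i) (S y) = S y" if i: "n < i" for i
  proof -
    note inv = I_fpf_properties(1)[OF y] and fpf = I_fpf_properties(2)[OF y]
    have "y i < y (i + 1) \<or> y i = i + 1"
    proof (rule ccontr)
      assume c: "\<not> (y i < y (i + 1) \<or> y i = i + 1)"
      have ne: "y i \<noteq> y (i + 1)" by (metis inv add_eq_self_zero one_neq_zero)
      have desc: "y (i + 1) < y i" using c ne by simp
      have "y (i + 1) \<noteq> i" using c inv by metis
      moreover have "y (i + 1) \<noteq> i + 1" using fpf by simp
      ultimately consider "y (i + 1) < i" | "y (i + 1) > i + 1" by linarith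
      then show False
      proof cases
        case 1
        then have "(i, y (i + 1)) \<in> D_Sp y" using desc i by (auto simp: D_Sp_def D_def intro!: exI[of _ "i + 1"])
        then show False using n i by auto
      next
        case 2
        have "(y (i + 1), y (y i)) \<in> D y"
          unfolding D_def using 2 desc inv i by (auto intro!: exI[of _ "y i"])
        then have "(y (i + 1), y (y i)) \<in> D_Sp y" using 2 by (simp add: D_Sp_def inv)
        then show False using n i 2 by auto
      qed
    qed
    then have "divdiff i (S y) = 0" using S y i by (simp add: Sp_Schubert_family_def)
    then show ?thesis by (simp add: divdiff_eq_0_iff)
  qed
qed (rule that)

lemma P_invol_properties:
  assumes S: "Sp_Schubert_family S" and y: "y \<in> I_fpf"
  obtains n0 d where "S y \<in> poly_space n0 d" "symmetric_function (P_invol S y)"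
    "\<And>n. n0 \<le> n \<Longrightarrow> restrict_vars n (P_invol S y) = pi_perm (w_rev n) (S y)"
proof -
  define n0 where "n0 = (LEAST n. D_Sp y \<subseteq> {1..n} \<times> {1..})"
  have n0: "D_Sp y \<subseteq> {1..n0} \<times> {1..}" unfolding n0_def by (rule LeastI_ex[OF D_Sp_bounded[OF y]])
  have iff: "D_Sp y \<subseteq> {1..n} \<times> {1..} \<longleftrightarrow> n0 \<le> n" for n
  proof
    show "n0 \<le> n" if "D_Sp y \<subseteq> {1..n} \<times> {1..}" unfolding n0_def using that by (rule Least_le)
    show "D_Sp y \<subseteq> {1..n} \<times> {1..}" if "n0 \<le> n"
    proof -
      have "{1..n0} \<times> {1..} \<subseteq> {1..n} \<times> {1..}" using that by auto
      with n0 show ?thesis by (rule subset_trans)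
    qed
  qed
  obtain d where d: "S y \<in> poly_space n0 d" using Sp_Schubert_space[OF S y n0] by blast
  obtain F where F: "symmetric_function F" "\<And>n. n0 \<le> n \<Longrightarrow> restrict_vars n F = pi_perm (w_rev n) (S y)"
    using symmetric_function_of_pi_w_rev[OF d] by blast
  have "P_invol S y = F"
    unfolding P_invol_def iff
  proof (rule the_equality)
    show "symmetric_function F \<and> (\<forall>n. n0 \<le> n \<longrightarrow> restrict_vars n F = pi_perm (w_rev n) (S y))"
      using F by blast
    show "G = F" if G: "symmetric_function G \<and> (\<forall>n. n0 \<le> n \<longrightarrow> restrict_vars n G = pi_perm (w_rev n) (S y))" for G
    proof (rule symmetric_function_eqI)
      show "restrict_vars n G = restrict_vars n F" if "n0 \<le> n" for n using that G F by simp
    qed (use G F in blast)+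
  qed
  with F show ?thesis using that[OF d] by blast
qed

section \<open>Schur P-functions of strict partitions\<close>

definition parts :: "(nat \<Rightarrow> nat) \<Rightarrow> nat list"
  where "parts \<nu> = map \<nu> [1..<Suc (parts_length \<nu>)]"

definition staircase_poly :: "(nat \<Rightarrow> nat) \<Rightarrow> zpoly"
  where "staircase_poly \<nu> = (\<Prod>(i, j)\<in>diagram \<nu>. X i + X (i + j))"

lemma is_partition_antimono:
  assumes "is_partition \<nu>" "1 \<le> i" "i \<le> j"
  shows "\<nu> j \<le> \<nu> i"
  using assms(3)
proof (induction rule: dec_induct)
  case (step k)
  then have "\<nu> (k + 1) \<le> \<nu> k" using assms by (simp add: is_partition_def)
  with step show ?case by simp
qed simp

lemma partition_level_set:
  assumes "is_partition \<nu>" "1 \<le> c"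
  shows "{i. c \<le> \<nu> i} = {1..card {i. c \<le> \<nu> i}}"
proof -
  let ?A = "{i. c \<le> \<nu> i}"
  have 0: "\<nu> 0 = 0" using assms by (auto simp: is_partition_def weak_composition_def)
  have "finite {i. \<nu> i \<noteq> 0}" using assms by (auto simp: is_partition_def weak_composition_def)
  then have fin: "finite ?A" by (rule rev_finite_subset) (use assms(2) in auto)
  define l where "l = Max (insert 0 ?A)"
  have "?A = {1..l}"
  proof (intro equalityI subsetI)
    fix i assume i: "i \<in> ?A"
    then have "i \<noteq> 0" using 0 assms(2) by (metis mem_Collect_eq le_zero_eq not_one_le_zero)
    moreover have "i \<le> l" using i fin by (simp add: l_def)
    ultimately show "i \<in> {1..l}" by simp
  next
    fix i assume i: "i \<in> {1..l}"
    have "l \<in> insert 0 ?A" unfolding l_def using fin by (intro Max_in) auto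
    then have "c \<le> \<nu> l" using i by auto
    moreover have "\<nu> l \<le> \<nu> i" using is_partition_antimono[OF assms(1), of i l] i by simp
    ultimately show "i \<in> ?A" by simp
  qed
  then show ?thesis by simp
qed

lemma partition_support:
  assumes "is_partition \<nu>"
  shows "{i. \<nu> i \<noteq> 0} = {1..parts_length \<nu>}"
proof -
  have "{i. \<nu> i \<noteq> 0} = {i. 1 \<le> \<nu> i}" by auto
  then show ?thesis using partition_level_set[OF assms, of 1] by (simp add: parts_length_def)
qed

lemma strict_partition_less:
  assumes "strict_partition \<nu>" "1 \<le> i" "i < j" "\<nu> i \<noteq> 0"
  shows "\<nu> j < \<nu> i"
proof -
  have le: "\<nu> j \<le> \<nu> i" using assms by (auto simp: strict_partition_def intro: is_partition_antimono[of \<nu> i j])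
  show ?thesis
  proof (cases "\<nu> j = 0")
    case False
    have inj: "inj_on \<nu> {i. \<nu> i \<noteq> 0}" using assms(1) by (simp only: strict_partition_def)
    have "\<nu> j \<noteq> \<nu> i"
    proof
      assume "\<nu> j = \<nu> i"
      then have "j = i" using inj_onD[OF inj, of j i] assms(4) by simp
      then show False using assms(3) by simp
    qed
    with le show ?thesis by simp
  next
    case True
    then show ?thesis using assms(4) by simp
  qed
qed

lemma length_parts: "length (parts \<nu>) = parts_length \<nu>"
  by (simp add: parts_def)

lemma parts_nth: "k < parts_length \<nu> \<Longrightarrow> parts \<nu> ! k = \<nu> (Suc k)"
  by (simp add: parts_def del: upt_Suc)

lemma strict_parts_parts:
  assumes "strict_partition \<nu>"
  shows "strict_parts (parts \<nu>)"
proof -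
  have supp: "{i. \<nu> i \<noteq> 0} = {1..parts_length \<nu>}"
    using assms by (intro partition_support) (simp add: strict_partition_def)
  have nz: "\<nu> i \<noteq> 0" if "1 \<le> i" "i \<le> parts_length \<nu>" for i using that supp by auto
  have "sorted_wrt (>) (parts \<nu>)"
    unfolding sorted_wrt_iff_nth_less length_parts
    using strict_partition_less[OF assms] nz by (auto simp: parts_nth)
  moreover have "0 \<notin> set (parts \<nu>)"
  proof
    assume "0 \<in> set (parts \<nu>)"
    then obtain i where "1 \<le> i" "i \<le> parts_length \<nu>" "\<nu> i = 0" by (auto simp: parts_def simp del: upt_Suc)
    then show False using nz by blast
  qed
  ultimately show ?thesis by (simp add: strict_parts_def)
qed

lemma largest_part_parts:
  assumes "strict_partition \<nu>"
  shows "largest_part (parts \<nu>) = \<nu> 1"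
proof (cases "parts_length \<nu>")
  case 0
  then have "{i. \<nu> i \<noteq> 0} = {}" using partition_support[of \<nu>] assms by (simp add: strict_partition_def)
  then show ?thesis using 0 by (auto simp: parts_def)
next
  case (Suc k)
  then have "parts \<nu> \<noteq> []" using length_parts[of \<nu>] by auto
  then have "largest_part (parts \<nu>) = parts \<nu> ! 0" by (cases "parts \<nu>") auto
  then show ?thesis using Suc by (simp add: parts_nth)
qed

lemma diagram_strict_partition:
  assumes "strict_partition \<nu>"
  shows "diagram \<nu> = Sigma {1..parts_length \<nu>} (\<lambda>i. {1..\<nu> i})"
proof -
  have supp: "{i. \<nu> i \<noteq> 0} = {1..parts_length \<nu>}"
    using assms by (intro partition_support) (simp add: strict_partition_def)
  then have "i \<le> parts_length \<nu>" if "1 \<le> j" "j \<le> \<nu> i" for i j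
    using that by (metis atLeastAtMost_iff mem_Collect_eq le_zero_eq not_one_le_zero)
  then show ?thesis by (auto simp: diagram_def)
qed

text \<open>The variable of largest index in the staircase product has index at most \<open>\<nu>\<^sub>1 + 1\<close>.\<close>

lemma diagram_bound:
  assumes "strict_partition \<nu>" "(i, j) \<in> diagram \<nu>"
  shows "i + j \<le> Suc (\<nu> 1)"
proof -
  have ij: "1 \<le> i" "i \<le> parts_length \<nu>" "j \<le> \<nu> i"
    using assms by (auto simp: diagram_strict_partition)
  have "parts \<nu> ! (i - 1) + (i - 1) \<le> largest_part (parts \<nu>)"
    using ij by (intro strict_parts_nth_le strict_parts_parts assms) (simp add: length_parts)
  then show ?thesis using ij by (simp add: parts_nth largest_part_parts[OF assms(1)])
qed

lemma staircase_poly_space: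
  assumes "strict_partition \<nu>" "\<nu> 1 < n"
  shows "staircase_poly \<nu> \<in> poly_space n (card (diagram \<nu>))"
  unfolding staircase_poly_def
proof (rule poly_space_prod)
  show "finite (diagram \<nu>)" by (simp add: diagram_strict_partition[OF assms(1)])
  fix p assume "p \<in> diagram \<nu>"
  then obtain i j where p: "p = (i, j)" "(i, j) \<in> diagram \<nu>" by (cases p) auto
  then have "1 \<le> i" "i + j \<le> n" using diagram_bound[OF assms(1)] assms(2) by (fastforce simp: diagram_def)+
  then have "X i + X (i + j) \<in> poly_space n 1" by (intro poly_space_add poly_space_X) auto
  then show "(case p of (i, j) \<Rightarrow> X i + X (i + j)) \<in> poly_space n 1" by (simp add: p(1))
qed

lemma eval_staircase_poly:
  assumes "strict_partition \<nu>" "\<nu> 1 < length xs"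
  shows "eval_poly (point xs) (staircase_poly \<nu>) = staircase_product (parts \<nu>) xs"
proof -
  have pt: "point xs i + point xs (i + j) = xs ! (i - 1) + xs ! (i - 1 + j)" if "(i, j) \<in> diagram \<nu>" for i j
    using diagram_bound[OF assms(1) that] that assms(2) by (auto simp: point_def diagram_def)
  have "eval_poly (point xs) (staircase_poly \<nu>) = (\<Prod>(i, j)\<in>diagram \<nu>. xs ! (i - 1) + xs ! (i - 1 + j))"
    unfolding staircase_poly_def eval_poly_prod by (intro prod.cong refl) (auto simp: pt)
  also have "\<dots> = (\<Prod>i\<in>{1..parts_length \<nu>}. \<Prod>j\<in>{1..\<nu> i}. xs ! (i - 1) + xs ! (i - 1 + j))"
    unfolding diagram_strict_partition[OF assms(1)] by (subst prod.Sigma) auto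
  also have "\<dots> = (\<Prod>i<parts_length \<nu>. \<Prod>j\<in>{1..\<nu> (Suc i)}. xs ! i + xs ! (i + j))"
    by (rule prod.reindex_bij_witness[where i = Suc and j = "\<lambda>i. i - 1"]) auto
  also have "\<dots> = (\<Prod>i<parts_length \<nu>. \<Prod>j<\<nu> (Suc i). xs ! i + xs ! (i + 1 + j))"
    by (rule prod.cong[OF refl], rule prod.reindex_bij_witness[where i = Suc and j = "\<lambda>i. i - 1"]) auto
  also have "\<dots> = staircase_product (parts \<nu>) xs"
    unfolding staircase_product_def length_parts by (intro prod.cong refl) (simp_all add: parts_nth)
  finally show ?thesis .
qed

lemma eval_pi_w_rev_staircase:
  fixes a :: "nat \<Rightarrow> 'a::field"
  assumes "strict_partition \<nu>" "\<nu> 1 < n" and a: "inj_on a {1..n}" "antipode_free (a ` {1..n})"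
  shows "eval_poly a (pi_perm (w_rev n) (staircase_poly \<nu>)) = schur_P_at (parts \<nu>) (a ` {1..n})"
proof -
  let ?A = "a ` {1..n}"
  have card: "card ?A = n" using card_image[OF a(1)] by simp
  have "eval_poly a (pi_perm (w_rev n) (staircase_poly \<nu>)) = symmetrize (staircase_poly \<nu>) ?A"
    using staircase_poly_space[OF assms(1,2)] a(1) by (rule eval_pi_w_rev)
  also have "\<dots> = (\<Sum>xs\<in>orderings ?A. staircase_product (parts \<nu>) xs * sym_weight xs)"
    unfolding symmetrize_def
  proof (rule sum.cong[OF refl])
    fix xs assume "xs \<in> orderings ?A"
    then have "length xs = n" using card permutations_of_setD distinct_card by metis
    then show "eval_poly (point xs) (staircase_poly \<nu>) * sym_weight xs = staircase_product (parts \<nu>) xs * sym_weight xs"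
      using eval_staircase_poly[OF assms(1), of xs] assms(2) by simp
  qed
  also have "\<dots> = schur_P_at (parts \<nu>) ?A"
    using assms card by (intro sum_staircase_product strict_parts_parts) (auto simp: largest_part_parts)
  finally show ?thesis .
qed

lemma schur_P_term_eq_prod:
  assumes "length \<mu> \<le> length xs" "distinct xs"
  shows "schur_P_term \<mu> xs =
    (\<Prod>i<length \<mu>. xs ! i ^ \<mu> ! i * (\<Prod>j\<in>{i + 1..<length xs}. (xs ! i + xs ! j) / (xs ! i - xs ! j)))"
  using assms
proof (induction \<mu> arbitrary: xs)
  case (Cons m \<mu>)
  then obtain b ys where xs: "xs = b # ys" by (cases xs) auto
  have ys: "length \<mu> \<le> length ys" "distinct ys" using Cons.prems by (auto simp: xs)
  have shift: "(\<Prod>j\<in>{Suc k..<Suc (length ys)}. g ((b # ys) ! j)) = (\<Prod>j\<in>{k..<length ys}. g (ys ! j))"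
    for g :: "'a \<Rightarrow> 'a" and k
    unfolding prod.shift_bounds_Suc_ivl by simp
  have "hl_factor b (set ys) = (\<Prod>j<length ys. (b + ys ! j) / (b - ys ! j))"
    using prod_nth_distinct[OF ys(2), of "\<lambda>j. (b + j) / (b - j)"] by simp
  moreover have "(\<Prod>j\<in>{0 + 1..<length xs}. (xs ! 0 + xs ! j) / (xs ! 0 - xs ! j)) = (\<Prod>j<length ys. (b + ys ! j) / (b - ys ! j))"
    using shift[of "\<lambda>x. (b + x) / (b - x)" 0] by (simp add: xs lessThan_atLeast0 del: prod.op_ivl_Suc)
  moreover have "(\<Prod>j\<in>{Suc i + 1..<length xs}. (xs ! Suc i + xs ! j) / (xs ! Suc i - xs ! j)) =
     (\<Prod>j\<in>{i + 1..<length ys}. (ys ! i + ys ! j) / (ys ! i - ys ! j))" for i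
    using shift[of "\<lambda>x. (ys ! i + x) / (ys ! i - x)" "i + 1"] by (simp add: xs del: prod.op_ivl_Suc)
  ultimately show ?case
    unfolding list.size(4) add_Suc_right add_0_right prod.lessThan_Suc_shift o_def
    using Cons.IH[OF ys] by (simp add: xs)
qed simp

lemma schur_P_summand_eq:
  assumes \<nu>: "strict_partition \<nu>" "parts_length \<nu> \<le> n" and w: "w permutes {1..n}"
  shows "schur_P_summand \<nu> n w = schur_P_term (parts \<nu>) (map (generic \<circ> w) [1..<Suc n])"
proof -
  define xs where "xs = map (generic \<circ> w) [1..<Suc n]"
  define g where "g i = generic (w i)" for i
  let ?l = "parts_length \<nu>"
  have len: "length xs = n" by (simp add: xs_def)
  have nth: "xs ! i = g (Suc i)" if "i < n" for i using that by (simp add: xs_def g_def del: upt_Suc)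
  have inj: "inj_on generic {1..n}" by (auto simp: inj_on_def generic_inj)
  have "xs \<in> orderings (generic ` {1..n})"
    unfolding xs_def using bij_betw_apply[OF permutation_lists_bij[OF inj], of w] w by simp
  then have dist: "distinct xs" by (rule permutations_of_setD)
  have "schur_P_term (parts \<nu>) xs = (\<Prod>i<?l. xs ! i ^ parts \<nu> ! i * (\<Prod>j\<in>{i + 1..<n}. (xs ! i + xs ! j) / (xs ! i - xs ! j)))"
    using \<nu>(2) dist len by (subst schur_P_term_eq_prod) (simp_all add: length_parts)
  also have "\<dots> = (\<Prod>i<?l. g (Suc i) ^ \<nu> (Suc i) * (\<Prod>j\<in>{i + 1..<n}. (g (Suc i) + g (Suc j)) / (g (Suc i) - g (Suc j))))"
    using \<nu>(2) by (intro prod.cong refl arg_cong2[where f = "(*)"]) (simp_all add: nth parts_nth)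
  also have "\<dots> = (\<Prod>i<?l. g (Suc i) ^ \<nu> (Suc i) * (\<Prod>j = Suc i + 1..n. (g (Suc i) + g j) / (g (Suc i) - g j)))"
  proof (rule prod.cong[OF refl])
    fix i
    have "(\<Prod>j\<in>{i + 1..<n}. (g (Suc i) + g (Suc j)) / (g (Suc i) - g (Suc j))) = (\<Prod>j = Suc i + 1..n. (g (Suc i) + g j) / (g (Suc i) - g j))"
      by (rule prod.reindex_bij_witness[where i = "\<lambda>j. j - 1" and j = Suc]) auto
    then show "g (Suc i) ^ \<nu> (Suc i) * (\<Prod>j\<in>{i + 1..<n}. (g (Suc i) + g (Suc j)) / (g (Suc i) - g (Suc j))) =
      g (Suc i) ^ \<nu> (Suc i) * (\<Prod>j = Suc i + 1..n. (g (Suc i) + g j) / (g (Suc i) - g j))" by simp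
  qed
  also have "\<dots> = (\<Prod>i = 1..?l. g i ^ \<nu> i * (\<Prod>j = i + 1..n. (g i + g j) / (g i - g j)))"
    by (rule prod.reindex_bij_witness[where i = "\<lambda>j. j - 1" and j = Suc]) auto
  finally have 1: "schur_P_term (parts \<nu>) xs = (\<Prod>i = 1..?l. g i ^ \<nu> i * (\<Prod>j = i + 1..n. (g i + g j) / (g i - g j)))" .
  have fr: "Fraction_Field.Fract p q = eval_poly generic p / eval_poly generic q" for p q
    by (simp add: eval_poly_generic)
  have "schur_P_summand \<nu> n w = (\<Prod>i = 1..?l. g i ^ \<nu> i) * (\<Prod>i = 1..?l. \<Prod>j = i + 1..n. g i + g j) /
     (\<Prod>i = 1..?l. \<Prod>j = i + 1..n. g i - g j)"
    unfolding schur_P_summand_def fr by (simp add: eval_poly_prod g_def)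
  also have "\<dots> = schur_P_term (parts \<nu>) xs"
    unfolding 1 by (simp add: prod.distrib prod_dividef)
  finally show ?thesis by (simp add: xs_def)
qed

lemma poly_eval_poly: "poly (eval_poly b f) z = eval_poly (\<lambda>i. poly (b i) z) f"
proof -
  have "poly (of_int c) z = of_int c" for c
    by (cases c rule: int_diff_cases) simp
  then show ?thesis by (simp add: eval_poly_def monomial_at_def poly_sum poly_prod)
qed

text \<open>The hypothesis does not apply to a point with last coordinate 0. But both sides are polynomials in
  the last coordinate that agree at infinitely many values, hence also at 0.\<close>

lemma schur_P_at_set_last_0:
  fixes a :: "nat \<Rightarrow> zpoly fract"
  assumes R: "R \<in> poly_space (Suc n) d" and \<mu>: "strict_parts \<mu>"
    and ev: "\<And>a :: nat \<Rightarrow> zpoly fract. inj_on a {1..Suc n} \<Longrightarrow> antipode_free (a ` {1..Suc n}) \<Longrightarrow>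
      eval_poly a R = schur_P_at \<mu> (a ` {1..Suc n})"
    and a: "inj_on a {1..n}" "antipode_free (a ` {1..n})"
  shows "eval_poly a (truncate_vars n R) = schur_P_at \<mu> (a ` {1..n})"
proof -
  let ?A = "a ` {1..n}"
  have fin: "finite ?A" by simp
  obtain p where p: "\<And>z. z \<notin> ?A \<Longrightarrow> poly p z = schur_P_at \<mu> (insert z ?A)"
    using schur_P_at_polynomial[OF fin \<mu>] by blast
  define q where "q = eval_poly (\<lambda>i. if i = Suc n then [:0, 1:] else [:a i:]) R"
  have q: "poly q z = eval_poly (a(Suc n := z)) R" for z
    unfolding q_def poly_eval_poly by (rule arg_cong[where f = "\<lambda>a. eval_poly a R"]) auto
  have pq: "poly p z = poly q z" if z: "z \<notin> ?A \<union> uminus ` ?A \<union> {0}" for z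
  proof -
    have ins: "{1..Suc n} = insert (Suc n) {1..n}" by (rule atLeastAtMostSuc_conv) simp
    have same: "(a(Suc n := z)) i = a i" if "i \<in> {1..n}" for i using that by simp
    have im: "(a(Suc n := z)) ` {1..n} = ?A" by (rule image_cong[OF refl same])
    have eq: "(a(Suc n := z)) ` {1..Suc n} = insert z ?A"
      unfolding ins image_insert im by simp
    have "inj_on (a(Suc n := z)) {1..n}" using a(1) same by (simp only: inj_on_cong[of "{1..n}" "a(Suc n := z)" a])
    moreover have "(a(Suc n := z)) (Suc n) \<notin> (a(Suc n := z)) ` ({1..n} - {Suc n})"
      using z im by auto
    ultimately have inj: "inj_on (a(Suc n := z)) {1..Suc n}" unfolding ins inj_on_insert by blast
    moreover have "z + z \<noteq> 0"
    proof -
      have "2 * generic 0 \<noteq> 0" using generic_add_nonzero[of 0 0] by (simp only: mult_2 not_False_eq_True)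
      then have "(2 :: zpoly fract) \<noteq> 0" by (metis mult_zero_left)
      moreover have "z \<noteq> 0" using z by simp
      ultimately have "2 * z \<noteq> 0" by (simp only: mult_eq_0_iff de_Morgan_disj not_False_eq_True)
      then show ?thesis by (simp only: mult_2 not_False_eq_True)
    qed
    moreover have "z + x \<noteq> 0 \<and> x + z \<noteq> 0" if x: "x \<in> ?A" for x
    proof (rule ccontr)
      assume "\<not> (z + x \<noteq> 0 \<and> x + z \<noteq> 0)"
      then have "z + x = 0" by (auto simp: add.commute)
      then have "z = - x" by (rule eq_neg_iff_add_eq_0[THEN iffD2])
      then show False using z x by blast
    qed
    ultimately have "antipode_free (insert z ?A)"
      using a(2) unfolding antipode_free_def by blast
    with inj have "poly q z = schur_P_at \<mu> (insert z ?A)" unfolding q using ev[of "a(Suc n := z)"] eq by simp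
    then show ?thesis using p z by simp
  qed
  have "infinite (- (?A \<union> uminus ` ?A \<union> {0}))"
  proof -
    have "infinite (UNIV :: zpoly fract set)"
    proof
      assume "finite (UNIV :: zpoly fract set)"
      then have "finite (range generic)" by (rule rev_finite_subset) simp
      moreover have "inj generic" by (rule injI) (simp only: generic_inj)
      ultimately show False using finite_imageD infinite_UNIV_nat by blast
    qed
    then show ?thesis unfolding Compl_eq_Diff_UNIV by (rule Diff_infinite_finite[rotated]) simp
  qed
  moreover have "- (?A \<union> uminus ` ?A \<union> {0}) \<subseteq> {z. poly (p - q) z = 0}" using pq by auto
  ultimately have "p - q = 0" using poly_roots_finite finite_subset by blast
  then have "p = q" by simp
  have 0: "0 \<notin> ?A"   proof
    assume "0 \<in> ?A"
    then have "0 + 0 \<noteq> (0 :: zpoly fract)" using a(2) unfolding antipode_free_def by blast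
    then show False by simp
  qed
  have "eval_poly a (truncate_vars n R) = eval_poly (a(Suc n := 0)) R"
    unfolding eval_truncate_vars using R by (rule eval_poly_cong) auto
  also have "\<dots> = poly p 0" by (simp add: \<open>p = q\<close> q)
  also have "\<dots> = schur_P_at \<mu> (insert 0 ?A)" by (rule p[OF 0])
  also have "\<dots> = schur_P_at \<mu> ?A" using fin 0 \<mu> by (rule schur_P_at_insert_0)
  finally show ?thesis .
qed

text \<open>For \<open>n > \<nu>\<^sub>1\<close> the symmetrized staircase products form a stable family. Its limit satisfies the
  defining formula for these \<open>n\<close>, and for smaller \<open>n\<close> by setting one variable after the other to 0.\<close>

lemma schur_P_properties:
  assumes \<nu>: "strict_partition \<nu>"
  shows "symmetric_function (schur_P \<nu>)"
    and "\<And>n. \<nu> 1 < n \<Longrightarrow> restrict_vars n (schur_P \<nu>) = pi_perm (w_rev n) (staircase_poly \<nu>)"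
proof -
  have sp: "staircase_poly \<nu> \<in> poly_space (Suc (\<nu> 1)) (card (diagram \<nu>))"
    using \<nu> by (rule staircase_poly_space) simp
  obtain F where F: "symmetric_function F"
    "\<And>n. Suc (\<nu> 1) \<le> n \<Longrightarrow> restrict_vars n F = pi_perm (w_rev n) (staircase_poly \<nu>)"
    using symmetric_function_of_pi_w_rev[OF sp] by blast
  obtain d where d: "\<And>n. restrict_vars n F \<in> poly_space n d" using restrict_vars_space[OF F(1)] by blast
  have large: "eval_poly a (restrict_vars n F) = schur_P_at (parts \<nu>) (a ` {1..n})"
    if "\<nu> 1 < n" "inj_on a {1..n}" "antipode_free (a ` {1..n})" for n and a :: "nat \<Rightarrow> zpoly fract"
    using eval_pi_w_rev_staircase[OF \<nu> that] F(2)[of n] that(1) by simp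
  have all: "eval_poly a (restrict_vars n F) = schur_P_at (parts \<nu>) (a ` {1..n})"
    if "inj_on a {1..n}" "antipode_free (a ` {1..n})" for n and a :: "nat \<Rightarrow> zpoly fract"
    using that
  proof (induction "Suc (\<nu> 1) - n" arbitrary: n a)
    case 0
    then show ?case by (intro large) auto
  next
    case (Suc k)
    have "eval_poly a (truncate_vars n (restrict_vars (Suc n) F)) = schur_P_at (parts \<nu>) (a ` {1..n})"
    proof (rule schur_P_at_set_last_0[OF d strict_parts_parts[OF \<nu>]])
      fix b :: "nat \<Rightarrow> zpoly fract"
      assume "inj_on b {1..Suc n}" "antipode_free (b ` {1..Suc n})"
      then show "eval_poly b (restrict_vars (Suc n) F) = schur_P_at (parts \<nu>) (b ` {1..Suc n})"
        using Suc.hyps by (intro Suc.hyps(1)) auto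
    qed (use Suc.prems in auto)
    then show ?case by (simp only: truncate_restrict_vars[OF F(1)])
  qed
  let ?l = "parts_length \<nu>"
  have inj: "inj_on generic {1..n}" for n by (auto simp: inj_on_def generic_inj)
  have af: "antipode_free (generic ` {1..n})" for n
    unfolding antipode_free_def using generic_add_nonzero by auto
  have sum: "(\<Sum>w | w permutes {1..n}. schur_P_summand \<nu> n w) = of_nat (fact (n - ?l)) * Fraction_Field.Fract (restrict_vars n F) 1"
    if n: "?l \<le> n" for n
  proof -
    have "(\<Sum>w | w permutes {1..n}. schur_P_summand \<nu> n w) =
      (\<Sum>w | w permutes {1..n}. schur_P_term (parts \<nu>) (map (generic \<circ> w) [1..<Suc n]))"
      using schur_P_summand_eq[OF \<nu> n] by (intro sum.cong) auto
    also have "\<dots> = sum (schur_P_term (parts \<nu>)) (orderings (generic ` {1..n}))"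
      by (rule sum.reindex_bij_betw[OF permutation_lists_bij[OF inj]])
    also have "\<dots> = of_nat (fact (n - ?l)) * schur_P_at (parts \<nu>) (generic ` {1..n})"
      using n card_image[OF inj[of n]] by (subst sum_schur_P_term) (simp_all add: length_parts)
    also have "schur_P_at (parts \<nu>) (generic ` {1..n}) = Fraction_Field.Fract (restrict_vars n F) 1"
      unfolding eval_poly_generic[symmetric] by (rule all[OF inj af, symmetric])
    finally show ?thesis .
  qed
  have nz: "(of_nat (fact k) :: zpoly fract) \<noteq> 0" for k
    by (simp add: of_nat_fract Zero_fract_def eq_fract)
  have "schur_P \<nu> = F"
    unfolding schur_P_def
  proof (rule the_equality)
    show "symmetric_function F \<and> (\<forall>n \<ge> ?l. of_nat (fact (n - ?l)) * Fraction_Field.Fract (restrict_vars n F) 1 =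
       (\<Sum>w | w permutes {1..n}. schur_P_summand \<nu> n w))"
      using F(1) sum[symmetric] by blast
    show "G = F" if G: "symmetric_function G \<and> (\<forall>n \<ge> ?l. of_nat (fact (n - ?l)) * Fraction_Field.Fract (restrict_vars n G) 1 =
       (\<Sum>w | w permutes {1..n}. schur_P_summand \<nu> n w))" for G
    proof (rule symmetric_function_eqI)
      fix n assume n: "?l \<le> n"
      have "of_nat (fact (n - ?l)) * Fraction_Field.Fract (restrict_vars n G) 1 = of_nat (fact (n - ?l)) * Fraction_Field.Fract (restrict_vars n F) 1"
        using G n unfolding sum[OF n, symmetric] by blast
      then have "Fraction_Field.Fract (restrict_vars n G) 1 = Fraction_Field.Fract (restrict_vars n F) 1"
        by (rule mult_left_cancel[OF nz, THEN iffD1])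
      then show "restrict_vars n G = restrict_vars n F" by (simp add: eq_fract)
    qed (use G F in blast)+
  qed
  then show "symmetric_function (schur_P \<nu>)" using F(1) by (simp only:)
  show "restrict_vars n (schur_P \<nu>) = pi_perm (w_rev n) (staircase_poly \<nu>)" if "\<nu> 1 < n" for n
    unfolding \<open>schur_P \<nu> = F\<close> using that by (intro F(2)) simp
qed

section \<open>Sorting weak compositions\<close>

text \<open>A partition is determined by the numbers of its entries that are at least \<open>c\<close>, for \<open>c \<ge> 1\<close>, and these
  numbers are invariant under permutations.\<close>

lemma partition_unique:
  assumes \<mu>: "is_partition \<mu>" and \<mu>': "is_partition \<mu>'" and w: "w \<in> S_inf" "w' \<in> S_inf"
    and eq: "perm_act w \<mu> = perm_act w' \<mu>'"
  shows "\<mu> = \<mu>'"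
proof
  fix i
  have card: "card {i. c \<le> perm_act w \<mu> i} = card {i. c \<le> \<mu> i}" if "w \<in> S_inf" for c w \<mu>
  proof -
    have b: "bij w" using that by (rule S_inf_bij)
    have "{i. c \<le> perm_act w \<mu> i} = w ` {i. c \<le> \<mu> i}"
    proof (intro equalityI subsetI)
      fix i assume "i \<in> {i. c \<le> perm_act w \<mu> i}"
      then have "inv w i \<in> {i. c \<le> \<mu> i}" by (simp add: perm_act_def)
      moreover have "i = w (inv w i)" using b by (simp add: bij_is_surj surj_f_inv_f)
      ultimately show "i \<in> w ` {i. c \<le> \<mu> i}" by (rule rev_image_eqI)
    next
      fix i assume "i \<in> w ` {i. c \<le> \<mu> i}"
      then show "i \<in> {i. c \<le> perm_act w \<mu> i}" using b by (auto simp: perm_act_def bij_is_inj)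
    qed
    moreover have "inj_on w {i. c \<le> \<mu> i}" using bij_is_inj[OF b] by (rule inj_on_subset) simp
    ultimately show ?thesis by (simp only: card_image)
  qed
  have lev: "c \<le> \<mu> i \<longleftrightarrow> c \<le> \<mu>' i" if "1 \<le> c" for c
  proof -
    have "{i. c \<le> \<mu> i} = {i. c \<le> \<mu>' i}"
    proof -
      have "card {i. c \<le> \<mu> i} = card {i. c \<le> \<mu>' i}"
        using card[OF w(1), of c \<mu>] card[OF w(2), of c \<mu>'] unfolding eq by (rule trans[OF sym])
      then show ?thesis
        using partition_level_set[OF \<mu> that] partition_level_set[OF \<mu>' that] by (metis (no_types))
    qed
    then show ?thesis by auto
  qed
  show "\<mu> i = \<mu>' i"
  proof (rule antisym)
    show "\<mu> i \<le> \<mu>' i" using lev[of "\<mu> i"] by (cases "\<mu> i") auto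
    show "\<mu>' i \<le> \<mu> i" using lev[of "\<mu>' i"] by (cases "\<mu>' i") auto
  qed
qed

text \<open>A rearrangement that minimizes \<open>\<Sum> i \<alpha>\<^sub>i\<close> is weakly decreasing, since exchanging the two entries of an
  ascent would lower the sum.\<close>

lemma sorting_exists:
  assumes "weak_composition \<alpha>"
  shows "\<exists>\<mu>. is_partition \<mu> \<and> (\<exists>w\<in>S_inf. \<alpha> = perm_act w \<mu>)"
proof -
  define N where "N = Max (insert 0 {i. \<alpha> i \<noteq> 0})"
  have fin: "finite {i. \<alpha> i \<noteq> 0}" and \<alpha>0: "\<alpha> 0 = 0" using assms by (auto simp: weak_composition_def)
  have N: "\<alpha> i = 0" if "N < i" for i
  proof (rule ccontr)
    assume "\<alpha> i \<noteq> 0"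
    then have "i \<le> N" using fin by (simp add: N_def)
    with that show False by simp
  qed
  define \<Phi> where "\<Phi> p = (\<Sum>i\<in>{1..N}. i * \<alpha> (p i))" for p
  have "\<exists>p. p permutes {1..N} \<and> (\<forall>q. q permutes {1..N} \<longrightarrow> \<Phi> p \<le> \<Phi> q)"
    by (rule ex_has_least_nat[where k = id]) (rule permutes_id)
  then obtain p where p: "p permutes {1..N}" and least: "\<And>q. q permutes {1..N} \<Longrightarrow> \<Phi> p \<le> \<Phi> q"
    by blast
  define \<mu> where "\<mu> = \<alpha> \<circ> p"
  have out: "\<mu> i = 0" if "i \<notin> {1..N}" for i
    using permutes_not_in[OF p that] that N[of i] \<alpha>0 by (cases i) (auto simp: \<mu>_def)
  have desc: "\<mu> (i + 1) \<le> \<mu> i" if i: "1 \<le> i" for i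
  proof (rule ccontr)
    assume asc: "\<not> \<mu> (i + 1) \<le> \<mu> i"
    then have iN: "i + 1 \<le> N" using out[of "i + 1"] by (cases "i + 1 \<le> N") auto
    have q: "p \<circ> s i permutes {1..N}" using i iN by (intro permutes_compose p s_permutes) auto
    let ?B = "{1..N} - {i, i + 1}"
    have split: "sum g {1..N} = g i + g (i + 1) + sum g ?B" for g :: "nat \<Rightarrow> nat"
    proof -
      have "sum g {1..N} = sum g ?B + sum g {i, i + 1}"
        using i iN by (intro sum.subset_diff) auto
      then show ?thesis by simp
    qed
    have "(\<Sum>k\<in>?B. k * \<alpha> ((p \<circ> s i) k)) = (\<Sum>k\<in>?B. k * \<alpha> (p k))"
      by (intro sum.cong refl) (auto simp: transpose_if)
    then have "\<Phi> (p \<circ> s i) = i * \<mu> (i + 1) + (i + 1) * \<mu> i + (\<Sum>k\<in>?B. k * \<alpha> (p k))"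
      unfolding \<Phi>_def split[of "\<lambda>k. k * \<alpha> ((p \<circ> s i) k)"]
      by (simp only: \<mu>_def o_apply transpose_apply_first transpose_apply_second)
    moreover have "\<Phi> p = i * \<mu> i + (i + 1) * \<mu> (i + 1) + (\<Sum>k\<in>?B. k * \<alpha> (p k))"
      unfolding \<Phi>_def split[of "\<lambda>k. k * \<alpha> (p k)"] by (simp only: \<mu>_def o_apply)
    moreover have "i * \<mu> (i + 1) + (i + 1) * \<mu> i < i * \<mu> i + (i + 1) * \<mu> (i + 1)"
      using asc unfolding add_mult_distrib mult_1 by linarith
    ultimately have "\<Phi> (p \<circ> s i) < \<Phi> p" by linarith
    then show False using least[OF q] by linarith
  qed
  have "weak_composition \<mu>"
    unfolding weak_composition_def
  proof
    show "\<mu> 0 = 0" by (rule out) simp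
    have "{i. \<mu> i \<noteq> 0} \<subseteq> {1..N}"
    proof
      fix i assume "i \<in> {i. \<mu> i \<noteq> 0}"
      then show "i \<in> {1..N}" using out[of i] by (cases "i \<in> {1..N}") simp_all
    qed
    then show "finite {i. \<mu> i \<noteq> 0}" by (rule finite_subset) simp
  qed
  then have "is_partition \<mu>" using desc by (simp add: is_partition_def)
  moreover have "p \<in> S_inf" using p S_inf_iff by blast
  moreover have "\<alpha> = perm_act p \<mu>"
    using permutes_inverses[OF p] by (auto simp: perm_act_def \<mu>_def fun_eq_iff)
  ultimately show ?thesis by blast
qed

lemma sort_comp_properties:
  assumes "weak_composition \<alpha>"
  shows "is_partition (sort_comp \<alpha>) \<and> (\<exists>w\<in>S_inf. \<alpha> = perm_act w (sort_comp \<alpha>))"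
proof -
  have "\<exists>!\<mu>. is_partition \<mu> \<and> (\<exists>w\<in>S_inf. \<alpha> = perm_act w \<mu>)"
  proof (rule ex_ex1I[OF sorting_exists[OF assms]])
    fix \<mu> \<mu>' assume "is_partition \<mu> \<and> (\<exists>w\<in>S_inf. \<alpha> = perm_act w \<mu>)"
      and "is_partition \<mu>' \<and> (\<exists>w\<in>S_inf. \<alpha> = perm_act w \<mu>')"
    then obtain w w' where "is_partition \<mu>" "is_partition \<mu>'" "w \<in> S_inf" "w' \<in> S_inf"
      "\<alpha> = perm_act w \<mu>" "\<alpha> = perm_act w' \<mu>'" by blast
    then show "\<mu> = \<mu>'" using partition_unique[of \<mu> \<mu>' w w'] by simp
  qed
  from theI'[OF this] show ?thesis unfolding sort_comp_def .
qed

text \<open>Otherwise \<open>u s\<^sub>i\<close> would be a shorter permutation with the same effect on \<open>\<mu>\<close>.\<close>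

lemma minimal_sorter_increasing:
  assumes u: "u \<in> S_inf" and min: "\<And>v. v \<in> S_inf \<Longrightarrow> perm_act v \<mu> = perm_act u \<mu> \<Longrightarrow> perm_length u \<le> perm_length v"
    and i: "1 \<le> i" "\<mu> i = \<mu> (i + 1)"
  shows "u i < u (i + 1)"
proof (rule ccontr)
  assume "\<not> u i < u (i + 1)"
  moreover have "u i \<noteq> u (i + 1)" using bij_is_inj[OF S_inf_bij[OF u]] by (simp add: inj_eq)
  ultimately have desc: "u i > u (i + 1)" by simp
  obtain n where n: "u permutes {1..n}" using u S_inf_iff by blast
  have us: "u \<circ> s i \<in> S_inf" using S_inf_comp[OF u S_inf_s[OF i(1)]] .
  have "inv (u \<circ> s i) = s i \<circ> inv u"
    using S_inf_bij[OF u] by (subst o_inv_distrib) simp_all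
  moreover have "\<mu> \<circ> s i = \<mu>" using i(2) by (auto simp: fun_eq_iff transpose_if)
  ultimately have "perm_act (u \<circ> s i) \<mu> = perm_act u \<mu>"
    unfolding perm_act_def by (simp only: comp_assoc[symmetric])
  then have "perm_length u \<le> perm_length (u \<circ> s i)" using us by (rule min[rotated])
  then show False
    using inv_count_comp_s(2)[OF n i(1) desc] perm_length_eq_inv_count[OF u] perm_length_eq_inv_count[OF us] by simp
qed

text \<open>Both permutations map each level set of \<open>\<mu>\<close>, which consists of consecutive indices, increasingly onto
  the same set.\<close>

lemma increasing_sorter_unique:
  assumes u: "u \<in> S_inf" and v: "v \<in> S_inf" and eq: "perm_act u \<mu> = perm_act v \<mu>" and \<mu>: "is_partition \<mu>"
    and incu: "\<And>i. 1 \<le> i \<Longrightarrow> \<mu> i = \<mu> (i + 1) \<Longrightarrow> u i < u (i + 1)"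
    and incv: "\<And>i. 1 \<le> i \<Longrightarrow> \<mu> i = \<mu> (i + 1) \<Longrightarrow> v i < v (i + 1)"
  shows "u = v"
proof
  fix i
  have mono: "w i < w j" if w: "\<And>i. 1 \<le> i \<Longrightarrow> \<mu> i = \<mu> (i + 1) \<Longrightarrow> w i < w (i + 1)"
    and ij: "1 \<le> i" "i < j" "\<mu> i = \<mu> j" for w :: "nat \<Rightarrow> nat" and i j
  proof -
    have const: "\<mu> k = \<mu> i" if "i \<le> k" "k \<le> j" for k
      using is_partition_antimono[OF \<mu> ij(1) that(1)] is_partition_antimono[OF \<mu> _ that(2)] that ij by simp
    have "k \<le> j \<longrightarrow> w i < w k" if "Suc i \<le> k" for k
      using that
    proof (induction rule: dec_induct)
      case base
      then show ?case using w[of i] const[of "Suc i"] ij by simp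
    next
      case (step k)
      then show ?case using w[of k] const[of k] const[of "Suc k"] ij by auto
    qed
    then show ?thesis using ij by simp
  qed
  \<comment> \<open>At the first index \<open>i\<close> where they differ, the value \<open>u i\<close> would have to be attained by \<open>v\<close> at an
    index \<open>k\<close> of the same level, which can lie neither before nor after \<open>i\<close>.\<close>
  have step: "\<not> u i < v i"
    if u: "u \<in> S_inf" and v: "v \<in> S_inf" and eq: "perm_act u \<mu> = perm_act v \<mu>" and i: "1 \<le> i"
      and incv: "\<And>i. 1 \<le> i \<Longrightarrow> \<mu> i = \<mu> (i + 1) \<Longrightarrow> v i < v (i + 1)"
      and IH: "\<And>k. k < i \<Longrightarrow> u k = v k" for u v i
  proof
    assume less: "u i < v i"
    have bu: "bij u" and bv: "bij v" using u v S_inf_bij by auto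
    define k where "k = inv v (u i)"
    have vk: "v k = u i" using bv by (simp add: k_def bij_is_surj surj_f_inv_f)
    have "perm_act u \<mu> (u i) = \<mu> i" using bu by (simp add: perm_act_def bij_is_inj)
    then have "perm_act v \<mu> (u i) = \<mu> i" by (simp only: eq)
    then have \<mu>k: "\<mu> i = \<mu> k" by (simp add: perm_act_def k_def)
    obtain n where n: "v permutes {1..n}" using v S_inf_iff by blast
    obtain n' where n': "u permutes {1..n'}" using u S_inf_iff by blast
    have k1: "1 \<le> k" using permutes_pos[OF n' i] permutes_0[OF n] vk by (cases k) auto
    consider "k < i" | "k = i" | "i < k" by linarith
    then show False
    proof cases
      case 1
      then have "u k = u i" using IH vk by simp
      then show False using bij_is_inj[OF bu] 1 by (simp add: inj_eq)
    next
      case 2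
      then show False using vk less by simp
    next
      case 3
      then have "v i < v k" using mono[where w = v, OF incv i 3 \<mu>k] by simp
      then show False using vk less by simp
    qed
  qed
  show "u i = v i"
  proof (induction i rule: less_induct)
    case (less i)
    show ?case
    proof (cases "i = 0")
      case True
      then show ?thesis using u v S_inf_iff permutes_0 by metis
    next
      case False
      then have i: "1 \<le> i" by simp
      have "\<not> u i < v i" using u v eq i incv less by (rule step)
      moreover have "\<not> v i < u i" using v u eq[symmetric] i incu less[symmetric] by (rule step)
      ultimately show ?thesis by simp
    qed
  qed
qed

lemma min_sorter_in_S_inf:
  assumes "weak_composition \<alpha>"
  shows "min_sorter \<alpha> \<in> S_inf"
proof -
  let ?\<mu> = "sort_comp \<alpha>"
  let ?P = "\<lambda>u. u \<in> S_inf \<and> \<alpha> = perm_act u ?\<mu> \<and>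
       (\<forall>v\<in>S_inf. \<alpha> = perm_act v ?\<mu> \<longrightarrow> perm_length u \<le> perm_length v)"
  have \<mu>: "is_partition ?\<mu>" using sort_comp_properties[OF assms] by blast
  obtain w where "w \<in> S_inf \<and> \<alpha> = perm_act w ?\<mu>" using sort_comp_properties[OF assms] by blast
  then have "\<exists>u. (u \<in> S_inf \<and> \<alpha> = perm_act u ?\<mu>) \<and>
      (\<forall>v. v \<in> S_inf \<and> \<alpha> = perm_act v ?\<mu> \<longrightarrow> perm_length u \<le> perm_length v)"
    by (rule ex_has_least_nat[where P = "\<lambda>u. u \<in> S_inf \<and> \<alpha> = perm_act u (sort_comp \<alpha>)"])
  then have ex: "\<exists>u. ?P u" by blast
  have "\<exists>!u. ?P u"
  proof (rule ex_ex1I[OF ex])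
    fix u v assume u: "?P u" and v: "?P v"
    show "u = v"
    proof (rule increasing_sorter_unique[OF _ _ _ \<mu>])
      show "u \<in> S_inf" "v \<in> S_inf" "perm_act u ?\<mu> = perm_act v ?\<mu>" using u v by auto
      show "u i < u (i + 1)" if "1 \<le> i" "?\<mu> i = ?\<mu> (i + 1)" for i
        using that u by (intro minimal_sorter_increasing[of u ?\<mu> i]) auto
      show "v i < v (i + 1)" if "1 \<le> i" "?\<mu> i = ?\<mu> (i + 1)" for i
        using that v by (intro minimal_sorter_increasing[of v ?\<mu> i]) auto
    qed
  qed
  from theI'[OF this] have "?P (min_sorter \<alpha>)" unfolding min_sorter_def .
  then show ?thesis by blast
qed

text \<open>A strict partition can be recovered from the set of its parts, because \<open>\<nu>\<^sub>i\<close> is the \<open>i\<close>-th largest of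
  them.\<close>

lemma strict_partition_rank:
  assumes \<nu>: "strict_partition \<nu>" and i: "\<nu> i \<noteq> 0"
  shows "card {v \<in> {\<nu> i |i. \<nu> i \<noteq> 0}. \<nu> i \<le> v} = i"
proof -
  have supp: "{i. \<nu> i \<noteq> 0} = {1..parts_length \<nu>}"
    using \<nu> by (intro partition_support) (simp add: strict_partition_def)
  have il: "1 \<le> i" "i \<le> parts_length \<nu>" using i supp by auto
  have "{v \<in> {\<nu> i |i. \<nu> i \<noteq> 0}. \<nu> i \<le> v} = \<nu> ` {1..i}"
  proof (intro equalityI subsetI)
    fix v assume "v \<in> {v \<in> {\<nu> i |i. \<nu> i \<noteq> 0}. \<nu> i \<le> v}"
    then obtain k where k: "v = \<nu> k" "\<nu> k \<noteq> 0" "\<nu> i \<le> \<nu> k" by blast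
    have "1 \<le> k" using k supp by auto
    have "k \<le> i"
    proof (rule ccontr)
      assume "\<not> k \<le> i"
      then have "\<nu> k < \<nu> i" using strict_partition_less[OF \<nu> il(1) _ i] by simp
      then show False using k by simp
    qed
    then show "v \<in> \<nu> ` {1..i}" using k \<open>1 \<le> k\<close> by auto
  next
    fix v assume "v \<in> \<nu> ` {1..i}"
    then obtain k where k: "v = \<nu> k" "1 \<le> k" "k \<le> i" by auto
    have "\<nu> i \<le> \<nu> k" using \<nu> k by (auto simp: strict_partition_def intro: is_partition_antimono[of \<nu> k i])
    then show "v \<in> {v \<in> {\<nu> i |i. \<nu> i \<noteq> 0}. \<nu> i \<le> v}" using k i by auto
  qed
  moreover have "inj_on \<nu> {1..i}"
    using \<nu> il supp by (auto simp: strict_partition_def elim: inj_on_subset)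
  ultimately show ?thesis by (simp add: card_image)
qed

lemma strict_partition_unique:
  assumes \<nu>: "strict_partition \<nu>" and \<nu>': "strict_partition \<nu>'"
    and eq: "{\<nu> i |i. \<nu> i \<noteq> 0} = {\<nu>' i |i. \<nu>' i \<noteq> 0}"
  shows "\<nu> = \<nu>'"
proof
  fix i
  have *: "\<nu>' i = \<nu> i" if "\<nu> i \<noteq> 0" and \<nu>: "strict_partition \<nu>" and \<nu>': "strict_partition \<nu>'"
    and eq: "{\<nu> i |i. \<nu> i \<noteq> 0} = {\<nu>' i |i. \<nu>' i \<noteq> 0}" for \<nu> \<nu>'
  proof -
    have "\<nu> i \<in> {\<nu>' i |i. \<nu>' i \<noteq> 0}" using that(1) eq by blast
    then obtain j where j: "\<nu>' j \<noteq> 0" "\<nu> i = \<nu>' j" by blast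
    have "card {v \<in> {\<nu> i |i. \<nu> i \<noteq> 0}. \<nu> i \<le> v} = j"
      unfolding eq j(2) by (rule strict_partition_rank[OF \<nu>' j(1)])
    then have "i = j" using strict_partition_rank[OF \<nu> that(1)] by (rule trans[OF sym, rotated])
    with j show ?thesis by simp
  qed
  show "\<nu> i = \<nu>' i"
  proof (cases "\<nu> i = 0")
    case True
    show ?thesis
    proof (cases "\<nu>' i = 0")
      case False
      then show ?thesis using *[OF _ \<nu>' \<nu> eq[symmetric]] by simp
    qed (simp add: True)
  next
    case False
    then show ?thesis using *[OF _ \<nu> \<nu>' eq] by simp
  qed
qed

text \<open>The nonzero numbers \<open>\<mu>\<^sub>i - i\<close> come in strictly decreasing order.\<close>

lemma half_lt_strict:
  assumes \<mu>: "is_partition \<mu>"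
  shows "strict_partition (half_lt \<mu>)"
proof -
  let ?P = "\<lambda>\<nu>. strict_partition \<nu> \<and> {\<nu> i |i. \<nu> i \<noteq> 0} = {\<mu> i - i |i. 1 \<le> i \<and> i < \<mu> i}"
  define \<nu> where "\<nu> i = (if i = 0 then 0 else \<mu> i - i)" for i
  have dec: "\<nu> (i + 1) \<le> \<nu> i" if "1 \<le> i" for i
    using is_partition_antimono[OF \<mu> that, of "i + 1"] that by (simp add: \<nu>_def)
  have "finite {i. \<mu> i \<noteq> 0}" using \<mu> by (simp add: is_partition_def weak_composition_def)
  then have fin: "finite {i. \<nu> i \<noteq> 0}" by (rule rev_finite_subset) (auto simp: \<nu>_def)
  have part: "is_partition \<nu>"
    unfolding is_partition_def weak_composition_def using dec fin by (auto simp: \<nu>_def)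
  have less: "\<nu> j < \<nu> i" if "i < j" "\<nu> i \<noteq> 0" for i j
  proof -
    have "1 \<le> i" using that by (auto simp: \<nu>_def intro: ccontr)
    then show ?thesis using is_partition_antimono[OF \<mu>, of i j] that by (simp add: \<nu>_def)
  qed
  have "inj_on \<nu> {i. \<nu> i \<noteq> 0}"
  proof (rule inj_onI)
    fix i j assume "i \<in> {i. \<nu> i \<noteq> 0}" "j \<in> {i. \<nu> i \<noteq> 0}" "\<nu> i = \<nu> j"
    then show "i = j" using less[of i j] less[of j i] by (cases i j rule: linorder_cases) auto
  qed
  with part have st: "strict_partition \<nu>" by (simp add: strict_partition_def)
  have "{\<nu> i |i. \<nu> i \<noteq> 0} = {\<mu> i - i |i. 1 \<le> i \<and> i < \<mu> i}"
  proof (intro equalityI subsetI)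
    fix x assume "x \<in> {\<nu> i |i. \<nu> i \<noteq> 0}"
    then obtain i where i: "x = \<nu> i" "\<nu> i \<noteq> 0" by blast
    then have "x = \<mu> i - i" "1 \<le> i" "i < \<mu> i" by (auto simp: \<nu>_def split: if_splits)
    then show "x \<in> {\<mu> i - i |i. 1 \<le> i \<and> i < \<mu> i}" by blast
  next
    fix x assume "x \<in> {\<mu> i - i |i. 1 \<le> i \<and> i < \<mu> i}"
    then obtain i where i: "x = \<mu> i - i" "1 \<le> i" "i < \<mu> i" by blast
    then have "x = \<nu> i" "\<nu> i \<noteq> 0" by (auto simp: \<nu>_def)
    then show "x \<in> {\<nu> i |i. \<nu> i \<noteq> 0}" by blast
  qed
  with st have P\<nu>: "?P \<nu>" by blast
  have "\<exists>!\<nu>. ?P \<nu>"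
  proof (rule ex1I)
    show "?P \<nu>" by (rule P\<nu>)
  next
    fix \<xi> assume \<xi>: "?P \<xi>"
    show "\<xi> = \<nu>"
    proof (rule strict_partition_unique)
      show "strict_partition \<xi>" using \<xi> by (rule conjunct1)
      show "strict_partition \<nu>" by (rule st)
      show "{\<xi> i |i. \<xi> i \<noteq> 0} = {\<nu> i |i. \<nu> i \<noteq> 0}"
        using \<xi>[THEN conjunct2] P\<nu>[THEN conjunct2] by (rule trans[OF _ sym])
    qed
  qed
  from theI'[OF this] have "?P (half_lt \<mu>)" unfolding half_lt_def .
  then show ?thesis by blast
qed

section \<open>P-key polynomials\<close>

text \<open>The operator of the sorting permutation is absorbed by the symmetrizer once \<open>n\<close> is large enough for
  this permutation to lie in \<open>S\<^sub>n\<close>.\<close>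

lemma P_key_symmetrization:
  assumes "skew_symmetric \<alpha>"
  shows "\<exists>\<nu> N d. strict_partition \<nu> \<and> (\<forall>n\<ge>N. P_key \<alpha> \<in> poly_space n d \<and>
    pi_perm (w_rev n) (P_key \<alpha>) = pi_perm (w_rev n) (staircase_poly \<nu>))"
proof -
  let ?\<nu> = "half_lt (sort_comp \<alpha>)"
  have wc: "weak_composition \<alpha>" "is_partition (sort_comp \<alpha>)"
    using assms by (auto simp: skew_symmetric_def skew_symmetric_partition_def)
  have \<nu>: "strict_partition ?\<nu>" using wc(2) by (rule half_lt_strict)
  obtain k where k: "min_sorter \<alpha> permutes {1..k}" using min_sorter_in_S_inf[OF wc(1)] S_inf_iff by blast
  obtain ws where ws: "ws \<in> lists {1..<k}" "\<And>f. pi_perm (min_sorter \<alpha>) f = foldr pi_op ws f"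
    using pi_perm_word[OF k] by blast
  have P: "P_key \<alpha> = foldr pi_op ws (staircase_poly ?\<nu>)"
    unfolding P_key_def staircase_poly_def by (rule ws(2))
  define N where "N = max k (Suc (?\<nu> 1))"
  have "P_key \<alpha> \<in> poly_space n (card (diagram ?\<nu>)) \<and>
    pi_perm (w_rev n) (P_key \<alpha>) = pi_perm (w_rev n) (staircase_poly ?\<nu>)" if n: "N \<le> n" for n
  proof
    have ws': "ws \<in> lists {1..<n}" using ws(1) n by (auto simp: N_def in_lists_conv_set)
    have sp: "staircase_poly ?\<nu> \<in> poly_space n (card (diagram ?\<nu>))"
      using \<nu> n by (intro staircase_poly_space) (auto simp: N_def)
    show Psp: "P_key \<alpha> \<in> poly_space n (card (diagram ?\<nu>))"
      unfolding P using ws' sp by (rule foldr_pi_op_space)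
    have inj: "inj_on generic {1..n}" by (auto simp: inj_on_def generic_inj)
    show "pi_perm (w_rev n) (P_key \<alpha>) = pi_perm (w_rev n) (staircase_poly ?\<nu>)"
    proof (rule zpoly_eq_by_generic_eval)
      show "eval_poly generic (pi_perm (w_rev n) (P_key \<alpha>)) = eval_poly generic (pi_perm (w_rev n) (staircase_poly ?\<nu>))"
        unfolding eval_pi_w_rev[OF Psp inj] eval_pi_w_rev[OF sp inj] unfolding P
        using ws' card_image[OF inj] by (intro symmetrize_word) auto
    qed
  qed
  with \<nu> show ?thesis by blast
qed

lemma symmetrize_sum: "symmetrize (\<Sum>i\<in>I. f i) A = (\<Sum>i\<in>I. symmetrize (f i) A)"
  unfolding symmetrize_def eval_poly_sum sum_distrib_right by (rule sum.swap)

text \<open>By linear independence, the multiplicity of each strict partition among the half partitions of the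
  summands is 1 for \<open>\<mu>\<close> and 0 for all others, so there is just one summand.\<close>

lemma P_key_sum_single:
  assumes \<mu>: "strict_partition \<mu>" and fin: "finite A" and skew: "\<And>\<alpha>. \<alpha> \<in> A \<Longrightarrow> skew_symmetric \<alpha>"
    and eq: "\<And>n. N \<le> n \<Longrightarrow> pi_perm (w_rev n) (\<Sum>\<alpha>\<in>A. P_key \<alpha>) = pi_perm (w_rev n) (staircase_poly \<mu>)"
  shows "\<exists>\<alpha>. A = {\<alpha>}"
proof -
  have "\<forall>\<alpha>\<in>A. \<exists>\<nu> N d. strict_partition \<nu> \<and> (\<forall>n\<ge>N. P_key \<alpha> \<in> poly_space n d \<and>
    pi_perm (w_rev n) (P_key \<alpha>) = pi_perm (w_rev n) (staircase_poly \<nu>))"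
    by (intro ballI P_key_symmetrization skew)
  then obtain \<nu> M d where \<nu>: "\<And>\<alpha>. \<alpha> \<in> A \<Longrightarrow> strict_partition (\<nu> \<alpha>)"
    and sp: "\<And>\<alpha> n. \<alpha> \<in> A \<Longrightarrow> M \<alpha> \<le> n \<Longrightarrow> P_key \<alpha> \<in> poly_space n (d \<alpha>)"
    and sym: "\<And>\<alpha> n. \<alpha> \<in> A \<Longrightarrow> M \<alpha> \<le> n \<Longrightarrow> pi_perm (w_rev n) (P_key \<alpha>) = pi_perm (w_rev n) (staircase_poly (\<nu> \<alpha>))"
    by metis
  \<comment> \<open>Beyond \<open>K\<close> variables, all the symmetrizations involved are given by Schur \<open>P\<close>-functions.\<close>
  define K where "K = Suc (Max (insert N (insert (\<mu> 1) (M ` A \<union> (\<lambda>\<alpha>. \<nu> \<alpha> 1) ` A))))"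
  have K: "x < K" if "x \<in> insert N (insert (\<mu> 1) (M ` A \<union> (\<lambda>\<alpha>. \<nu> \<alpha> 1) ` A))" for x
    unfolding K_def less_Suc_eq_le using fin that by (intro Max_ge) auto
  define f where "f \<alpha> = parts (\<nu> \<alpha>)" for \<alpha>
  have id: "(\<Sum>\<alpha>\<in>A. schur_P_at (f \<alpha>) B) = schur_P_at (parts \<mu>) B"
    if B: "antipode_free B" "K \<le> card B" for B :: "rat set"
  proof -
    have "finite B" using B by (simp add: antipode_free_def)
    then obtain a where a: "bij_betw a {1..card B} B" using ex_bij_betw_nat_finite_1 by blast
    define n where "n = card B"
    have inj: "inj_on a {1..n}" and im: "a ` {1..n} = B" using a by (auto simp: bij_betw_def n_def)
    have af: "antipode_free (a ` {1..n})" using B im by simp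
    have n: "x < n" if "x \<in> insert N (insert (\<mu> 1) (M ` A \<union> (\<lambda>\<alpha>. \<nu> \<alpha> 1) ` A))" for x
      using K[OF that] B(2) by (simp add: n_def)
    have summand: "symmetrize (P_key \<alpha>) B = schur_P_at (f \<alpha>) B" if \<alpha>: "\<alpha> \<in> A" for \<alpha>
    proof -
      have Mn: "M \<alpha> \<le> n" "\<nu> \<alpha> 1 < n" using n[of "M \<alpha>"] n[of "\<nu> \<alpha> 1"] \<alpha> by auto
      have "symmetrize (P_key \<alpha>) B = eval_poly a (pi_perm (w_rev n) (P_key \<alpha>))"
        using eval_pi_w_rev[OF sp[OF \<alpha> Mn(1)] inj] im by simp
      also have "\<dots> = schur_P_at (f \<alpha>) B"
        unfolding sym[OF \<alpha> Mn(1)] f_def using eval_pi_w_rev_staircase[OF \<nu>[OF \<alpha>] Mn(2) inj af] im by simp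
      finally show ?thesis .
    qed
    define e where "e = Max (insert 0 (d ` A))"
    have "(\<Sum>\<alpha>\<in>A. P_key \<alpha>) \<in> poly_space n e"
    proof (rule poly_space_sum)
      fix \<alpha> assume \<alpha>: "\<alpha> \<in> A"
      then have "M \<alpha> \<le> n" using n[of "M \<alpha>"] by auto
      then have "P_key \<alpha> \<in> poly_space n (d \<alpha>)" using \<alpha> sp by blast
      then show "P_key \<alpha> \<in> poly_space n e"
        by (rule poly_space_mono) (use \<alpha> fin in \<open>auto simp: e_def intro: Max_ge\<close>)
    qed
    then have "symmetrize (\<Sum>\<alpha>\<in>A. P_key \<alpha>) B = eval_poly a (pi_perm (w_rev n) (\<Sum>\<alpha>\<in>A. P_key \<alpha>))"
      using eval_pi_w_rev[OF _ inj] im by simp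
    also have "\<dots> = eval_poly a (pi_perm (w_rev n) (staircase_poly \<mu>))"
      using eq[of n] n[of N] by simp
    also have "\<dots> = schur_P_at (parts \<mu>) B"
      using eval_pi_w_rev_staircase[OF \<mu> _ inj af] n[of "\<mu> 1"] im by simp
    finally show ?thesis using summand by (simp add: symmetrize_sum)
  qed
  define Q where "Q = insert (parts \<mu>) (f ` A)"
  define c where "c \<rho> = of_nat (card {\<alpha> \<in> A. f \<alpha> = \<rho>}) - (if \<rho> = parts \<mu> then 1 else 0 :: rat)" for \<rho>
  have zero: "c \<rho> = 0" if \<rho>: "\<rho> \<in> Q" for \<rho>
  proof (rule schur_P_at_linear_independence[where M = Q and n = K and c = c])
    show "finite Q" using fin by (simp add: Q_def)
    show "strict_parts \<rho>" if "\<rho> \<in> Q" for \<rho>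
      using that \<mu> \<nu> by (auto simp: Q_def f_def strict_parts_parts)
    fix B :: "rat set" assume B: "antipode_free B" "K \<le> card B"
    have "(\<Sum>\<rho>\<in>Q. of_nat (card {\<alpha> \<in> A. f \<alpha> = \<rho>}) * schur_P_at \<rho> B) = (\<Sum>\<rho>\<in>Q. \<Sum>\<alpha>\<in>{\<alpha> \<in> A. f \<alpha> = \<rho>}. schur_P_at (f \<alpha>) B)"
      by (intro sum.cong refl) simp
    also have "\<dots> = (\<Sum>\<alpha>\<in>A. schur_P_at (f \<alpha>) B)"
      using fin by (intro sum.group) (auto simp: Q_def)
    also have "\<dots> = schur_P_at (parts \<mu>) B" using B by (rule id)
    also have "\<dots> = (\<Sum>\<rho>\<in>Q. (if \<rho> = parts \<mu> then 1 else 0) * schur_P_at \<rho> B)"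
    proof -
      have "(\<Sum>\<rho>\<in>Q. (if \<rho> = parts \<mu> then 1 else 0) * schur_P_at \<rho> B) = (if parts \<mu> = parts \<mu> then 1 else 0) * schur_P_at (parts \<mu>) B"
        using fin by (intro sum_eq_single_term) (auto simp: Q_def)
      then show ?thesis by simp
    qed
    finally show "(\<Sum>\<rho>\<in>Q. c \<rho> * schur_P_at \<rho> B) = 0"
      by (simp add: c_def left_diff_distrib sum_subtractf)
  qed (rule \<rho>)
  have "f \<alpha> = parts \<mu>" if \<alpha>: "\<alpha> \<in> A" for \<alpha>
  proof (rule ccontr)
    assume "f \<alpha> \<noteq> parts \<mu>"
    then have "card {\<beta> \<in> A. f \<beta> = f \<alpha>} = 0" using zero[of "f \<alpha>"] \<alpha> by (simp add: c_def Q_def)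
    then show False using fin \<alpha> by auto
  qed
  then have "{\<alpha> \<in> A. f \<alpha> = parts \<mu>} = A" by auto
  then have "card A = 1" using zero[of "parts \<mu>"] by (simp add: c_def Q_def)
  then show ?thesis by (simp add: card_1_singleton_iff)
qed

theorem proposition2p40:
  fixes S :: "(nat \<Rightarrow> nat) \<Rightarrow> zpoly" and y :: "nat \<Rightarrow> nat"
  assumes "Sp_Schubert_family S"
    and "y \<in> I_fpf"
  shows "((\<exists>\<alpha>. skew_symmetric \<alpha> \<and> S y = P_key \<alpha>) \<longrightarrow> fpf_vexillary S y) \<and>
    ((\<forall>v\<in>I_fpf. \<exists>A. finite A \<and> (\<forall>\<alpha>\<in>A. skew_symmetric \<alpha>) \<and> inj_on P_key A \<and>
        S v = (\<Sum>\<alpha>\<in>A. P_key \<alpha>)) \<longrightarrow>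
      fpf_vexillary S y \<longrightarrow> (\<exists>\<alpha>. skew_symmetric \<alpha> \<and> S y = P_key \<alpha>))"
proof (intro conjI impI)
  obtain n0 d where "S y \<in> poly_space n0 d" and sym: "symmetric_function (P_invol S y)"
    and res: "\<And>n. n0 \<le> n \<Longrightarrow> restrict_vars n (P_invol S y) = pi_perm (w_rev n) (S y)"
    by (rule P_invol_properties[OF assms]) (rule that)
  {
    assume "\<exists>\<alpha>. skew_symmetric \<alpha> \<and> S y = P_key \<alpha>"
    then obtain \<alpha> where \<alpha>: "skew_symmetric \<alpha>" "S y = P_key \<alpha>" by (elim exE conjE)
    obtain \<nu> N e where \<nu>: "strict_partition \<nu>"
      and N: "\<forall>n\<ge>N. P_key \<alpha> \<in> poly_space n e \<and>
        pi_perm (w_rev n) (P_key \<alpha>) = pi_perm (w_rev n) (staircase_poly \<nu>)"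
      using P_key_symmetrization[OF \<alpha>(1)] by (elim exE conjE)
    have "P_invol S y = schur_P \<nu>"
    proof (rule symmetric_function_eqI[OF sym schur_P_properties(1)[OF \<nu>]])
      fix n assume n: "max n0 (max N (Suc (\<nu> 1))) \<le> n"
      have "restrict_vars n (P_invol S y) = pi_perm (w_rev n) (P_key \<alpha>)"
        unfolding \<alpha>(2)[symmetric] by (rule res) (use n in simp)
      also have "\<dots> = pi_perm (w_rev n) (staircase_poly \<nu>)"
        using N n by simp
      also have "\<dots> = restrict_vars n (schur_P \<nu>)"
        by (rule schur_P_properties(2)[OF \<nu>, symmetric]) (use n in simp)
      finally show "restrict_vars n (P_invol S y) = restrict_vars n (schur_P \<nu>)" .
    qed
    with \<nu> show "fpf_vexillary S y" unfolding fpf_vexillary_def by (intro exI[of _ \<nu>] conjI)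
  }
  {
    assume "\<forall>v\<in>I_fpf. \<exists>A. finite A \<and> (\<forall>\<alpha>\<in>A. skew_symmetric \<alpha>) \<and> inj_on P_key A \<and> S v = (\<Sum>\<alpha>\<in>A. P_key \<alpha>)"
    from bspec[OF this assms(2)] obtain A where A: "finite A" "\<forall>\<alpha>\<in>A. skew_symmetric \<alpha>" "S y = (\<Sum>\<alpha>\<in>A. P_key \<alpha>)"
      by (elim exE conjE)
    assume "fpf_vexillary S y"
    then obtain \<mu> where \<mu>: "strict_partition \<mu>" "P_invol S y = schur_P \<mu>"
      unfolding fpf_vexillary_def by (elim exE conjE)
    have "\<exists>\<alpha>. A = {\<alpha>}"
    proof (rule P_key_sum_single[OF \<mu>(1) A(1)])
      fix n assume n: "max n0 (Suc (\<mu> 1)) \<le> n"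
      have "pi_perm (w_rev n) (\<Sum>\<alpha>\<in>A. P_key \<alpha>) = restrict_vars n (schur_P \<mu>)"
        unfolding A(3)[symmetric] \<mu>(2)[symmetric] by (rule res[symmetric]) (use n in simp)
      also have "\<dots> = pi_perm (w_rev n) (staircase_poly \<mu>)"
        by (rule schur_P_properties(2)[OF \<mu>(1)]) (use n in simp)
      finally show "pi_perm (w_rev n) (\<Sum>\<alpha>\<in>A. P_key \<alpha>) = pi_perm (w_rev n) (staircase_poly \<mu>)" .
    qed (use A(2) in blast)
    then obtain \<alpha> where "A = {\<alpha>}" by (elim exE)
    then have "skew_symmetric \<alpha>" "S y = P_key \<alpha>" using A(2,3) by simp_all
    then show "\<exists>\<alpha>. skew_symmetric \<alpha> \<and> S y = P_key \<alpha>" by (intro exI[of _ \<alpha>] conjI)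
  }
qed

end
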